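(* Let $$\mathcal{E}=\Big\{(x,y)\in\mathbb{R}^2:\ x=\frac{4\pi A(\Omega)}{P(\Omega)^2},\ y=\frac{E(\Omega)P(\Omega)}{2\pi^2},\ \Omega\in\mathcal{C}\Big\}.$$ If $(x_0,y_0)\in\mathcal{E}$, then $[x_0,1)\times[y_0,+\infty)\subset\mathcal{E}$. Moreover the half-line $\{(1,s):s\ge1\}$ is contained in the boundary of $\mathcal{E}$, and its intersection with $\mathcal{E}$ is the single point $(1,1)$.
   Context: Let $\mathcal{C}$ be the class of bounded open convex sets $\Omega\subset\mathbb{R}^2$ whose boundary, of length $P$, is parametrized by arc length with tangent angle $\theta\in W^{1,2}(0,P)$, $\theta'\ge0$ a.e., $\theta(P)=\theta(0)+2\pi$, $\int_0^P\cos\theta=\int_0^P\sin\theta=0$. Curvature $k=\theta'$, $E(\Omega)=\frac12\int_0^Pk^2ds$, $A$ area, $P$ perimeter. *)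

theory Defs
  imports "HOL-Analysis.Analysis"
begin

text \<open>Tangent angle theta(s) = theta0 + int_0^s k, with curvature k in L^2(0,P)
  (so theta is in W^{1,2}(0,P) with theta' = k).\<close>
definition tangent_angle :: "real \<Rightarrow> (real \<Rightarrow> real) \<Rightarrow> real \<Rightarrow> real" where
  "tangent_angle \<theta>0 k s = \<theta>0 + integral {0..s} k"

definition arc_curve :: "real \<times> real \<Rightarrow> (real \<Rightarrow> real) \<Rightarrow> real \<Rightarrow> real \<times> real" where
  "arc_curve p \<theta> s =
     (fst p + integral {0..s} (\<lambda>t. cos (\<theta> t)), snd p + integral {0..s} (\<lambda>t. sin (\<theta> t)))"

definition in_class_C :: "(real \<times> real) set \<Rightarrow> real \<Rightarrow> (real \<Rightarrow> real) \<Rightarrow> bool" where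
  "in_class_C \<Omega> P k \<longleftrightarrow>
     bounded \<Omega> \<and> open \<Omega> \<and> convex \<Omega> \<and> P > 0 \<and>
     k integrable_on {0..P} \<and> (\<lambda>s. (k s)\<^sup>2) integrable_on {0..P} \<and>
     (\<forall>s\<in>{0..P}. k s \<ge> 0) \<and>
     (\<exists>\<theta>0 p. tangent_angle \<theta>0 k P = \<theta>0 + 2 * pi \<and>
        integral {0..P} (\<lambda>s. cos (tangent_angle \<theta>0 k s)) = 0 \<and>
        integral {0..P} (\<lambda>s. sin (tangent_angle \<theta>0 k s)) = 0 \<and>
        frontier \<Omega> = arc_curve p (tangent_angle \<theta>0 k) ` {0..P} \<and>
        inj_on (arc_curve p (tangent_angle \<theta>0 k)) {0..<P})"

definition elastic_energy :: "real \<Rightarrow> (real \<Rightarrow> real) \<Rightarrow> real" where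
  "elastic_energy P k = integral {0..P} (\<lambda>s. (k s)\<^sup>2) / 2"

definition E_set :: "(real \<times> real) set" where
  "E_set = {(4 * pi * measure lebesgue \<Omega> / P\<^sup>2, elastic_energy P k * P / (2 * pi\<^sup>2)) | \<Omega> P k.
             in_class_C \<Omega> P k}"

end

theory Submission
  imports Defs
begin

text \<open>A curve of the class is recorded by its curvature \<open>k\<close>. Keeping the turning \<open>k ds\<close> and replacing the
  length element \<open>ds\<close> by \<open>v ds\<close> (\<open>v > 0\<close>) gives a new curve of the class as soon as the closure condition, which is
  linear in \<open>v\<close>, holds; the perimeter is linear in \<open>v\<close>, the area is a quadratic form \<open>B v v\<close>, and the energy is half the
  integral of \<open>k\<^sup>2 / v\<close>. Here \<open>v = k\<close> is the unit disc and lies in the kernel of the isoperimetric deficit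
  \<open>P\<^sup>2 - 4 \<pi> A\<close>.

  To increase \<open>x\<close>, take \<open>v = 1 + r k\<close>: the deficit stays fixed while the perimeter grows, and \<open>y\<close> does not increase.
  To increase \<open>y\<close> at fixed \<open>x < 1\<close>, take \<open>v = 1 - \<sigma> w + r k\<close> with \<open>w\<close> a step function supported on a short arc
  of small turning, orthogonal to the length, to the closure condition and to the first variation of the area, and equal to its
  maximum 1 on some subarc. Then the deficit increases with \<open>\<sigma>\<close>, \<open>r\<close> is determined by \<open>x\<close>, and as \<open>\<sigma>\<close> tends to 1
  the energy exceeds any given bound if the arc was short enough, so the intermediate value theorem applies.
  The case \<open>x = 1\<close> is the equality case of the isoperimetric inequality.\<close>

section \<open>Calculus of indefinite integrals\<close>

text \<open>The curvature is merely square integrable, so neither the tangent angle nor a new arc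
  length is differentiable everywhere; integration by parts, chain rule and substitution are
  therefore proved for indefinite integrals. The set is defined by domains, so it must also be shown
  that each closed curvature function bounds a convex domain whose area is the quadratic form.

  Adding \<open>r k\<close> to a weight adds a disc of radius \<open>r\<close>; constancy of the
  deficit is the Steiner formula. When \<open>y\<close> is raised, this disc also refills the arc
  that should be squeezed: on a subarc of turning \<open>\<epsilon>\<close> Cauchy-Schwarz bounds
  the energy below by \<open>\<epsilon>^2\<close> over the integral of \<open>v\<close>, and that
  integral contains \<open>r \<epsilon>\<close>. This is harmless because \<open>- B w w\<close>,
  hence \<open>r\<close>, is at most of order \<open>\<epsilon> \<eta>^2\<close> for an arc of
  length at most \<open>\<eta>\<close>. With \<open>\<sigma>\<close> close to 1 the bound is of
  order \<open>1 / \<eta>^2\<close>, whatever the size of \<open>\<epsilon>\<close>, which cannot be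
  prescribed. The assumption \<open>x < 1\<close> enters as positivity of the deficit: a zero
  deficit raised by \<open>w\<close> could not be restored in ratio by any \<open>r\<close>.\<close>

text \<open>Measured in the variable \<open>\<mu>\<close> instead of the parameter, \<open>D\<close>
  has derivative zero. This replaces the fundamental theorem for functions that are only indefinite
  integrals: \<open>D\<close> will be a claimed antiderivative minus the integral, and
  \<open>\<mu>\<close> the integral of an absolute value.\<close>

lemma constant_if_quadratic_increments:
  fixes D \<mu> :: "real \<Rightarrow> real"
  assumes ab: "a \<le> b" and cont: "continuous_on {a..b} \<mu>" and C: "C \<ge> 0"
    and incr: "\<And>s t. a \<le> s \<Longrightarrow> s \<le> t \<Longrightarrow> t \<le> b \<Longrightarrow> \<bar>D t - D s\<bar> \<le> C * (\<mu> t - \<mu> s)\<^sup>2"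
    and mono: "\<mu> a \<le> \<mu> b"
  shows "D b = D a"
proof -
  have "\<forall>y\<in>{\<mu> a..\<mu> b}. \<exists>t\<in>{a..b}. \<mu> t = y"
    using IVT'[of \<mu> a _ b] ab cont by fastforce
  then obtain \<psi> where \<psi>: "\<And>y. y \<in> {\<mu> a..\<mu> b} \<Longrightarrow> \<psi> y \<in> {a..b} \<and> \<mu> (\<psi> y) = y"
    by metis
  have incr': "\<bar>D t - D s\<bar> \<le> C * (\<mu> t - \<mu> s)\<^sup>2" if "s \<in> {a..b}" "t \<in> {a..b}" for s t
    using incr[of s t] incr[of t s] that by (cases "s \<le> t") (auto simp: power2_commute abs_minus_commute)
  have lip: "\<bar>D (\<psi> y) - D (\<psi> x)\<bar> \<le> C * (y - x)\<^sup>2" if "x \<in> {\<mu> a..\<mu> b}" "y \<in> {\<mu> a..\<mu> b}" for x y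
    using incr'[of "\<psi> x" "\<psi> y"] \<psi>[OF that(1)] \<psi>[OF that(2)] by auto
  have "((\<lambda>y. D (\<psi> y)) has_field_derivative 0) (at x within {\<mu> a..\<mu> b})" if x: "x \<in> {\<mu> a..\<mu> b}" for x
  proof -
    have "((\<lambda>y. (D (\<psi> y) - D (\<psi> x)) / (y - x)) \<longlongrightarrow> 0) (at x within {\<mu> a..\<mu> b})"
    proof (rule Lim_null_comparison)
      show "\<forall>\<^sub>F y in at x within {\<mu> a..\<mu> b}. norm ((D (\<psi> y) - D (\<psi> x)) / (y - x)) \<le> C * \<bar>y - x\<bar>"
      proof -
        have "norm ((D (\<psi> y) - D (\<psi> x)) / (y - x)) \<le> C * \<bar>y - x\<bar>" if "y \<in> {\<mu> a..\<mu> b}" "y \<noteq> x" for y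
          using lip[OF x that(1)] that(2)
          by (simp add: divide_simps power2_eq_square abs_mult_self mult.assoc)
        then show ?thesis by (simp add: eventually_at_filter)
      qed
      have "((\<lambda>y. C * \<bar>y - x\<bar>) \<longlongrightarrow> C * \<bar>x - x\<bar>) (at x within {\<mu> a..\<mu> b})"
        by (intro tendsto_intros)
      then show "((\<lambda>y. C * \<bar>y - x\<bar>) \<longlongrightarrow> 0) (at x within {\<mu> a..\<mu> b})" by simp
    qed
    then show ?thesis by (simp add: has_field_derivative_iff)
  qed
  then obtain c where c: "\<And>x. x \<in> {\<mu> a..\<mu> b} \<Longrightarrow> D (\<psi> x) = c"
    using has_field_derivative_zero_constant[of "{\<mu> a..\<mu> b}"] by (metis convex_real_interval(5))
  \<comment> \<open>The increment bound makes \<open>D\<close> constant on level sets of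
    \<open>\<mu>\<close>, so each end point may be exchanged for the representative of its level
    chosen by \<open>\<psi>\<close>.\<close>
  have "D s = c" if "s = a \<or> s = b" for s
  proof -
    have "\<mu> s \<in> {\<mu> a..\<mu> b}" using that mono by auto
    moreover have "D s = D (\<psi> (\<mu> s))"
      using incr'[of "\<psi> (\<mu> s)" s] that ab \<psi>[OF calculation] by auto
    ultimately show ?thesis using c by simp
  qed
  then show ?thesis by auto
qed

lemma absolutely_integrable_continuous_mult:
  fixes f g :: "real \<Rightarrow> real"
  assumes "continuous_on {a..b} f" "g absolutely_integrable_on {a..b}"
  shows "(\<lambda>x. f x * g x) absolutely_integrable_on {a..b}"
    "(\<lambda>x. g x * f x) absolutely_integrable_on {a..b}"
    "(\<lambda>x. f x * g x) integrable_on {a..b}"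
    "(\<lambda>x. g x * f x) integrable_on {a..b}"
proof -
  show 1: "(\<lambda>x. f x * g x) absolutely_integrable_on {a..b}"
    by (rule absolutely_integrable_bounded_measurable_product_real)
      (use assms in \<open>auto intro!: continuous_imp_measurable_on_sets_lebesgue compact_imp_bounded compact_continuous_image\<close>)
  then show 2: "(\<lambda>x. g x * f x) absolutely_integrable_on {a..b}"
    by (simp add: mult.commute)
  from 1 2 show "(\<lambda>x. f x * g x) integrable_on {a..b}" "(\<lambda>x. g x * f x) integrable_on {a..b}"
    by (auto intro: absolutely_integrable_on_def[THEN iffD1, THEN conjunct1])
qed

lemma abs_integral_mult_le:
  fixes f h :: "real \<Rightarrow> real"
  assumes f: "f absolutely_integrable_on {s..t}" and h: "continuous_on {s..t} h"
    and bound: "\<And>u. u \<in> {s..t} \<Longrightarrow> \<bar>h u\<bar> \<le> M"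
  shows "\<bar>integral {s..t} (\<lambda>u. f u * h u)\<bar> \<le> M * integral {s..t} (\<lambda>u. \<bar>f u\<bar>)"
proof -
  have ai: "(\<lambda>u. f u * h u) integrable_on {s..t}"
    using absolutely_integrable_continuous_mult(4)[OF h f] .
  have fi: "(\<lambda>u. \<bar>f u\<bar>) integrable_on {s..t}"
    using f by (auto simp: absolutely_integrable_on_def)
  have "norm (integral {s..t} (\<lambda>u. f u * h u)) \<le> integral {s..t} (\<lambda>u. M * \<bar>f u\<bar>)"
    by (rule integral_norm_bound_integral[OF ai])
      (use fi bound in \<open>auto simp: abs_mult mult.commute[of M] intro!: mult_left_mono integrable_on_mult_left\<close>)
  then show ?thesis by simp
qed

lemma integral_increment:
  fixes f :: "real \<Rightarrow> 'a::banach"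
  assumes "f integrable_on {a..b}" "a \<le> s" "s \<le> t" "t \<le> b"
  shows "integral {a..t} f - integral {a..s} f = integral {s..t} f"
    "f integrable_on {s..t}" "f integrable_on {a..t}"
proof -
  show "f integrable_on {s..t}" "f integrable_on {a..t}"
    using assms by (auto intro: integrable_on_subinterval)
  then show "integral {a..t} f - integral {a..s} f = integral {s..t} f"
    using Henstock_Kurzweil_Integration.integral_combine[of a s t f] assms by (simp add: algebra_simps)
qed

lemma absolutely_integrable_subinterval:
  fixes f :: "real \<Rightarrow> 'a::euclidean_space"
  assumes "f absolutely_integrable_on {a..b}" "a \<le> s" "t \<le> b"
  shows "f absolutely_integrable_on {s..t}"
  by (rule absolutely_integrable_on_subinterval[OF assms(1)]) (use assms in auto)

lemma abs_integral_subinterval_le: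
  fixes f :: "real \<Rightarrow> real"
  assumes f: "f absolutely_integrable_on {s..t}" and "s \<le> u" "v \<le> t"
  shows "\<bar>integral {u..v} f\<bar> \<le> integral {s..t} (\<lambda>x. \<bar>f x\<bar>)"
proof -
  have f': "f absolutely_integrable_on {u..v}"
    using absolutely_integrable_subinterval assms by blast
  have i: "f integrable_on {u..v}" "(\<lambda>x. \<bar>f x\<bar>) integrable_on {u..v}" "(\<lambda>x. \<bar>f x\<bar>) integrable_on {s..t}"
    using f f' by (auto simp: absolutely_integrable_on_def)
  have "norm (integral {u..v} f) \<le> integral {u..v} (\<lambda>x. \<bar>f x\<bar>)"
    by (rule integral_norm_bound_integral[OF i(1,2)]) auto
  also have "\<dots> \<le> integral {s..t} (\<lambda>x. \<bar>f x\<bar>)"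
    by (rule integral_subset_le[OF _ i(2,3)]) (use assms in auto)
  finally show ?thesis by simp
qed

lemma continuous_on_indefinite_integral:
  fixes f F :: "real \<Rightarrow> real"
  assumes "f integrable_on {a..b}" "\<And>s. s \<in> {a..b} \<Longrightarrow> F s = c + integral {a..s} f"
  shows "continuous_on {a..b} F"
proof -
  have "continuous_on {a..b} (\<lambda>s. c + integral {a..s} f)"
    by (intro continuous_intros indefinite_integral_continuous_1 assms)
  then show ?thesis using assms(2) by (subst continuous_on_cong[OF refl]) auto
qed

text \<open>On \<open>{s..t}\<close> the error is the integral of \<open>f (G t - G u)\<close> plus
  that of \<open>g (F s - F u)\<close>. With \<open>I\<close>, \<open>J\<close> the integrals of the
  absolute values of \<open>f\<close>, \<open>g\<close> it is at most \<open>2 I J\<close>, hence at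
  most \<open>(I + J)^2\<close>, which is quadratic in the increment of
  \<open>\<mu>\<close>.\<close>

lemma indefinite_integral_product_rule:
  fixes f g F G :: "real \<Rightarrow> real"
  assumes ab: "a \<le> b"
    and f: "f absolutely_integrable_on {a..b}" and g: "g absolutely_integrable_on {a..b}"
    and F: "\<And>s. s \<in> {a..b} \<Longrightarrow> F s = F a + integral {a..s} f"
    and G: "\<And>s. s \<in> {a..b} \<Longrightarrow> G s = G a + integral {a..s} g"
  shows "((\<lambda>s. f s * G s + F s * g s) has_integral F b * G b - F a * G a) {a..b}"
proof -
  have fi: "f integrable_on {a..b}" "(\<lambda>x. \<bar>f x\<bar>) integrable_on {a..b}"
    and gi: "g integrable_on {a..b}" "(\<lambda>x. \<bar>g x\<bar>) integrable_on {a..b}"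
    using f g by (auto simp: absolutely_integrable_on_def)
  have cF: "continuous_on {a..b} F" and cG: "continuous_on {a..b} G"
    by (rule continuous_on_indefinite_integral[OF fi(1) F], assumption)
      (rule continuous_on_indefinite_integral[OF gi(1) G], assumption)
  let ?h = "\<lambda>s. f s * G s + F s * g s"
  define \<mu> where "\<mu> s = integral {a..s} (\<lambda>u. \<bar>f u\<bar> + \<bar>g u\<bar>)" for s
  have mi: "(\<lambda>u. \<bar>f u\<bar> + \<bar>g u\<bar>) integrable_on {a..b}"
    using fi gi by (intro integrable_add) auto
  have hi: "?h integrable_on {a..b}"
    using absolutely_integrable_continuous_mult[OF cG f] absolutely_integrable_continuous_mult[OF cF g]
    by (intro integrable_add) auto
  define D where "D s = F s * G s - integral {a..s} ?h" for s
  have "D b = D a"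
  proof (rule constant_if_quadratic_increments[OF ab, where \<mu> = \<mu> and C = 1])
    show "continuous_on {a..b} \<mu>"
      unfolding \<mu>_def by (intro indefinite_integral_continuous_1 mi)
    show "\<mu> a \<le> \<mu> b"
      unfolding \<mu>_def using mi by (auto intro!: integral_nonneg)
    fix s t assume st: "a \<le> s" "s \<le> t" "t \<le> b"
    have dF: "F v - F u = integral {u..v} f" if "s \<le> u" "u \<le> v" "v \<le> t" for u v
      using F[of u] F[of v] integral_increment(1)[OF fi(1), of u v] that st by auto
    have dG: "G v - G u = integral {u..v} g" if "s \<le> u" "u \<le> v" "v \<le> t" for u v
      using G[of u] G[of v] integral_increment(1)[OF gi(1), of u v] that st by auto
    have f': "f absolutely_integrable_on {s..t}" and g': "g absolutely_integrable_on {s..t}"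
      using absolutely_integrable_subinterval f g st by blast+
    have fi': "f integrable_on {s..t}" "(\<lambda>x. \<bar>f x\<bar>) integrable_on {s..t}"
      and gi': "g integrable_on {s..t}" "(\<lambda>x. \<bar>g x\<bar>) integrable_on {s..t}"
      using f' g' by (auto simp: absolutely_integrable_on_def)
    have cF': "continuous_on {s..t} F" and cG': "continuous_on {s..t} G"
      using cF cG st by (auto elim: continuous_on_subset)
    define I where "I = integral {s..t} (\<lambda>u. \<bar>f u\<bar>)"
    define J where "J = integral {s..t} (\<lambda>u. \<bar>g u\<bar>)"
    have IJ: "I \<ge> 0" "J \<ge> 0" "\<mu> t - \<mu> s = I + J"
      unfolding I_def J_def \<mu>_def using integral_increment(1)[OF mi st] fi' gi'
      by (auto intro!: integral_nonneg simp: Henstock_Kurzweil_Integration.integral_add)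
    have bG: "\<bar>G t - G u\<bar> \<le> J" if "u \<in> {s..t}" for u
      using dG[of u t] that abs_integral_subinterval_le[OF g', of u t] by (auto simp: J_def)
    have bF: "\<bar>F s - F u\<bar> \<le> I" if "u \<in> {s..t}" for u
      using dF[of s u] that abs_integral_subinterval_le[OF f', of s u] by (auto simp: I_def)
    have i1: "(\<lambda>u. f u * (G t - G u)) integrable_on {s..t}" "(\<lambda>u. g u * (F s - F u)) integrable_on {s..t}"
      using f' g' cF' cG' by (auto intro!: absolutely_integrable_continuous_mult continuous_intros)
    have "integral {s..t} (\<lambda>u. f u * (G t - G u)) + integral {s..t} (\<lambda>u. g u * (F s - F u))
        = integral {s..t} (\<lambda>u. (f u * G t + F s * g u) - ?h u)"
      using i1 by (subst Henstock_Kurzweil_Integration.integral_add[symmetric]) (auto simp: algebra_simps)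
    also have "\<dots> = integral {s..t} (\<lambda>u. f u * G t + F s * g u) - integral {s..t} ?h"
      using integral_increment(2)[OF hi st] fi' gi'
      by (intro Henstock_Kurzweil_Integration.integral_diff) (auto intro!: integrable_add integrable_on_mult_left integrable_on_mult_right)
    also have "integral {s..t} (\<lambda>u. f u * G t + F s * g u) = (F t - F s) * G t + F s * (G t - G s)"
      using dF[of s t] dG[of s t] fi' gi' st
      by (subst Henstock_Kurzweil_Integration.integral_add) (auto intro!: integrable_on_mult_left integrable_on_mult_right)
    also have "(F t - F s) * G t + F s * (G t - G s) - integral {s..t} ?h = D t - D s"
      unfolding D_def using integral_increment(1)[OF hi st] by (simp add: algebra_simps)
    finally have "\<bar>D t - D s\<bar> \<le> \<bar>integral {s..t} (\<lambda>u. f u * (G t - G u))\<bar> + \<bar>integral {s..t} (\<lambda>u. g u * (F s - F u))\<bar>"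
      by linarith
    also have "\<dots> \<le> J * I + I * J"
      unfolding I_def J_def
      by (intro add_mono abs_integral_mult_le f' g')
        (use bF bG cF' cG' I_def J_def in \<open>auto intro!: continuous_intros\<close>)
    also have "\<dots> \<le> 1 * (\<mu> t - \<mu> s)\<^sup>2"
      using IJ by (simp add: power2_eq_square algebra_simps)
    finally show "\<bar>D t - D s\<bar> \<le> 1 * (\<mu> t - \<mu> s)\<^sup>2" .
  qed simp
  then have "integral {a..b} ?h = F b * G b - F a * G a"
    unfolding D_def by simp
  then show ?thesis using hi by (metis integrable_integral)
qed

text \<open>The mean value theorem writes the increment of \<open>h\<close> with \<open>h'\<close>
  at one point \<open>\<xi>\<close> between the two angles. The Lipschitz bound lets
  \<open>h' \<xi>\<close> be exchanged for \<open>h' (\<theta> u)\<close> at a cost of the variation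
  of \<open>\<theta>\<close>, so the error is again quadratic.\<close>

lemma indefinite_integral_chain_rule:
  fixes k \<theta> h h' :: "real \<Rightarrow> real"
  assumes ab: "a \<le> b" and k: "k absolutely_integrable_on {a..b}"
    and \<theta>: "\<And>s. s \<in> {a..b} \<Longrightarrow> \<theta> s = \<theta> a + integral {a..s} k"
    and h: "\<And>x. (h has_field_derivative h' x) (at x)"
    and lip: "\<And>x y. \<bar>h' x - h' y\<bar> \<le> \<bar>x - y\<bar>"
  shows "((\<lambda>s. k s * h' (\<theta> s)) has_integral h (\<theta> b) - h (\<theta> a)) {a..b}"
proof -
  have ki: "k integrable_on {a..b}" "(\<lambda>x. \<bar>k x\<bar>) integrable_on {a..b}"
    using k by (auto simp: absolutely_integrable_on_def)
  have c\<theta>: "continuous_on {a..b} \<theta>"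
    by (rule continuous_on_indefinite_integral[OF ki(1) \<theta>])
  have "1-lipschitz_on UNIV h'"
    using lip by (auto intro!: lipschitz_onI simp: dist_real_def)
  then have ch': "continuous_on X h'" for X
    using lipschitz_on_continuous_on continuous_on_subset by blast
  have c: "continuous_on {a..b} (\<lambda>s. h' (\<theta> s))"
    by (rule continuous_on_compose2[OF ch'[of UNIV] c\<theta>]) auto
  let ?g = "\<lambda>s. k s * h' (\<theta> s)"
  have gi: "?g integrable_on {a..b}" using absolutely_integrable_continuous_mult[OF c k] by simp
  define \<mu> where "\<mu> s = integral {a..s} (\<lambda>u. \<bar>k u\<bar>)" for s
  define D where "D s = h (\<theta> s) - integral {a..s} ?g" for s
  have "D b = D a"
  proof (rule constant_if_quadratic_increments[OF ab, where \<mu> = \<mu> and C = 1])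
    show "continuous_on {a..b} \<mu>"
      unfolding \<mu>_def by (intro indefinite_integral_continuous_1 ki)
    show "\<mu> a \<le> \<mu> b"
      unfolding \<mu>_def using ki by (auto intro!: integral_nonneg)
    fix s t assume st: "a \<le> s" "s \<le> t" "t \<le> b"
    have k': "k absolutely_integrable_on {s..t}"
      using absolutely_integrable_subinterval k st by blast
    have ki': "k integrable_on {s..t}" "(\<lambda>x. \<bar>k x\<bar>) integrable_on {s..t}"
      using k' by (auto simp: absolutely_integrable_on_def)
    have d\<theta>: "\<theta> v - \<theta> u = integral {u..v} k" if "s \<le> u" "u \<le> v" "v \<le> t" for u v
      using \<theta>[of u] \<theta>[of v] integral_increment(1)[OF ki(1), of u v] that st by auto
    define I where "I = integral {s..t} (\<lambda>u. \<bar>k u\<bar>)"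
    have I: "\<mu> t - \<mu> s = I" "I \<ge> 0"
      unfolding I_def \<mu>_def using integral_increment(1)[OF ki(2) st] ki' by (auto intro!: integral_nonneg)
    have b: "\<bar>\<theta> v - \<theta> u\<bar> \<le> I" if "s \<le> u" "u \<le> v" "v \<le> t" for u v
      using d\<theta>[of u v] that abs_integral_subinterval_le[OF k', of u v] by (auto simp: I_def)
    obtain \<xi> where \<xi>: "h (\<theta> t) - h (\<theta> s) = h' \<xi> * (\<theta> t - \<theta> s)" "min (\<theta> s) (\<theta> t) \<le> \<xi>" "\<xi> \<le> max (\<theta> s) (\<theta> t)"
    proof -
      consider "\<theta> s = \<theta> t" | "\<theta> s < \<theta> t" | "\<theta> t < \<theta> s" by linarith
      then show thesis
      proof cases
        case 1 then show ?thesis using that[of "\<theta> s"] by simp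
      next
        case 2
        from MVT2[OF 2 h] obtain z where "\<theta> s < z" "z < \<theta> t" "h (\<theta> t) - h (\<theta> s) = (\<theta> t - \<theta> s) * h' z" by blast
        then show ?thesis using that[of z] by (simp add: mult.commute)
      next
        case 3
        from MVT2[OF 3 h] obtain z where "\<theta> t < z" "z < \<theta> s" "h (\<theta> s) - h (\<theta> t) = (\<theta> s - \<theta> t) * h' z" by blast
        then show ?thesis using that[of z] by (simp add: algebra_simps)
      qed
    qed
    have c': "continuous_on {s..t} (\<lambda>u. h' \<xi> - h' (\<theta> u))"
      using st by (intro continuous_intros continuous_on_subset[OF c]) auto
    have "integral {s..t} (\<lambda>u. k u * (h' \<xi> - h' (\<theta> u))) = integral {s..t} (\<lambda>u. k u * h' \<xi> - ?g u)"
      by (simp add: algebra_simps)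
    also have "\<dots> = integral {s..t} (\<lambda>u. k u * h' \<xi>) - integral {s..t} ?g"
      using integral_increment(2)[OF gi st] ki'
      by (intro Henstock_Kurzweil_Integration.integral_diff) (auto intro!: integrable_on_mult_left)
    also have "\<dots> = D t - D s"
      unfolding D_def using integral_increment(1)[OF gi st] \<xi>(1) d\<theta>[of s t] st by (simp add: algebra_simps)
    finally have "\<bar>D t - D s\<bar> = \<bar>integral {s..t} (\<lambda>u. k u * (h' \<xi> - h' (\<theta> u)))\<bar>" by simp
    also have "\<dots> \<le> I * I"
    proof -
      have "\<bar>h' \<xi> - h' (\<theta> u)\<bar> \<le> I" if "u \<in> {s..t}" for u
        using lip[of \<xi> "\<theta> u"] b[of s u] b[of u t] b[of s t] \<xi>(2,3) that st by (auto simp: abs_if split: if_splits)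
      then show ?thesis
        using abs_integral_mult_le[OF k' c', of I] by (simp add: I_def)
    qed
    finally show "\<bar>D t - D s\<bar> \<le> 1 * (\<mu> t - \<mu> s)\<^sup>2" using I by (simp add: power2_eq_square)
  qed simp
  then have "integral {a..b} ?g = h (\<theta> b) - h (\<theta> a)"
    unfolding D_def by simp
  then show ?thesis using gi by (metis integrable_integral)
qed

section \<open>Convex closed curves given by their tangent angle\<close>

definition unit_dir :: "real \<Rightarrow> real \<times> real" where
  "unit_dir \<alpha> = (cos \<alpha>, sin \<alpha>)"

lemma inner_unit_dir: "(x, y) \<bullet> unit_dir \<alpha> = x * cos \<alpha> + y * sin \<alpha>"
  by (simp add: unit_dir_def inner_prod_def)

lemma unit_dir_nonzero: "unit_dir \<alpha> \<noteq> 0"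
proof -
  have "norm (unit_dir \<alpha>) = 1" by (simp add: unit_dir_def norm_Pair)
  then show ?thesis by force
qed

lemma eq_if_inner_unit_dir_eq:
  assumes "x \<bullet> unit_dir \<alpha> = y \<bullet> unit_dir \<alpha>"
    and "x \<bullet> unit_dir (\<alpha> + pi / 2) = y \<bullet> unit_dir (\<alpha> + pi / 2)"
  shows "x = y"
proof -
  obtain a b where ab: "x - y = (a, b)" by (cases "x - y")
  have "(x - y) \<bullet> unit_dir \<alpha> = 0" "(x - y) \<bullet> unit_dir (\<alpha> + pi / 2) = 0"
    using assms by (auto simp: inner_diff_left)
  then have 1: "a * cos \<alpha> + b * sin \<alpha> = 0" and 2: "- a * sin \<alpha> + b * cos \<alpha> = 0"
    by (auto simp: ab inner_unit_dir cos_add sin_add)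
  have "a = a * ((sin \<alpha>)\<^sup>2 + (cos \<alpha>)\<^sup>2)" by simp
  also have "\<dots> = cos \<alpha> * (a * cos \<alpha> + b * sin \<alpha>) - sin \<alpha> * (- a * sin \<alpha> + b * cos \<alpha>)"
    by algebra
  finally have "a = 0" using 1 2 by simp
  have "b = b * ((sin \<alpha>)\<^sup>2 + (cos \<alpha>)\<^sup>2)" by simp
  also have "\<dots> = sin \<alpha> * (a * cos \<alpha> + b * sin \<alpha>) + cos \<alpha> * (- a * sin \<alpha> + b * cos \<alpha>)"
    by algebra
  finally have "b = 0" using 1 2 by simp
  with \<open>a = 0\<close> ab show ?thesis by (simp add: zero_prod_def[symmetric])
qed

text \<open>The free window of length \<open>2 * pi\<close> is there to match the range of a tangent
  angle, so that the intermediate value theorem can reach the direction.\<close>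

lemma ex_unit_dir:
  fixes a :: "real \<times> real"
  assumes "a \<noteq> 0"
  obtains t where "\<beta> \<le> t" "t \<le> \<beta> + 2 * pi" "a = norm a *\<^sub>R unit_dir t"
proof -
  define x where "x = (a \<bullet> unit_dir \<beta>) / norm a"
  define y where "y = (a \<bullet> unit_dir (\<beta> + pi / 2)) / norm a"
  obtain a1 a2 where a: "a = (a1, a2)" by (cases a)
  have n: "norm a > 0" "(norm a)\<^sup>2 = a1\<^sup>2 + a2\<^sup>2" using assms by (simp, simp add: a norm_Pair)
  have "(norm a)\<^sup>2 * (x\<^sup>2 + y\<^sup>2) = (a1 * cos \<beta> + a2 * sin \<beta>)\<^sup>2 + (- a1 * sin \<beta> + a2 * cos \<beta>)\<^sup>2"
    using n(1) by (simp add: x_def y_def power_divide distrib_left a inner_unit_dir cos_add sin_add)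
  also have "\<dots> = (a1\<^sup>2 + a2\<^sup>2) * ((sin \<beta>)\<^sup>2 + (cos \<beta>)\<^sup>2)"
    by algebra
  finally have "(norm a)\<^sup>2 * (x\<^sup>2 + y\<^sup>2) = (norm a)\<^sup>2 * 1" using n(2) by simp
  then have "x\<^sup>2 + y\<^sup>2 = 1" using n(1) by (simp only: mult_cancel_left) simp
  then obtain t where t: "0 \<le> t" "t < 2 * pi" "x = cos t" "y = sin t"
    by (rule sincos_total_2pi)
  have "a = norm a *\<^sub>R unit_dir (\<beta> + t)"
  proof (rule eq_if_inner_unit_dir_eq[of _ \<beta>])
    have "cos (\<beta> + t) * cos \<beta> + sin (\<beta> + t) * sin \<beta> = cos t"
      using cos_diff[of "\<beta> + t" \<beta>] by simp
    then show "a \<bullet> unit_dir \<beta> = (norm a *\<^sub>R unit_dir (\<beta> + t)) \<bullet> unit_dir \<beta>"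
      using n(1) t(3) by (simp add: x_def unit_dir_def field_simps) (simp flip: distrib_left)
    have "cos (\<beta> + t) * cos (\<beta> + pi / 2) + sin (\<beta> + t) * sin (\<beta> + pi / 2) = sin t"
      using sin_diff[of "\<beta> + t" \<beta>] by (simp add: cos_add sin_add)
    then show "a \<bullet> unit_dir (\<beta> + pi / 2) = (norm a *\<^sub>R unit_dir (\<beta> + t)) \<bullet> unit_dir (\<beta> + pi / 2)"
      using n(1) t(4) by (simp add: y_def unit_dir_def field_simps) (simp flip: distrib_left)
  qed
  with t that[of "\<beta> + t"] show thesis by auto
qed

lemma sin_nonneg_shift: "-(2 * pi) \<le> d \<Longrightarrow> d \<le> - pi \<Longrightarrow> 0 \<le> sin d"
  using sin_ge_zero[of "d + 2 * pi"] by simp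

lemma sin_nonpos_shift: "- pi \<le> d \<Longrightarrow> d \<le> 0 \<Longrightarrow> sin d \<le> 0"
  using sin_ge_zero[of "- d"] by simp

lemma sin_nonpos_shift': "pi \<le> d \<Longrightarrow> d \<le> 2 * pi \<Longrightarrow> sin d \<le> 0"
  using sin_ge_zero[of "d - pi"] by (simp add: sin_diff)

text \<open>A continuous nondecreasing tangent angle carries all the geometry; curvature is
  connected to it in \<open>convex_closed_curve_tangent_angle\<close>.\<close>

locale convex_closed_curve =
  fixes P :: real and \<theta> :: "real \<Rightarrow> real" and p :: "real \<times> real"
  assumes P_pos: "P > 0"
    and cont_\<theta>: "continuous_on {0..P} \<theta>"
    and mono_\<theta>: "\<And>s t. 0 \<le> s \<Longrightarrow> s \<le> t \<Longrightarrow> t \<le> P \<Longrightarrow> \<theta> s \<le> \<theta> t"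
    and turning: "\<theta> P = \<theta> 0 + 2 * pi"
    and closed_cos: "integral {0..P} (\<lambda>s. cos (\<theta> s)) = 0"
    and closed_sin: "integral {0..P} (\<lambda>s. sin (\<theta> s)) = 0"
begin

definition \<gamma> :: "real \<Rightarrow> real \<times> real" where "\<gamma> = arc_curve p \<theta>"

abbreviation trace :: "(real \<times> real) set" where "trace \<equiv> \<gamma> ` {0..P}"

text \<open>Candidate for the closure of the domain. That passing to the hull creates no boundary
  outside the curve is \<open>frontier_region\<close>.\<close>

definition region :: "(real \<times> real) set" where "region = convex hull trace"

lemma \<gamma>_closed: "\<gamma> P = \<gamma> 0"
  by (simp add: \<gamma>_def arc_curve_def closed_cos closed_sin)

lemma cont_trig: "continuous_on {0..P} (\<lambda>s. cos (\<theta> s - \<alpha>))" "continuous_on {0..P} (\<lambda>s. sin (\<theta> s - \<alpha>))"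
  "continuous_on {0..P} (\<lambda>s. cos (\<theta> s))" "continuous_on {0..P} (\<lambda>s. sin (\<theta> s))"
  using cont_\<theta> by (auto intro!: continuous_intros)

lemma int_trig: "(\<lambda>s. cos (\<theta> s)) integrable_on {0..P}" "(\<lambda>s. sin (\<theta> s)) integrable_on {0..P}"
  by (auto intro!: integrable_continuous_real cont_trig)

lemma proj_increment:
  assumes "0 \<le> u" "u \<le> t" "t \<le> P"
  shows "\<gamma> t \<bullet> unit_dir \<alpha> - \<gamma> u \<bullet> unit_dir \<alpha> = integral {u..t} (\<lambda>x. cos (\<theta> x - \<alpha>))"
proof -
  have i: "(\<lambda>s. cos (\<theta> s)) integrable_on {u..t}" "(\<lambda>s. sin (\<theta> s)) integrable_on {u..t}"
    using integral_increment(2)[OF int_trig(1) assms] integral_increment(2)[OF int_trig(2) assms] by auto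
  have "\<gamma> t \<bullet> unit_dir \<alpha> - \<gamma> u \<bullet> unit_dir \<alpha> =
      integral {u..t} (\<lambda>s. cos (\<theta> s)) * cos \<alpha> + integral {u..t} (\<lambda>s. sin (\<theta> s)) * sin \<alpha>"
    unfolding integral_increment(1)[OF int_trig(1) assms, symmetric] integral_increment(1)[OF int_trig(2) assms, symmetric]
    by (simp add: \<gamma>_def arc_curve_def inner_unit_dir algebra_simps)
  also have "\<dots> = integral {u..t} (\<lambda>x. cos (\<theta> x) * cos \<alpha> + sin (\<theta> x) * sin \<alpha>)"
    using i by (subst Henstock_Kurzweil_Integration.integral_add) (auto intro!: integrable_on_mult_left)
  finally show ?thesis by (simp add: cos_diff)
qed

lemma normal_proj_mono:
  assumes "0 \<le> u" "u \<le> t" "t \<le> P" "\<And>x. u \<le> x \<Longrightarrow> x \<le> t \<Longrightarrow> 0 \<le> sin (\<theta> x - \<phi>)"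
  shows "\<gamma> u \<bullet> unit_dir (\<phi> + pi / 2) \<le> \<gamma> t \<bullet> unit_dir (\<phi> + pi / 2)"
proof -
  have eq: "cos (\<theta> x - (\<phi> + pi / 2)) = sin (\<theta> x - \<phi>)" for x
    by (simp add: cos_diff cos_add sin_add sin_diff algebra_simps)
  have "0 \<le> integral {u..t} (\<lambda>x. sin (\<theta> x - \<phi>))"
    using assms by (intro integral_nonneg integrable_continuous_real continuous_on_subset[OF cont_trig(2)]) auto
  then show ?thesis
    using proj_increment[OF assms(1-3), of "\<phi> + pi / 2"] eq by simp
qed

lemma normal_proj_antimono:
  assumes "0 \<le> u" "u \<le> t" "t \<le> P" "\<And>x. u \<le> x \<Longrightarrow> x \<le> t \<Longrightarrow> sin (\<theta> x - \<phi>) \<le> 0"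
  shows "\<gamma> t \<bullet> unit_dir (\<phi> + pi / 2) \<le> \<gamma> u \<bullet> unit_dir (\<phi> + pi / 2)"
proof -
  have eq: "cos (\<theta> x - (\<phi> + pi / 2)) = sin (\<theta> x - \<phi>)" for x
    by (simp add: cos_diff cos_add sin_add sin_diff algebra_simps)
  have "0 \<le> integral {u..t} (\<lambda>x. - sin (\<theta> x - \<phi>))"
    using assms by (intro integral_nonneg integrable_continuous_real continuous_on_minus continuous_on_subset[OF cont_trig(2)]) auto
  then show ?thesis
    using proj_increment[OF assms(1-3), of "\<phi> + pi / 2"] eq by simp
qed

lemma cont_\<gamma>: "continuous_on {0..P} \<gamma>"
  unfolding \<gamma>_def arc_curve_def
  by (intro continuous_intros indefinite_integral_continuous_1 int_trig)

lemma compact_trace: "compact trace"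
  by (intro compact_continuous_image cont_\<gamma>) auto

lemma connected_\<gamma>_image: "0 \<le> u \<Longrightarrow> t \<le> P \<Longrightarrow> connected (\<gamma> ` {u..t})"
  by (intro connected_continuous_image continuous_on_subset[OF cont_\<gamma>]) auto

lemma connected_two_arcs:
  assumes "u \<in> {0..P}" "v \<in> {0..P}"
  shows "connected (\<gamma> ` {0..u} \<union> \<gamma> ` {v..P})"
proof (rule connected_Un)
  have "\<gamma> 0 \<in> \<gamma> ` {0..u}" "\<gamma> P \<in> \<gamma> ` {v..P}" using assms by auto
  then show "\<gamma> ` {0..u} \<inter> \<gamma> ` {v..P} \<noteq> {}" using \<gamma>_closed by auto
qed (use assms in \<open>auto intro!: connected_\<gamma>_image\<close>)

text \<open>Starting at \<open>s\<close> one of the two arcs to \<open>t\<close> turns by at most \<open>\<pi>\<close>, and along it the height over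
  the tangent line at \<open>s\<close> is monotone.\<close>
lemma monotone_arc:
  assumes s: "s \<in> {0..P}" and t: "t \<in> {0..P}"
  defines "n \<equiv> unit_dir (\<theta> s + pi / 2)"
  obtains C where "connected C" "\<gamma> s \<in> C" "\<gamma> t \<in> C" "C \<subseteq> trace"
    "\<And>y. y \<in> C \<Longrightarrow> \<gamma> s \<bullet> n \<le> y \<bullet> n" "\<And>y. y \<in> C \<Longrightarrow> y \<bullet> n \<le> \<gamma> t \<bullet> n"
proof -
  have range: "\<theta> 0 \<le> \<theta> x" "\<theta> x \<le> \<theta> 0 + 2 * pi" if "0 \<le> x" "x \<le> P" for x
    using mono_\<theta>[of 0 x] mono_\<theta>[of x P] that turning by auto
  note inc = normal_proj_mono[of _ _ "\<theta> s", folded n_def]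
  note dec = normal_proj_antimono[of _ _ "\<theta> s", folded n_def]
  \<comment> \<open>In A and C the parameter interval between \<open>s\<close> and \<open>t\<close>
    is the right arc. In B and D it turns by more than \<open>pi\<close>, and the complementary arc
    through the closing point \<open>\<gamma> 0 = \<gamma> P\<close> is taken.\<close>
  consider (A) "s \<le> t" "\<theta> t - \<theta> s \<le> pi" | (B) "s \<le> t" "\<theta> t - \<theta> s > pi"
    | (C) "t < s" "\<theta> t - \<theta> s \<ge> - pi" | (D) "t < s" "\<theta> t - \<theta> s < - pi" by linarith
  then show thesis
  proof cases
    case A
    have m: "\<gamma> u \<bullet> n \<le> \<gamma> v \<bullet> n" if "s \<le> u" "u \<le> v" "v \<le> t" for u v
    proof (rule inc)
      fix x assume "u \<le> x" "x \<le> v"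
      then show "0 \<le> sin (\<theta> x - \<theta> s)"
        using A mono_\<theta>[of s x] mono_\<theta>[of x t] that s t by (intro sin_ge_zero) auto
    qed (use that s t in auto)
    show thesis
      by (rule that[of "\<gamma> ` {s..t}"]) (use A s t m connected_\<gamma>_image in auto)
  next
    case C
    have m: "\<gamma> v \<bullet> n \<le> \<gamma> u \<bullet> n" if "t \<le> u" "u \<le> v" "v \<le> s" for u v
    proof (rule dec)
      fix x assume "u \<le> x" "x \<le> v"
      then show "sin (\<theta> x - \<theta> s) \<le> 0"
        using C mono_\<theta>[of x s] mono_\<theta>[of t x] that s t by (intro sin_nonpos_shift) auto
    qed (use that s t in auto)
    show thesis
      by (rule that[of "\<gamma> ` {t..s}"]) (use C s t m connected_\<gamma>_image in auto)
  next
    case B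
    have m1: "\<gamma> v \<bullet> n \<le> \<gamma> u \<bullet> n" if "t \<le> u" "u \<le> v" "v \<le> P" for u v
    proof (rule dec)
      fix x assume "u \<le> x" "x \<le> v"
      then show "sin (\<theta> x - \<theta> s) \<le> 0"
        using B mono_\<theta>[of t x] range[of x] range[of s] that s t by (intro sin_nonpos_shift') auto
    qed (use that s t in auto)
    have m2: "\<gamma> v \<bullet> n \<le> \<gamma> u \<bullet> n" if "0 \<le> u" "u \<le> v" "v \<le> s" for u v
    proof (rule dec)
      fix x assume "u \<le> x" "x \<le> v"
      then show "sin (\<theta> x - \<theta> s) \<le> 0"
        using B mono_\<theta>[of x s] range[of x] range[of t] that s t by (intro sin_nonpos_shift) auto
    qed (use that s t in auto)
    have "connected (\<gamma> ` {0..s} \<union> \<gamma> ` {t..P})"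
      using s t by (intro connected_two_arcs) auto
    moreover have "\<gamma> s \<bullet> n \<le> \<gamma> x \<bullet> n \<and> \<gamma> x \<bullet> n \<le> \<gamma> t \<bullet> n" if "x \<in> {0..s} \<union> {t..P}" for x
      using m1[of t x] m1[of x P] m2[of 0 x] m2[of x s] m1[of t P] m2[of 0 s] \<gamma>_closed that s t by auto
    ultimately show thesis
      using s t by (intro that[of "\<gamma> ` {0..s} \<union> \<gamma> ` {t..P}"]) auto
  next
    case D
    have m1: "\<gamma> u \<bullet> n \<le> \<gamma> v \<bullet> n" if "0 \<le> u" "u \<le> v" "v \<le> t" for u v
    proof (rule inc)
      fix x assume "u \<le> x" "x \<le> v"
      then show "0 \<le> sin (\<theta> x - \<theta> s)"
        using D mono_\<theta>[of x t] range[of x] range[of s] that s t by (intro sin_nonneg_shift) auto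
    qed (use that s t in auto)
    have m2: "\<gamma> u \<bullet> n \<le> \<gamma> v \<bullet> n" if "s \<le> u" "u \<le> v" "v \<le> P" for u v
    proof (rule inc)
      fix x assume "u \<le> x" "x \<le> v"
      then show "0 \<le> sin (\<theta> x - \<theta> s)"
        using D mono_\<theta>[of s x] range[of x] range[of t] that s t by (intro sin_ge_zero) auto
    qed (use that s t in auto)
    have "connected (\<gamma> ` {0..t} \<union> \<gamma> ` {s..P})"
      using s t by (intro connected_two_arcs) auto
    moreover have "\<gamma> s \<bullet> n \<le> \<gamma> x \<bullet> n \<and> \<gamma> x \<bullet> n \<le> \<gamma> t \<bullet> n" if "x \<in> {0..t} \<union> {s..P}" for x
      using m1[of 0 x] m1[of x t] m2[of s x] m2[of x P] m1[of 0 t] m2[of s P] \<gamma>_closed that s t by auto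
    ultimately show thesis
      using s t by (intro that[of "\<gamma> ` {0..t} \<union> \<gamma> ` {s..P}"]) auto
  qed
qed

text \<open>The direction \<open>\<theta> s + pi / 2\<close> is the inner normal at
  \<open>\<gamma> s\<close>: the tangent line there supports the curve, since a monotone arc leads
  from \<open>\<gamma> s\<close> up to any other point.\<close>

lemma support_trace:
  assumes "s \<in> {0..P}" "y \<in> trace"
  shows "\<gamma> s \<bullet> unit_dir (\<theta> s + pi / 2) \<le> y \<bullet> unit_dir (\<theta> s + pi / 2)"
proof -
  obtain t where t: "t \<in> {0..P}" "y = \<gamma> t" using assms(2) by blast
  show ?thesis
    by (rule monotone_arc[OF assms(1) t(1)]) (use t(2) in blast)
qed

lemma support_region:
  assumes "s \<in> {0..P}" "y \<in> region"
  shows "\<gamma> s \<bullet> unit_dir (\<theta> s + pi / 2) \<le> y \<bullet> unit_dir (\<theta> s + pi / 2)"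
proof -
  let ?n = "unit_dir (\<theta> s + pi / 2)"
  have "region \<subseteq> {y. ?n \<bullet> y \<ge> ?n \<bullet> \<gamma> s}"
    unfolding region_def
    using support_trace[OF assms(1)]
    by (intro hull_minimal convex_halfspace_ge) (auto simp: inner_commute)
  then show ?thesis using assms(2) by (auto simp: inner_commute)
qed

text \<open>The tangent angle runs continuously through a full turn, so every direction occurs as a
  tangent rotated by the fixed angle \<open>\<delta>\<close>; \<open>\<delta> = pi / 2\<close> gives
  normals.\<close>

lemma ex_tangent_dir:
  assumes "a \<noteq> (0 :: real \<times> real)"
  obtains s where "s \<in> {0..P}" "a = norm a *\<^sub>R unit_dir (\<theta> s + \<delta>)"
proof -
  obtain t where t: "\<theta> 0 + \<delta> \<le> t" "t \<le> \<theta> 0 + \<delta> + 2 * pi" "a = norm a *\<^sub>R unit_dir t"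
    using ex_unit_dir[OF assms] by blast
  obtain s where "0 \<le> s" "s \<le> P" "\<theta> s = t - \<delta>"
    using IVT'[of \<theta> 0 "t - \<delta>" P] t turning P_pos cont_\<theta> by auto
  with t that[of s] show thesis by auto
qed

lemma compact_region: "compact region"
  unfolding region_def by (rule compact_convex_hull[OF compact_trace])

lemma convex_region: "convex region"
  unfolding region_def by (rule convex_convex_hull)

lemma trace_subset_region: "trace \<subseteq> region"
  unfolding region_def by (rule hull_subset)

lemma closed_region: "closed region"
  by (rule compact_imp_closed[OF compact_region])

lemma interior_region_strict:
  assumes "s \<in> {0..P}" "y \<in> interior region"
  shows "\<gamma> s \<bullet> unit_dir (\<theta> s + pi / 2) < y \<bullet> unit_dir (\<theta> s + pi / 2)"
proof -
  let ?n = "unit_dir (\<theta> s + pi / 2)"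
  have n: "?n \<noteq> 0" by (rule unit_dir_nonzero)
  have "region \<subseteq> {y. ?n \<bullet> y \<ge> ?n \<bullet> \<gamma> s}"
    using support_region[OF assms(1)] by (auto simp: inner_commute)
  then have "interior region \<subseteq> {y. ?n \<bullet> y > ?n \<bullet> \<gamma> s}"
    using interior_mono interior_halfspace_ge[OF n] by metis
  then show ?thesis using assms(2) by (auto simp: inner_commute)
qed

lemma trace_subset_frontier: "trace \<subseteq> frontier region"
proof
  fix y assume y: "y \<in> trace"
  then obtain s where s: "s \<in> {0..P}" "y = \<gamma> s" by blast
  have "y \<notin> interior region" using interior_region_strict[OF s(1), of y] s(2) by blast
  moreover have "y \<in> region" using y trace_subset_region by blast
  ultimately show "y \<in> frontier region"
    using closed_region by (simp add: frontier_def)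
qed

text \<open>A supporting line at \<open>b\<close> is parallel to the tangent at some
  \<open>\<gamma> s\<close>, on the same side, so both lie on one line. The face of the hull on that
  line is the hull of curve points on it, and these already form a convex set: they are connected,
  and they lie on a line.\<close>

lemma frontier_subset_trace: "frontier region \<subseteq> trace"
proof
  fix b assume b: "b \<in> frontier region"
  then have bR: "b \<in> region" and bI: "b \<notin> interior region"
    using closed_region by (auto simp: frontier_def)
  show "b \<in> trace"
  proof -
    obtain a where a: "a \<noteq> 0" "\<And>y. y \<in> region \<Longrightarrow> a \<bullet> b \<le> a \<bullet> y"
    \<comment> \<open>A degenerate hull is not excluded at this stage. If the hull lies in a line,
      that line itself serves as supporting line.\<close>
    proof (cases "interior region = {}")
      case True
      then obtain a c where "a \<noteq> 0" "region \<subseteq> {x. a \<bullet> x = c}"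
        using empty_interior_subset_hyperplane[OF convex_region] by blast
      then show ?thesis using that[of a] bR by (metis (mono_tags, lifting) in_mono mem_Collect_eq order_refl)
    next
      case False
      then have ri: "b \<notin> rel_interior region"
        using bI by (simp add: rel_interior_nonempty_interior)
      then show ?thesis
        using supporting_hyperplane_rel_boundary[OF convex_region bR ri] that by metis
    qed
    obtain s where s: "s \<in> {0..P}" "a = norm a *\<^sub>R unit_dir (\<theta> s + pi / 2)"
      using ex_tangent_dir[OF a(1)] by blast
    define n where "n = unit_dir (\<theta> s + pi / 2)"
    have na: "norm a > 0" using a(1) by simp
    have le: "b \<bullet> n \<le> y \<bullet> n" if "y \<in> region" for y
      using a(2)[OF that] s(2) na unfolding n_def
      by (metis inner_commute inner_scaleR_left mult_le_cancel_left_pos)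
    define m where "m = \<gamma> s \<bullet> n"
    have bm: "b \<bullet> n = m"
      using le[of "\<gamma> s"] support_region[OF s(1) bR] s(1) trace_subset_region
      by (force simp: m_def n_def)
    define Z where "Z = {y \<in> trace. y \<bullet> n = m}"
    \<comment> \<open>A monotone arc from \<open>\<gamma> s\<close> to a point of the same height
      \<open>m\<close> is squeezed between \<open>m\<close> and \<open>m\<close>, so it stays inside
      \<open>Z\<close>.\<close>
    have "connected_component Z (\<gamma> s) y" if y: "y \<in> Z" for y
    proof -
      obtain t where t: "t \<in> {0..P}" "y = \<gamma> t" using y Z_def by auto
      obtain C where C: "connected C" "\<gamma> s \<in> C" "\<gamma> t \<in> C" "C \<subseteq> trace"
        "\<And>y. y \<in> C \<Longrightarrow> m \<le> y \<bullet> n" "\<And>y. y \<in> C \<Longrightarrow> y \<bullet> n \<le> \<gamma> t \<bullet> n"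
        by (rule monotone_arc[OF s(1) t(1), folded n_def, folded m_def]) (use that in blast)
      then have "C \<subseteq> Z" using y t by (force simp: Z_def)
      then show ?thesis using C(1-3) t(2) unfolding connected_component_def by blast
    qed
    then have conn: "connected Z"
      unfolding connected_iff_connected_component by (meson connected_component_sym connected_component_trans)
    \<comment> \<open>The tangential coordinate is injective on the supporting line, so
      \<open>Z\<close> is recovered from its image, an interval, and inherits convexity.\<close>
    let ?\<tau> = "\<lambda>y. y \<bullet> unit_dir (\<theta> s)"
    have "connected (?\<tau> ` Z)"
      by (rule connected_continuous_image[OF _ conn]) (intro continuous_intros)
    then have c\<tau>: "convex (?\<tau> ` Z)" by (simp add: connected_convex_1)
    have "y \<in> Z" if y: "n \<bullet> y = m" "?\<tau> y \<in> ?\<tau> ` Z" for y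
    proof -
      obtain z where z: "z \<in> Z" "?\<tau> y = ?\<tau> z" using y(2) by blast
      then have "y = z"
        using y(1) by (intro eq_if_inner_unit_dir_eq[of _ "\<theta> s"]) (auto simp: Z_def n_def inner_commute)
      then show ?thesis using z by simp
    qed
    moreover have Zn: "n \<bullet> y = m" if "y \<in> Z" for y
      using that by (simp add: Z_def inner_commute)
    ultimately have "Z = {y. n \<bullet> y = m} \<inter> (?\<tau> -` (?\<tau> ` Z))"
      by blast
    moreover have "convex ({y. n \<bullet> y = m} \<inter> (?\<tau> -` (?\<tau> ` Z)))"
      by (intro convex_Int convex_hyperplane convex_linear_vimage c\<tau> bounded_linear.linear bounded_linear_inner_left)
    ultimately have cZ: "convex Z" by simp
    have face: "region \<inter> {y. n \<bullet> y = m} face_of region"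
      using support_region[OF s(1)]
      by (intro face_of_Int_supporting_hyperplane_ge convex_region) (simp add: m_def n_def inner_commute)
    obtain S' where S': "S' \<subseteq> trace" "region \<inter> {y. n \<bullet> y = m} = convex hull S'"
      by (rule face_of_convex_hull_subset[OF compact_trace face[unfolded region_def], folded region_def])
        (use that in blast)
    have "n \<bullet> y = m" if "y \<in> S'" for y using S'(2) hull_subset[of S' convex] that by blast
    then have "S' \<subseteq> Z" using S'(1) by (auto simp: Z_def inner_commute)
    then have "convex hull S' \<subseteq> Z" using cZ by (simp add: hull_minimal)
    moreover have "b \<in> convex hull S'" using S'(2) bR bm by (auto simp: inner_commute)
    ultimately show ?thesis by (auto simp: Z_def)
  qed
qed

lemma frontier_region: "frontier region = trace"
  using frontier_subset_trace trace_subset_frontier by blast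

text \<open>If the curve lay in a line with normal \<open>a\<close>, its projection onto
  \<open>a\<close> would be constant; but at a point whose tangent is parallel to \<open>a\<close>
  that projection moves with unit speed.\<close>

lemma interior_region_nonempty: "interior region \<noteq> {}"
proof
  assume "interior region = {}"
  then obtain a c where a: "a \<noteq> 0" "region \<subseteq> {x. a \<bullet> x = c}"
    using empty_interior_subset_hyperplane[OF convex_region] by blast
  obtain s where s: "s \<in> {0..P}" "a = norm a *\<^sub>R unit_dir (\<theta> s)"
    using ex_tangent_dir[OF a(1), of 0] by auto
  have e: "\<gamma> t \<bullet> unit_dir (\<theta> s) = c / norm a" if "t \<in> {0..P}" for t
  proof -
    have "a \<bullet> \<gamma> t = c" using a(2) trace_subset_region that by blast
    then show ?thesis using s(2) a(1) by (metis inner_commute inner_scaleR_left nonzero_mult_div_cancel_left norm_eq_zero)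
  qed
  have z: "integral {u..t} (\<lambda>x. cos (\<theta> x - \<theta> s)) = 0" if "0 \<le> u" "u \<le> t" "t \<le> P" for u t
    using proj_increment[OF that, of "\<theta> s"] e that by auto
  have "continuous_on {0..P} (\<lambda>x. cos (\<theta> x - \<theta> s))" by (rule cont_trig)
  moreover have "cos (\<theta> s - \<theta> s) > 0" by simp
  ultimately obtain d where d: "d > 0" "\<And>x. x \<in> {0..P} \<Longrightarrow> \<bar>x - s\<bar> < d \<Longrightarrow> cos (\<theta> x - \<theta> s) > 0"
    using s(1) unfolding continuous_on_iff dist_real_def
    by (metis (no_types, lifting) abs_diff_less_iff diff_self diff_zero)
  define u where "u = max 0 (s - d / 2)"
  define t where "t = min P (s + d / 2)"
  have ut: "0 \<le> u" "u < t" "t \<le> P" using s(1) d(1) P_pos by (auto simp: u_def t_def)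
  have pos: "cos (\<theta> x - \<theta> s) > 0" if "x \<in> {u..t}" for x
    using d(2)[of x] that ut d(1) by (auto simp: u_def t_def)
  have c: "continuous_on {u..t} (\<lambda>x. cos (\<theta> x - \<theta> s))"
    using ut by (intro continuous_on_subset[OF cont_trig(1)]) auto
  have "\<forall>x\<in>{u..t}. cos (\<theta> x - \<theta> s) = 0"
    using z[of u t] ut pos integral_eq_0_iff[OF c ut(2)] by (meson less_imp_le)
  then show False using pos[of u] ut by force
qed

text \<open>If the curve met itself, it would split into two closed loops, one of which turns by at
  most \<open>pi\<close>. Projected onto the middle direction of that loop the motion never goes
  backwards, so it cannot return.\<close>

lemma inj_on_\<gamma>: "inj_on \<gamma> {0..<P}"
proof (rule linorder_inj_onI)
  show "\<And>x y. x \<in> {0..<P} \<Longrightarrow> y \<in> {0..<P} \<Longrightarrow> x \<le> y \<or> y \<le> x" by auto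
  fix s t assume st: "s < t" "s \<in> {0..<P}" "t \<in> {0..<P}"
  show "\<gamma> s \<noteq> \<gamma> t"
  proof
    assume eq: "\<gamma> s = \<gamma> t"
    show False
    proof (cases "\<theta> t - \<theta> s \<le> pi")
      case True
      define \<phi> where "\<phi> = (\<theta> s + \<theta> t) / 2"
      have nn: "0 \<le> cos (\<theta> x - \<phi>)" if "x \<in> {s..t}" for x
        using mono_\<theta>[of s x] mono_\<theta>[of x t] that st True
        by (intro cos_ge_zero) (auto simp: \<phi>_def field_simps)
      have "integral {s..t} (\<lambda>x. cos (\<theta> x - \<phi>)) = 0"
        using proj_increment[of s t \<phi>] st eq by auto
      then have "\<forall>x\<in>{s..t}. cos (\<theta> x - \<phi>) = 0"
        using st nn by (subst integral_eq_0_iff[symmetric]) (auto intro!: continuous_on_subset[OF cont_trig(1)])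
      moreover obtain x where "s \<le> x" "x \<le> t" "\<theta> x = \<phi>"
        using IVT'[of \<theta> s \<phi> t] mono_\<theta>[of s t] st continuous_on_subset[OF cont_\<theta>, of "{s..t}"] by (auto simp: \<phi>_def)
      ultimately show False by force
    next
      case False
      \<comment> \<open>Middle direction of the complementary loop, which runs through the closing
        point. On the initial piece \<open>{0..s}\<close> the angle has to be raised by
        \<open>2 * pi\<close> to continue the one on \<open>{t..P}\<close>.\<close>
      define \<phi> where "\<phi> = (\<theta> s + \<theta> t) / 2 + pi"
      have p1: "0 < cos (\<theta> x - \<phi>)" if "x \<in> {t..P}" for x
        using mono_\<theta>[of t x] mono_\<theta>[of x P] mono_\<theta>[of 0 s] turning that st False
        by (intro cos_gt_zero_pi) (auto simp: \<phi>_def field_simps)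
      have p2: "0 < cos (\<theta> x - \<phi>)" if "x \<in> {0..s}" for x
      proof -
        have "0 < cos (\<theta> x - \<phi> + 2 * pi)"
          using mono_\<theta>[of 0 x] mono_\<theta>[of x s] mono_\<theta>[of t P] turning that st False
          by (intro cos_gt_zero_pi) (auto simp: \<phi>_def field_simps)
        then show ?thesis by simp
      qed
      have 1: "integral {0..s} (\<lambda>x. cos (\<theta> x - \<phi>)) + integral {t..P} (\<lambda>x. cos (\<theta> x - \<phi>)) = 0"
        using proj_increment[of 0 s \<phi>] proj_increment[of t P \<phi>] st eq \<gamma>_closed by auto
      have 2: "integral {0..s} (\<lambda>x. cos (\<theta> x - \<phi>)) \<ge> 0" "integral {t..P} (\<lambda>x. cos (\<theta> x - \<phi>)) \<ge> 0"
        by (rule integral_nonneg; use p1 p2 st in \<open>force intro!: integrable_continuous_real continuous_on_subset[OF cont_trig(1)]\<close>)+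
      with 1 have "integral {t..P} (\<lambda>x. cos (\<theta> x - \<phi>)) = 0" by linarith
      moreover have "continuous_on {t..P} (\<lambda>x. cos (\<theta> x - \<phi>))" "t < P"
        using st by (auto intro!: continuous_on_subset[OF cont_trig(1)])
      ultimately have "\<forall>x\<in>{t..P}. cos (\<theta> x - \<phi>) = 0"
        using p1 integral_eq_0_iff by (meson less_imp_le)
      then show False using p1[of t] st by force
    qed
  qed
qed

end

section \<open>Area enclosed by the curve\<close>

text \<open>The domain lies in \<open>real \<times> real\<close>, whereas the change of variables
  used below is stated with the determinant of a matrix on \<open>real^2\<close>.\<close>

definition vec_of_pair :: "real \<times> real \<Rightarrow> real^2" where
  "vec_of_pair z = (\<chi> i. if i = 1 then fst z else snd z)"

lemma vec_of_pair_nth [simp]: "vec_of_pair z $ 1 = fst z" "vec_of_pair z $ 2 = snd z"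
  by (simp_all add: vec_of_pair_def)

lemma vec_of_pair_inverse [simp]: "vec_of_pair (v $ 1, v $ 2) = v"
  by (simp add: vec_eq_iff forall_2)

lemma inj_vec_of_pair: "inj vec_of_pair"
  by (metis injI vec_of_pair_nth prod.collapse)

lemma linear_vec_of_pair: "linear vec_of_pair"
  by (rule linearI) (simp_all add: vec_eq_iff forall_2)

lemma vec_of_pair_measurable [measurable]: "vec_of_pair \<in> borel_measurable borel"
  by (intro borel_measurable_continuous_onI linear_continuous_on)
    (simp add: linear_vec_of_pair linear_conv_bounded_linear[symmetric])

lemma vec_of_pair_vimage_box: "vec_of_pair -` box l u = box (l $ 1, l $ 2) (u $ 1, u $ 2)"
proof (rule set_eqI)
  fix z :: "real \<times> real"
  have "z \<in> box (l $ 1, l $ 2) (u $ 1, u $ 2) \<longleftrightarrow> l $ 1 < fst z \<and> fst z < u $ 1 \<and> l $ 2 < snd z \<and> snd z < u $ 2"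
    by (cases z) (auto simp: mem_box Basis_prod_def)
  then show "z \<in> vec_of_pair -` box l u \<longleftrightarrow> z \<in> box (l $ 1, l $ 2) (u $ 1, u $ 2)"
    by (simp add: mem_box_cart forall_2 conj_ac)
qed

lemma vec_of_pair_vimage_cbox: "vec_of_pair -` cbox l u = cbox (l $ 1, l $ 2) (u $ 1, u $ 2)"
proof (rule set_eqI)
  fix z :: "real \<times> real"
  have "z \<in> cbox (l $ 1, l $ 2) (u $ 1, u $ 2) \<longleftrightarrow> l $ 1 \<le> fst z \<and> fst z \<le> u $ 1 \<and> l $ 2 \<le> snd z \<and> snd z \<le> u $ 2"
    by (cases z) (auto simp: mem_box Basis_prod_def)
  then show "z \<in> vec_of_pair -` cbox l u \<longleftrightarrow> z \<in> cbox (l $ 1, l $ 2) (u $ 1, u $ 2)"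
    by (simp add: mem_box_cart forall_2 conj_ac)
qed

lemma Basis_vec2: "(Basis :: (real^2) set) = {axis 1 1, axis 2 1}"
proof -
  have "axis i (1::real) \<in> {axis 1 1, axis 2 1}" for i :: 2 using exhaust_2[of i] by blast
  then show ?thesis by (auto simp: Basis_vec_def)
qed

lemma lborel_eq_distr_vec_of_pair: "(lborel :: (real^2) measure) = distr lborel borel vec_of_pair"
proof (rule lborel_eqI)
  fix l u :: "real^2"
  assume lu: "\<And>b. b \<in> Basis \<Longrightarrow> l \<bullet> b \<le> u \<bullet> b"
  have le: "l $ i \<le> u $ i" for i
    using lu[of "axis i 1"] by (simp add: inner_axis axis_in_Basis_iff)
  have "emeasure (distr lborel borel vec_of_pair) (box l u) = emeasure lborel (box (l $ 1, l $ 2) (u $ 1, u $ 2))"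
    by (simp add: emeasure_distr vec_of_pair_vimage_box)
  also have "\<dots> = ennreal ((u $ 1 - l $ 1) * (u $ 2 - l $ 2))"
    using le by (subst emeasure_lborel_box) (auto simp: Basis_prod_def prod.union_disjoint inner_prod_def prod.reindex)
  also have "(u $ 1 - l $ 1) * (u $ 2 - l $ 2) = (\<Prod>b\<in>Basis. (u - l) \<bullet> b)"
  proof -
    have "axis 1 (1::real) \<noteq> (axis 2 1 :: real^2)"
      by (simp add: axis_eq_axis)
    then show ?thesis by (simp add: Basis_vec2 inner_axis)
  qed
  finally show "emeasure (distr lborel borel vec_of_pair) (box l u) = ennreal (\<Prod>b\<in>Basis. (u - l) \<bullet> b)" .
qed simp

lemma measure_vec_of_pair_image:
  assumes "S \<in> sets borel"
  shows "measure lebesgue (vec_of_pair ` S) = measure lebesgue S"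
proof -
  have eq: "vec_of_pair ` S = (\<lambda>v. (v $ 1, v $ 2)) -` S"
    by (auto simp: image_iff) (metis vec_of_pair_inverse)
  have "(\<lambda>v::real^2. (v $ 1, v $ 2)) \<in> borel_measurable borel"
    by (intro borel_measurable_continuous_onI continuous_intros)
  then have b: "vec_of_pair ` S \<in> sets borel"
    unfolding eq using measurable_sets_borel[OF _ assms] by blast
  have "emeasure lborel (vec_of_pair ` S) = emeasure (distr lborel borel vec_of_pair) (vec_of_pair ` S)"
    using lborel_eq_distr_vec_of_pair by simp
  also have "\<dots> = emeasure lborel S"
    using b by (simp add: emeasure_distr inj_vimage_image_eq[OF inj_vec_of_pair])
  finally show ?thesis using b assms by (simp add: measure_def)
qed

lemma integral_vec_of_pair_cbox:
  fixes f :: "real^2 \<Rightarrow> real"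
  assumes c: "continuous_on (cbox l u) f"
  shows "integral (cbox l u) f = integral (cbox (l $ 1, l $ 2) (u $ 1, u $ 2)) (\<lambda>z. f (vec_of_pair z))"
proof -
  have c': "continuous_on (cbox (l $ 1, l $ 2) (u $ 1, u $ 2)) (\<lambda>z. f (vec_of_pair z))"
  proof (rule continuous_on_compose2[OF c])
    show "continuous_on (cbox (l $ 1, l $ 2) (u $ 1, u $ 2)) vec_of_pair"
      using linear_continuous_on linear_conv_bounded_linear linear_vec_of_pair by blast
  qed (simp add: vec_of_pair_vimage_cbox[symmetric])
  have i: "set_integrable lborel (cbox l u) f"
    unfolding set_integrable_def by (rule borel_integrable_compact[OF compact_cbox c])
  have i': "set_integrable lborel (cbox (l $ 1, l $ 2) (u $ 1, u $ 2)) (\<lambda>z. f (vec_of_pair z))"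
    unfolding set_integrable_def by (rule borel_integrable_compact[OF compact_cbox c'])
  have m: "(\<lambda>x. indicator (cbox l u) x *\<^sub>R f x) \<in> borel_measurable borel"
    using i unfolding set_integrable_def by (simp add: borel_measurable_integrable flip: measurable_lborel2)
  have "integral (cbox l u) f = (LINT x|lborel. indicator (cbox l u) x *\<^sub>R f x)"
    using set_borel_integral_eq_integral(2)[OF i] by (simp add: set_lebesgue_integral_def)
  also have "\<dots> = (LINT x|distr lborel borel vec_of_pair. indicator (cbox l u) x *\<^sub>R f x)"
    using lborel_eq_distr_vec_of_pair by simp
  also have "\<dots> = (LINT z|lborel. indicator (cbox l u) (vec_of_pair z) *\<^sub>R f (vec_of_pair z))"
    using m by (subst integral_distr) auto
  also have "\<dots> = (LINT z|lborel. indicator (cbox (l $ 1, l $ 2) (u $ 1, u $ 2)) z *\<^sub>R f (vec_of_pair z))"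
    by (simp add: vec_of_pair_vimage_cbox[symmetric] indicator_vimage)
  also have "\<dots> = integral (cbox (l $ 1, l $ 2) (u $ 1, u $ 2)) (\<lambda>z. f (vec_of_pair z))"
    using set_borel_integral_eq_integral(2)[OF i'] by (simp add: set_lebesgue_integral_def)
  finally show ?thesis .
qed

section \<open>Area in polar coordinates about an interior point\<close>

context convex_closed_curve
begin

lemma \<gamma>_derivs:
  assumes "s \<in> {0..P}"
  shows "((\<lambda>s. fst (\<gamma> s)) has_real_derivative cos (\<theta> s)) (at s within {0..P})"
    "((\<lambda>s. snd (\<gamma> s)) has_real_derivative sin (\<theta> s)) (at s within {0..P})"
proof -
  have 1: "((\<lambda>u. integral {0..u} (\<lambda>t. cos (\<theta> t))) has_real_derivative cos (\<theta> s)) (at s within {0..P})"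
    "((\<lambda>u. integral {0..u} (\<lambda>t. sin (\<theta> t))) has_real_derivative sin (\<theta> s)) (at s within {0..P})"
    using integral_has_vector_derivative[OF cont_trig(3) assms] integral_has_vector_derivative[OF cont_trig(4) assms]
    by (simp_all add: has_real_derivative_iff_has_vector_derivative)
  show "((\<lambda>s. fst (\<gamma> s)) has_real_derivative cos (\<theta> s)) (at s within {0..P})"
    "((\<lambda>s. snd (\<gamma> s)) has_real_derivative sin (\<theta> s)) (at s within {0..P})"
    unfolding \<gamma>_def arc_curve_def by (auto intro!: derivative_eq_intros 1)
qed

text \<open>Polar coordinates about \<open>a\<close> adapted to the curve: \<open>fst z\<close> is
  the fraction of the ray from \<open>a\<close> to \<open>\<gamma> (snd z)\<close>. The Jacobian is
  that fraction times the distance from \<open>a\<close> to the tangent line.\<close>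

definition cone_map :: "real \<times> real \<Rightarrow> real \<times> real \<Rightarrow> real \<times> real" where
  "cone_map a z = a + fst z *\<^sub>R (\<gamma> (snd z) - a)"

lemma cone_map_open_segment:
  assumes a: "a \<in> interior region" and "0 < \<rho>" "\<rho> < 1" "s \<in> {0..P}"
  shows "cone_map a (\<rho>, s) \<in> interior region" "cone_map a (\<rho>, s) \<noteq> a" "\<gamma> s \<noteq> a"
proof -
  have f: "\<gamma> s \<in> frontier region" using assms frontier_region by auto
  then show ne: "\<gamma> s \<noteq> a" using a by (auto simp: frontier_def)
  have "cone_map a (\<rho>, s) \<in> open_segment a (\<gamma> s)"
    using assms ne by (auto simp: in_segment cone_map_def algebra_simps intro!: exI[of _ \<rho>])
  then show "cone_map a (\<rho>, s) \<in> interior region"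
    using in_interior_closure_convex_segment[OF convex_region a, of "\<gamma> s"] f by (auto simp: frontier_def)
  show "cone_map a (\<rho>, s) \<noteq> a" using ne assms by (simp add: cone_map_def)
qed

text \<open>If two radii \<open>\<rho> < \<rho>'\<close> gave the same point, the boundary point
  \<open>\<gamma> s'\<close> would equal a point strictly between \<open>a\<close> and
  \<open>\<gamma> s\<close>, which is interior. With equal radii, injectivity of the curve
  decides.\<close>

lemma inj_on_cone_map:
  assumes a: "a \<in> interior region"
  shows "inj_on (cone_map a) ({0<..<1} \<times> {0..<P})"
proof -
  have le: "\<not> \<rho> < \<rho>'" if e: "cone_map a (\<rho>, s) = cone_map a (\<rho>', s')"
    and r: "\<rho> \<in> {0<..<1}" "\<rho>' \<in> {0<..<1}" "s \<in> {0..<P}" "s' \<in> {0..<P}" for \<rho> s \<rho>' s'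
  proof
    assume lt: "\<rho> < \<rho>'"
    have "\<rho>' *\<^sub>R (\<gamma> s' - a) = \<rho> *\<^sub>R (\<gamma> s - a)" using e by (simp add: cone_map_def)
    then have "(1 / \<rho>') *\<^sub>R (\<rho>' *\<^sub>R (\<gamma> s' - a)) = (1 / \<rho>') *\<^sub>R (\<rho> *\<^sub>R (\<gamma> s - a))" by simp
    then have "\<gamma> s' = cone_map a (\<rho> / \<rho>', s)"
      using r by (simp add: cone_map_def algebra_simps)
    moreover have "cone_map a (\<rho> / \<rho>', s) \<in> interior region"
      using r lt by (intro cone_map_open_segment a) auto
    moreover have "\<gamma> s' \<in> frontier region" using r frontier_region by auto
    ultimately show False by (simp add: frontier_def)
  qed
  show ?thesis
  proof (rule inj_onI)
    fix z z' assume z: "z \<in> {0<..<1} \<times> {0..<P}" "z' \<in> {0<..<1} \<times> {0..<P}" and e: "cone_map a z = cone_map a z'"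
    obtain \<rho> s \<rho>' s' where zz: "z = (\<rho>, s)" "z' = (\<rho>', s')" by (cases z, cases z')
    have "\<rho> = \<rho>'"
      using le[of \<rho> s \<rho>' s'] le[of \<rho>' s' \<rho> s] z e zz by force
    moreover have "\<gamma> s = \<gamma> s'" using e zz z \<open>\<rho> = \<rho>'\<close> by (simp add: cone_map_def)
    then have "s = s'" using inj_on_\<gamma> z zz by (auto simp: inj_on_def)
    ultimately show "z = z'" using zz by simp
  qed
qed

lemma cone_map_image:
  assumes a: "a \<in> interior region"
  shows "cone_map a ` ({0<..<1} \<times> {0..<P}) = interior region - {a}"
proof
  show "cone_map a ` ({0<..<1} \<times> {0..<P}) \<subseteq> interior region - {a}"
    using cone_map_open_segment[OF a] by (intro image_subsetI) (auto simp del: split_paired_All)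
  show "interior region - {a} \<subseteq> cone_map a ` ({0<..<1} \<times> {0..<P})"
  proof
    fix y assume y: "y \<in> interior region - {a}"
    have "bounded region" using compact_region compact_imp_bounded by blast
    then obtain d where d: "0 < d" "a + d *\<^sub>R (y - a) \<in> frontier region"
      using ray_to_frontier[OF _ a, of "y - a"] y by auto
    have "d > 1"
    proof (rule ccontr)
      assume "\<not> d > 1"
      then have "(1 - d) *\<^sub>R a + d *\<^sub>R y \<in> interior region"
        using d a y convex_interior[OF convex_region] by (intro convexD) auto
      then have "a + d *\<^sub>R (y - a) \<in> interior region" by (simp add: algebra_simps)
      then show False using d by (simp add: frontier_def)
    qed
    obtain t where t: "t \<in> {0..P}" "a + d *\<^sub>R (y - a) = \<gamma> t" using d(2) frontier_region by auto
    \<comment> \<open>The parameter interval of the polar coordinates is half open, so the end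
      \<open>P\<close> is replaced by 0, where the curve has the same point.\<close>
    define s where "s = (if t = P then 0 else t)"
    have s: "s \<in> {0..<P}" "a + d *\<^sub>R (y - a) = \<gamma> s" using t \<gamma>_closed P_pos by (auto simp: s_def)
    have "\<gamma> s - a = d *\<^sub>R (y - a)" using s(2) by (simp add: algebra_simps)
    then have "y = cone_map a (1 / d, s)" using d(1) by (simp add: cone_map_def)
    then show "y \<in> cone_map a ` ({0<..<1} \<times> {0..<P})"
      using s(1) \<open>d > 1\<close> by auto
  qed
qed

text \<open>Integrating the Jacobian of \<open>cone_map\<close> over the radius leaves half the
  integral of the distance from \<open>a\<close> to the tangent. Moving the base point from
  \<open>a\<close> to the start of the curve only adds multiples of the integrals of
  \<open>sin\<close> and \<open>cos\<close>, which vanish.\<close>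

lemma measure_interior_region:
  "measure lebesgue (interior region) =
    integral {0..P} (\<lambda>s. integral {0..s} (\<lambda>t. cos (\<theta> t)) * sin (\<theta> s) - integral {0..s} (\<lambda>t. sin (\<theta> t)) * cos (\<theta> s)) / 2"
proof -
  obtain a where a: "a \<in> interior region" using interior_region_nonempty by blast
  define x where "x s = fst (\<gamma> s) - fst a" for s
  define y where "y s = snd (\<gamma> s) - snd a" for s
  define F where "F z = vec_of_pair (cone_map a (z $ 1, z $ 2))" for z :: "real^2"
  define S where "S = {z::real^2. 0 < z $ 1 \<and> z $ 1 < 1 \<and> 0 \<le> z $ 2 \<and> z $ 2 < P}"
  define F' where "F' z h = vec_of_pair (h $ 1 * x (z $ 2) + z $ 1 * (cos (\<theta> (z $ 2)) * h $ 2),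
      h $ 1 * y (z $ 2) + z $ 1 * (sin (\<theta> (z $ 2)) * h $ 2))" for z h :: "real^2"
  define c where "c s = x s * sin (\<theta> s) - y s * cos (\<theta> s)" for s
  have FS: "F ` S = vec_of_pair ` (interior region - {a})"
  proof -
    have "(\<lambda>z. (z $ 1, z $ 2)) ` S = {0<..<1} \<times> {0..<P}"
    proof -
      have "w \<in> (\<lambda>z. (z $ 1, z $ 2)) ` S" if "w \<in> {0<..<1} \<times> {0..<P}" for w
        using that by (intro image_eqI[of _ _ "vec_of_pair w"]) (auto simp: S_def)
      then show ?thesis by (auto simp: S_def)
    qed
    then show ?thesis
      unfolding cone_map_image[OF a, symmetric] F_def by (simp add: image_image flip: \<open>_ ` S = _\<close>)
  qed
  have inj: "inj_on F S"
  proof (rule inj_onI)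
    fix z z' assume z: "z \<in> S" "z' \<in> S" "F z = F z'"
    have "cone_map a (z $ 1, z $ 2) = cone_map a (z' $ 1, z' $ 2)"
      using injD[OF inj_vec_of_pair z(3)[unfolded F_def]] .
    from inj_onD[OF inj_on_cone_map[OF a] this] have "(z $ 1, z $ 2) = (z' $ 1, z' $ 2)"
      using z(1,2) by (simp add: S_def)
    then show "z = z'" by (metis vec_of_pair_inverse)
  qed
  have der: "(F has_derivative F' z) (at z within S)" if z: "z \<in> S" for z
  proof -
    have sub: "(\<lambda>z. z $ 2) ` S \<subseteq> {0..P}" by (auto simp: S_def)
    have z2: "z $ 2 \<in> {0..P}" using z by (auto simp: S_def)
    have nth: "((\<lambda>z. z $ i) has_derivative (\<lambda>h. h $ i)) (at z within S)" for i
      by (intro bounded_linear_imp_has_derivative bounded_linear_vec_nth)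
    have dx: "((\<lambda>z. x (z $ 2)) has_derivative (\<lambda>h. cos (\<theta> (z $ 2)) * h $ 2)) (at z within S)"
    proof -
      have "(x has_derivative (*) (cos (\<theta> (z $ 2)))) (at (z $ 2) within (\<lambda>z. z $ 2) ` S)"
        using has_derivative_diff[OF \<gamma>_derivs(1)[OF z2, unfolded has_field_derivative_def] has_derivative_const[of "fst a"]]
        by (intro has_derivative_subset[OF _ sub]) (simp add: x_def[abs_def])
      from has_derivative_in_compose[OF nth this] show ?thesis by simp
    qed
    have dy: "((\<lambda>z. y (z $ 2)) has_derivative (\<lambda>h. sin (\<theta> (z $ 2)) * h $ 2)) (at z within S)"
    proof -
      have "(y has_derivative (*) (sin (\<theta> (z $ 2)))) (at (z $ 2) within (\<lambda>z. z $ 2) ` S)"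
        using has_derivative_diff[OF \<gamma>_derivs(2)[OF z2, unfolded has_field_derivative_def] has_derivative_const[of "snd a"]]
        by (intro has_derivative_subset[OF _ sub]) (simp add: y_def[abs_def])
      from has_derivative_in_compose[OF nth this] show ?thesis by simp
    qed
    have "((\<lambda>z. fst a + z $ 1 * x (z $ 2)) has_derivative
        (\<lambda>h. 0 + (z $ 1 * (cos (\<theta> (z $ 2)) * h $ 2) + h $ 1 * x (z $ 2)))) (at z within S)"
      by (intro has_derivative_add has_derivative_mult has_derivative_const nth dx)
    then have 1: "((\<lambda>z. F z $ 1) has_derivative (\<lambda>h. F' z h $ 1)) (at z within S)"
      by (simp add: F_def F'_def cone_map_def x_def add.commute)
    have "((\<lambda>z. snd a + z $ 1 * y (z $ 2)) has_derivative
        (\<lambda>h. 0 + (z $ 1 * (sin (\<theta> (z $ 2)) * h $ 2) + h $ 1 * y (z $ 2)))) (at z within S)"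
      by (intro has_derivative_add has_derivative_mult has_derivative_const nth dy)
    then have 2: "((\<lambda>z. F z $ 2) has_derivative (\<lambda>h. F' z h $ 2)) (at z within S)"
      by (simp add: F_def F'_def cone_map_def y_def add.commute)
    show ?thesis
      using 1 2 by (subst has_derivative_componentwise_within) (simp add: Basis_vec2 inner_axis)
  qed
  have det: "det (matrix (F' z)) = z $ 1 * c (z $ 2)" for z
    by (simp add: det_2 matrix_def F'_def c_def axis_def algebra_simps)
  have cpos: "c s > 0" if "s \<in> {0..P}" for s
    using interior_region_strict[OF that a]
    by (cases "\<gamma> s"; cases a) (simp add: c_def x_def y_def inner_unit_dir cos_add sin_add algebra_simps)
  have cc: "continuous_on {0..P} c"
    unfolding c_def x_def y_def using cont_\<gamma> by (intro continuous_intros cont_trig)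
  let ?l = "vec_of_pair (0, 0)" and ?u = "vec_of_pair (1, P)"
  let ?J = "\<lambda>z::real^2. z $ 1 * c (z $ 2)"
  have cb: "cbox ?l ?u = {z. 0 \<le> z $ 1 \<and> z $ 1 \<le> 1 \<and> 0 \<le> z $ 2 \<and> z $ 2 \<le> P}"
    by (auto simp: mem_box_cart forall_2)
  have cJ: "continuous_on (cbox ?l ?u) ?J"
    by (intro continuous_intros continuous_on_compose2[OF cc]) (auto simp: cb)
  have "integral (cbox ?l ?u) ?J = integral (cbox (0, 0) (1, P)) (\<lambda>z. fst z * c (snd z))"
    using integral_vec_of_pair_cbox[OF cJ] by simp
  also have "\<dots> = integral (cbox 0 1) (\<lambda>\<rho>. integral (cbox 0 P) (\<lambda>s. \<rho> * c s))"
    by (subst integral_prod_continuous)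
      (auto intro!: continuous_intros continuous_on_compose2[OF cc] simp: cbox_Pair_eq)
  also have "\<dots> = integral {0..P} c / 2"
    using ident_has_integral[of 0 1] by (simp add: integral_unique)
  finally have int1: "integral (cbox ?l ?u) ?J = integral {0..P} c / 2" .
  \<comment> \<open>The edges by which the half-open strip \<open>S\<close>, needed for injectivity,
    differs from the closed box, on which the integral is iterated.\<close>
  define N where "N = {z::real^2. z $ 1 = 0} \<union> {z. z $ 1 = 1} \<union> {z. z $ 2 = P}"
  have "negligible {z::real^2. z $ i = d}" for i d
    using negligible_standard_hyperplane[of "axis i (1::real)" d] by (simp add: inner_axis axis_in_Basis_iff)
  then have N: "negligible N"
    unfolding N_def by (intro negligible_Un)
  have sp: "negligible {z \<in> cbox ?l ?u - S. ?J z \<noteq> 0}" "negligible {z \<in> S - cbox ?l ?u. ?J z \<noteq> 0}"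
    by (auto intro!: negligible_subset[OF N] simp: N_def cb S_def)
  have "?J integrable_on cbox ?l ?u" using cJ integrable_continuous by blast
  from integrable_integral[OF this] have "(?J has_integral integral {0..P} c / 2) (cbox ?l ?u)" unfolding int1 .
  then have hJ: "(?J has_integral integral {0..P} c / 2) S"
    using has_integral_spike_set_eq[OF sp] by blast
  have "((\<lambda>z. \<bar>det (matrix (F' z))\<bar>) has_integral integral {0..P} c / 2) S"
    by (rule has_integral_eq[OF _ hJ]) (use cpos in \<open>auto simp: det S_def abs_mult less_imp_le\<close>)
  moreover have "S \<in> sets lebesgue"
  proof -
    have "S = {z. 0 < z $ 1} \<inter> {z. z $ 1 < 1} \<inter> {z. 0 \<le> z $ 2} \<inter> {z. z $ 2 < P}" by (auto simp: S_def)
    moreover have "\<dots> \<in> sets borel"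
      by (intro sets.Int borel_open borel_closed open_Collect_less closed_Collect_le continuous_intros)
    ultimately show ?thesis by simp
  qed
  ultimately have "measure lebesgue (F ` S) = integral {0..P} c / 2"
    using has_measure_differentiable_image[OF _ der inj] by blast
  then have "measure lebesgue (interior region - {a}) = integral {0..P} c / 2"
    using measure_vec_of_pair_image[of "interior region - {a}"] by (simp add: FS)
  moreover have "measure lebesgue (interior region - {a}) = measure lebesgue (interior region)"
    by (rule measure_Diff_null_set) (auto simp: negligible_iff_null_sets[symmetric])
  moreover have "integral {0..P} c = integral {0..P} (\<lambda>s. integral {0..s} (\<lambda>t. cos (\<theta> t)) * sin (\<theta> s) - integral {0..s} (\<lambda>t. sin (\<theta> t)) * cos (\<theta> s))"
    (is "_ = integral _ ?k")
  proof -
    have c_eq: "c s = ?k s + ((fst p - fst a) * sin (\<theta> s) - (snd p - snd a) * cos (\<theta> s))" for s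
      by (simp add: c_def x_def y_def \<gamma>_def arc_curve_def algebra_simps)
    have k: "?k integrable_on {0..P}"
      by (intro integrable_continuous_real continuous_intros indefinite_integral_continuous_1 cont_trig int_trig)
    have i: "(\<lambda>s. (fst p - fst a) * sin (\<theta> s)) integrable_on {0..P}" "(\<lambda>s. (snd p - snd a) * cos (\<theta> s)) integrable_on {0..P}"
      using int_trig by (auto intro: integrable_on_mult_right)
    have "integral {0..P} c = integral {0..P} ?k + (integral {0..P} (\<lambda>s. (fst p - fst a) * sin (\<theta> s)) - integral {0..P} (\<lambda>s. (snd p - snd a) * cos (\<theta> s)))"
      unfolding c_eq using k i
      by (simp add: Henstock_Kurzweil_Integration.integral_add Henstock_Kurzweil_Integration.integral_diff integrable_diff del: integral_mult_right)
    then show ?thesis using closed_cos closed_sin by simp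
  qed
  ultimately show ?thesis by simp
qed

end

section \<open>Description of the set by curvature functions\<close>

text \<open>Bilinear version of half the integral of \<open>x dy - y dx\<close>: the position is
  integrated with length element \<open>f ds\<close>, the outer integral is taken with
  \<open>g ds\<close>.\<close>

definition area_form :: "real \<Rightarrow> (real \<Rightarrow> real) \<Rightarrow> (real \<Rightarrow> real) \<Rightarrow> (real \<Rightarrow> real) \<Rightarrow> real" where
  "area_form P \<theta> f g = integral {0..P} (\<lambda>s. (integral {0..s} (\<lambda>t. f t * cos (\<theta> t)) * sin (\<theta> s)
      - integral {0..s} (\<lambda>t. f t * sin (\<theta> t)) * cos (\<theta> s)) * g s) / 2"

text \<open>Normal form of the admissible curvatures. Borel measurability and nonnegativity on the
  whole line, obtained by changing the curvature on a null set, make substitution by image measures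
  possible.\<close>

definition closed_curvature :: "real \<Rightarrow> (real \<Rightarrow> real) \<Rightarrow> real \<Rightarrow> bool" where
  "closed_curvature P k \<theta>0 \<longleftrightarrow> P > 0 \<and> k \<in> borel_measurable borel \<and> (\<forall>s. k s \<ge> 0) \<and>
     k integrable_on {0..P} \<and> (\<lambda>s. (k s)\<^sup>2) integrable_on {0..P} \<and> integral {0..P} k = 2 * pi \<and>
     integral {0..P} (\<lambda>s. cos (tangent_angle \<theta>0 k s)) = 0 \<and>
     integral {0..P} (\<lambda>s. sin (tangent_angle \<theta>0 k s)) = 0"

lemma convex_closed_curve_tangent_angle:
  assumes "P > 0" "k integrable_on {0..P}" "\<forall>s\<in>{0..P}. k s \<ge> 0"
    "tangent_angle \<theta>0 k P = \<theta>0 + 2 * pi"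
    "integral {0..P} (\<lambda>s. cos (tangent_angle \<theta>0 k s)) = 0"
    "integral {0..P} (\<lambda>s. sin (tangent_angle \<theta>0 k s)) = 0"
  shows "convex_closed_curve P (tangent_angle \<theta>0 k)"
proof
  show "continuous_on {0..P} (tangent_angle \<theta>0 k)"
    unfolding tangent_angle_def by (intro continuous_intros indefinite_integral_continuous_1 assms)
  fix s t :: real assume st: "0 \<le> s" "s \<le> t" "t \<le> P"
  have "integral {s..t} k \<ge> 0"
    using integral_increment(2)[OF assms(2) st] assms(3) st by (intro integral_nonneg) auto
  then show "tangent_angle \<theta>0 k s \<le> tangent_angle \<theta>0 k t"
    using integral_increment(1)[OF assms(2) st] by (simp add: tangent_angle_def)
qed (use assms in \<open>auto simp: tangent_angle_def\<close>)

lemma (in convex_closed_curve) measure_interior_region_area_form: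
  "measure lebesgue (interior region) = area_form P \<theta> (\<lambda>_. 1) (\<lambda>_. 1)"
  by (simp add: measure_interior_region area_form_def)

text \<open>A bounded open convex set is determined by its frontier: its closure is the hull of the
  frontier, and it is the interior of its closure. Hence the given domain is the interior of
  \<open>region\<close>, whose area is known.\<close>

lemma in_class_C_region:
  assumes C: "in_class_C \<Omega> P k"
  obtains \<theta>0 where "tangent_angle \<theta>0 k P = \<theta>0 + 2 * pi"
    "integral {0..P} (\<lambda>s. cos (tangent_angle \<theta>0 k s)) = 0"
    "integral {0..P} (\<lambda>s. sin (tangent_angle \<theta>0 k s)) = 0"
    "measure lebesgue \<Omega> = area_form P (tangent_angle \<theta>0 k) (\<lambda>_. 1) (\<lambda>_. 1)"
proof -
  obtain \<theta>0 p where t: "tangent_angle \<theta>0 k P = \<theta>0 + 2 * pi"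
        "integral {0..P} (\<lambda>s. cos (tangent_angle \<theta>0 k s)) = 0"
        "integral {0..P} (\<lambda>s. sin (tangent_angle \<theta>0 k s)) = 0"
        "frontier \<Omega> = arc_curve p (tangent_angle \<theta>0 k) ` {0..P}"
    using C unfolding in_class_C_def by blast
  have \<Omega>: "bounded \<Omega>" "open \<Omega>" "convex \<Omega>" using C by (auto simp: in_class_C_def)
  interpret convex_closed_curve P "tangent_angle \<theta>0 k" p
    by (rule convex_closed_curve_tangent_angle) (use C t in \<open>auto simp: in_class_C_def\<close>)
  have int: "interior (closure \<Omega>) = \<Omega>"
    using \<Omega> by (simp add: convex_interior_closure interior_open)
  have "frontier (closure \<Omega>) = frontier \<Omega>"
    using int \<Omega> by (simp add: frontier_def interior_open)
  then have "closure \<Omega> = convex hull (frontier \<Omega>)"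
    using Krein_Milman_frontier[of "closure \<Omega>"] \<Omega> by (simp add: convex_closure)
  then have "closure \<Omega> = region" using t(4) by (simp add: region_def \<gamma>_def)
  then have "\<Omega> = interior region" using int by simp
  then show thesis using that[OF t(1-3)] measure_interior_region_area_form by simp
qed

lemma borel_curvature:
  fixes k :: "real \<Rightarrow> real"
  assumes "k integrable_on {0..P}" "\<forall>s\<in>{0..P}. k s \<ge> 0"
  obtains k' N where "k' \<in> borel_measurable borel" "\<And>s. k' s \<ge> 0" "negligible N"
    "\<And>s. s \<in> {0..P} - N \<Longrightarrow> k' s = k s"
proof -
  define f where "f s = (if s \<in> {0..P} then k s else 0)" for s
  have "f integrable_on UNIV"
    unfolding f_def using assms(1) by (simp only: integrable_restrict_UNIV)
  then have "f \<in> borel_measurable lebesgue"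
    using integrable_imp_measurable[of f UNIV] by simp
  then obtain g where g: "g \<in> borel_measurable lborel" "AE x in lborel. f x = g x"
    using completion_ex_borel_measurable_real by blast
  then obtain N where N: "N \<in> null_sets lborel" "{x. f x \<noteq> g x} \<subseteq> N"
    by (elim AE_E) (auto simp: null_sets_def)
  have "negligible N"
    using N(1) by (simp add: negligible_iff_null_sets null_sets_completionI)
  moreover have "max 0 (g s) = k s" if "s \<in> {0..P} - N" for s
  proof -
    have "f s = g s" using that N(2) by blast
    moreover have "k s \<ge> 0" using that assms(2) by blast
    ultimately show ?thesis using that by (simp add: f_def)
  qed
  moreover have "(\<lambda>s. max 0 (g s)) \<in> borel_measurable borel" using g(1) by simp
  ultimately show thesis
    by (intro that[of "\<lambda>s. max 0 (g s)" N]) simp_all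
qed

text \<open>Eliminates the domains; from here on only curvature functions are handled. From right to
  left the domain is the interior of \<open>region\<close>; from left to right the curvature is
  first made Borel, which changes no integral.\<close>

lemma E_set_iff:
  "(x, y) \<in> E_set \<longleftrightarrow> (\<exists>P k \<theta>0. closed_curvature P k \<theta>0 \<and>
     x = 4 * pi * area_form P (tangent_angle \<theta>0 k) (\<lambda>_. 1) (\<lambda>_. 1) / P\<^sup>2 \<and>
     y = elastic_energy P k * P / (2 * pi\<^sup>2))" (is "?L \<longleftrightarrow> ?R")
proof
  assume ?R
  then obtain P k \<theta>0 where k: "closed_curvature P k \<theta>0"
    and xy: "x = 4 * pi * area_form P (tangent_angle \<theta>0 k) (\<lambda>_. 1) (\<lambda>_. 1) / P\<^sup>2"
     "y = elastic_energy P k * P / (2 * pi\<^sup>2)" by blast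
  have t: "tangent_angle \<theta>0 k P = \<theta>0 + 2 * pi" using k by (simp add: closed_curvature_def tangent_angle_def)
  interpret convex_closed_curve P "tangent_angle \<theta>0 k" "(0, 0)"
    by (rule convex_closed_curve_tangent_angle) (use k t in \<open>auto simp: closed_curvature_def\<close>)
  have "frontier (interior region) = closure region - interior region"
    using convex_closure_interior[OF convex_region interior_region_nonempty] by (simp add: frontier_def)
  then have fr: "frontier (interior region) = trace"
    using frontier_region by (simp add: frontier_def)
  have "in_class_C (interior region) P k"
    unfolding in_class_C_def
  proof (intro conjI exI)
    show "bounded (interior region)"
      using compact_region bounded_interior compact_imp_bounded by blast
    show "frontier (interior region) = arc_curve (0, 0) (tangent_angle \<theta>0 k) ` {0..P}"
      using fr by (simp add: \<gamma>_def)
    show "inj_on (arc_curve (0, 0) (tangent_angle \<theta>0 k)) {0..<P}"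
      using inj_on_\<gamma> by (simp add: \<gamma>_def)
  qed (use k t convex_region in \<open>auto simp: closed_curvature_def convex_interior\<close>)
  then show ?L
    unfolding E_set_def mem_Collect_eq xy measure_interior_region_area_form[symmetric] by blast
next
  assume ?L
  then obtain \<Omega> P k where C: "in_class_C \<Omega> P k"
    and xy: "x = 4 * pi * measure lebesgue \<Omega> / P\<^sup>2" "y = elastic_energy P k * P / (2 * pi\<^sup>2)"
    unfolding E_set_def mem_Collect_eq prod.inject by blast
  obtain \<theta>0 where t: "tangent_angle \<theta>0 k P = \<theta>0 + 2 * pi"
    "integral {0..P} (\<lambda>s. cos (tangent_angle \<theta>0 k s)) = 0"
    "integral {0..P} (\<lambda>s. sin (tangent_angle \<theta>0 k s)) = 0"
    "measure lebesgue \<Omega> = area_form P (tangent_angle \<theta>0 k) (\<lambda>_. 1) (\<lambda>_. 1)"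
    using in_class_C_region[OF C] by blast
  have k: "k integrable_on {0..P}" "\<forall>s\<in>{0..P}. k s \<ge> 0" "(\<lambda>s. (k s)\<^sup>2) integrable_on {0..P}" "P > 0"
    using C by (auto simp: in_class_C_def)
  obtain k' N where k': "k' \<in> borel_measurable borel" "\<And>s. k' s \<ge> 0" and N: "negligible N"
    and eq: "\<And>s. s \<in> {0..P} - N \<Longrightarrow> k' s = k s"
    using borel_curvature[OF k(1,2)] by blast
  have ieq: "integral {0..s} k' = integral {0..s} k" if "s \<le> P" for s
    by (rule integral_spike[OF N]) (use eq that in auto)
  have ang: "tangent_angle \<theta>0 k' s = tangent_angle \<theta>0 k s" if "s \<le> P" for s
    using ieq[OF that] by (simp add: tangent_angle_def)
  have "k' integrable_on {0..P}" "(\<lambda>s. (k' s)\<^sup>2) integrable_on {0..P}"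
    by (rule integrable_spike[OF k(1) N], simp add: eq) (rule integrable_spike[OF k(3) N], simp add: eq)
  moreover have E: "elastic_energy P k' = elastic_energy P k"
    unfolding elastic_energy_def
    by (rule arg_cong[of _ _ "\<lambda>z. z / 2"], rule integral_spike[OF N]) (simp add: eq)
  moreover have tr: "integral {0..s} (\<lambda>s. 1 * cos (tangent_angle \<theta>0 k' s)) = integral {0..s} (\<lambda>s. 1 * cos (tangent_angle \<theta>0 k s))"
    "integral {0..s} (\<lambda>s. 1 * sin (tangent_angle \<theta>0 k' s)) = integral {0..s} (\<lambda>s. 1 * sin (tangent_angle \<theta>0 k s))"
    if "s \<le> P" for s
    by (rule Henstock_Kurzweil_Integration.integral_cong; use that ang in simp)+
  moreover have "integral {0..P} k' = 2 * pi" using ieq[of P] t(1) by (simp add: tangent_angle_def)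
  ultimately have "closed_curvature P k' \<theta>0"
    using tr[of P] t k k' by (simp add: closed_curvature_def)
  moreover have A: "area_form P (tangent_angle \<theta>0 k') (\<lambda>_. 1) (\<lambda>_. 1) = area_form P (tangent_angle \<theta>0 k) (\<lambda>_. 1) (\<lambda>_. 1)"
    unfolding area_form_def by (intro arg_cong[of _ _ "\<lambda>z. z / 2"] Henstock_Kurzweil_Integration.integral_cong) (simp add: ang tr[simplified])
  ultimately show ?R unfolding xy t(4) E[symmetric] A[symmetric] by blast
qed

section \<open>Reweighting the arc length\<close>

text \<open>\<open>G\<close> is the new arc length as a function of the old one. The positive lower
  bound on the density makes it an increasing bijection of the line, with inverse
  \<open>\<phi>\<close>.\<close>

locale increasing_reparam =
  fixes v G :: "real \<Rightarrow> real" and c :: real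
  assumes v_meas [measurable]: "v \<in> borel_measurable borel"
    and c_pos: "c > 0" and v_ge: "\<And>x. c \<le> v x"
    and v_int: "\<And>a b. v integrable_on {a..b}"
    and G_diff: "\<And>x y. x \<le> y \<Longrightarrow> G y - G x = integral {x..y} v"
begin

lemma G_increment: "x \<le> y \<Longrightarrow> c * (y - x) \<le> G y - G x"
  using integral_le[of "\<lambda>_. c" "{x..y}" v] v_int[of x y] v_ge G_diff[of x y]
  by (simp add: integrable_const_ivl mult.commute)

lemma G_strict_mono: "x < y \<Longrightarrow> G x < G y"
  using G_increment[of x y] mult_pos_pos[OF c_pos, of "y - x"] by simp

lemma G_less_iff: "G x < G y \<longleftrightarrow> x < y"
  by (metis G_strict_mono linorder_neqE_linordered_idom order_less_asym order_less_irrefl)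

lemma G_le_iff: "G x \<le> G y \<longleftrightarrow> x \<le> y"
  using G_less_iff[of y x] by auto

lemma G_continuous_on: "continuous_on {a..b} G"
  by (rule continuous_on_indefinite_integral[where f = v and c = "G a"])
    (use v_int G_diff in \<open>auto simp: algebra_simps\<close>)

lemma G_surj: "\<exists>x. G x = y"
proof -
  define d where "d = \<bar>y - G 0\<bar> / c"
  have d: "0 \<le> d" "c * d = \<bar>y - G 0\<bar>" using c_pos by (auto simp: d_def)
  have "G (- d) \<le> y" using G_increment[of "- d" 0] d by auto
  moreover have "y \<le> G d" using G_increment[of 0 d] d by auto
  ultimately show ?thesis
    using IVT'[of G "- d" y d] d G_continuous_on by auto
qed

definition \<phi> :: "real \<Rightarrow> real" where "\<phi> y = (SOME x. G x = y)"

lemma G_\<phi> [simp]: "G (\<phi> y) = y"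
  unfolding \<phi>_def using G_surj by (rule someI_ex)

lemma \<phi>_G [simp]: "\<phi> (G x) = x"
  by (metis G_\<phi> G_le_iff order_antisym order_refl)

lemma \<phi>_measurable [measurable]: "\<phi> \<in> borel_measurable borel"
  by (rule borel_measurable_mono) (metis G_\<phi> G_le_iff monoI)

lemma G_measurable [measurable]: "G \<in> borel_measurable borel"
  by (rule borel_measurable_mono) (metis G_le_iff monoI)

lemma v_nonneg: "0 \<le> v x"
  using v_ge[of x] c_pos by linarith

text \<open>Substitution without derivatives: since \<open>v\<close> is only integrable,
  \<open>G\<close> need not be differentiable everywhere, but the image of \<open>v dx\<close> under
  \<open>G\<close> has the right value on intervals, hence is Lebesgue measure.\<close>

lemma lborel_eq_distr_G: "lborel = distr (density lborel (\<lambda>x. ennreal (v x))) borel G"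
proof (rule lborel_eqI)
  fix l u :: real assume "\<And>b. b \<in> Basis \<Longrightarrow> l \<bullet> b \<le> u \<bullet> b"
  then have lu: "l \<le> u" by auto
  have \<phi>lu: "\<phi> l \<le> \<phi> u" using lu G_le_iff[of "\<phi> l" "\<phi> u"] by simp
  have vim: "G -` box l u = {\<phi> l<..<\<phi> u}"
    using G_less_iff[of "\<phi> l"] G_less_iff[of _ "\<phi> u"] by auto
  have "(v has_integral u - l) {\<phi> l..\<phi> u}"
    using integrable_integral[OF v_int[of "\<phi> l" "\<phi> u"]] G_diff[OF \<phi>lu] by simp
  then have hi: "(v has_integral u - l) {\<phi> l<..<\<phi> u}"
    using has_integral_open_interval[of v "u - l" "\<phi> l" "\<phi> u"] by (simp add: box_real)
  have "emeasure (distr (density lborel (\<lambda>x. ennreal (v x))) borel G) (box l u)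
      = (\<integral>\<^sup>+x. ennreal (v x) * indicator {\<phi> l<..<\<phi> u} x \<partial>lborel)"
    by (simp add: emeasure_distr emeasure_density vim del: box_real)
  also have "\<dots> = (\<integral>\<^sup>+x. ennreal (if x \<in> {\<phi> l<..<\<phi> u} then v x else 0) \<partial>lborel)"
    by (intro nn_integral_cong) (auto simp: indicator_def)
  also have "\<dots> = ennreal (u - l)"
  proof (rule nn_integral_has_integral_lborel)
    show "((\<lambda>x. if x \<in> {\<phi> l<..<\<phi> u} then v x else 0) has_integral u - l) UNIV"
      using hi by (simp only: has_integral_restrict_UNIV)
  qed (use v_nonneg in auto)
  finally show "emeasure (distr (density lborel (\<lambda>x. ennreal (v x))) borel G) (box l u) = ennreal (\<Prod>b\<in>Basis. (u - l) \<bullet> b)"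
    by simp
qed simp

lemma has_integral_substitution_\<phi>:
  fixes h :: "real \<Rightarrow> real"
  assumes hm: "(\<lambda>x. indicator {s..t} x * h x) \<in> borel_measurable borel"
    and hi: "(\<lambda>x. h x * v x) absolutely_integrable_on {s..t}"
  shows "((\<lambda>u. h (\<phi> u)) has_integral integral {s..t} (\<lambda>x. h x * v x)) {G s..G t}"
proof -
  define f where "f u = indicator {s..t} (\<phi> u) * h (\<phi> u)" for u
  have f_eq: "f u = indicator {G s..G t} u *\<^sub>R h (\<phi> u)" for u
    using G_le_iff[of s "\<phi> u"] G_le_iff[of "\<phi> u" t] by (auto simp: f_def indicator_def)
  have fm: "f \<in> borel_measurable borel"
    unfolding f_def using measurable_compose[OF \<phi>_measurable hm] by simp
  have fG: "f (G x) = indicator {s..t} x * h x" for x by (simp add: f_def)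
  have m: "(\<lambda>x. v x *\<^sub>R (indicator {s..t} x * h x)) \<in> borel_measurable borel"
    using hm by simp
  have "integrable lebesgue (\<lambda>x. v x *\<^sub>R (indicator {s..t} x * h x))"
    using hi unfolding set_integrable_def by (simp add: mult_ac)
  then have i: "integrable lborel (\<lambda>x. v x *\<^sub>R (indicator {s..t} x * h x))"
    using integrable_completion[of _ lborel] m by (metis measurable_lborel2)
  have int: "(LINT x|lborel. v x *\<^sub>R (indicator {s..t} x * h x)) = integral {s..t} (\<lambda>x. h x * v x)"
  proof -
    have "set_integrable lborel {s..t} (\<lambda>x. h x * v x)"
      using i unfolding set_integrable_def by (simp add: mult_ac)
    from set_borel_integral_eq_integral(2)[OF this] show ?thesis
      unfolding set_lebesgue_integral_def by (simp add: mult_ac)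
  qed
  have v_AE: "AE x in lborel. 0 \<le> v x" using v_nonneg by simp
  have "integrable (density lborel (\<lambda>x. ennreal (v x))) (\<lambda>x. f (G x))"
    unfolding fG using i hm v_AE by (subst integrable_density) auto
  then have "integrable (distr (density lborel (\<lambda>x. ennreal (v x))) borel G) f"
    using fm by (subst integrable_distr_eq) auto
  then have fi: "integrable lborel f"
    using lborel_eq_distr_G by simp
  have "(LINT u|lborel. f u) = (LINT u|distr (density lborel (\<lambda>x. ennreal (v x))) borel G. f u)"
    using lborel_eq_distr_G by simp
  also have "\<dots> = (LINT x|density lborel (\<lambda>x. ennreal (v x)). f (G x))"
    using fm by (subst integral_distr) auto
  also have "\<dots> = integral {s..t} (\<lambda>x. h x * v x)"
    unfolding fG int[symmetric] using hm v_AE by (subst integral_density) auto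
  finally have eq: "(LINT u|lborel. f u) = integral {s..t} (\<lambda>x. h x * v x)" .
  have si: "set_integrable lborel {G s..G t} (\<lambda>u. h (\<phi> u))"
    using fi unfolding set_integrable_def f_eq[symmetric] .
  have "(LINT u:{G s..G t}|lborel. h (\<phi> u)) = integral {s..t} (\<lambda>x. h x * v x)"
    unfolding set_lebesgue_integral_def f_eq[symmetric] eq ..
  with set_borel_integral_eq_integral[OF si] show ?thesis
    by (simp add: has_integral_iff)
qed

end

lemma borel_measurable_lebesgue_onI:
  fixes f :: "real \<Rightarrow> real"
  assumes "f \<in> borel_measurable borel"
  shows "f \<in> borel_measurable (lebesgue_on S)"
  using assms by (intro measurable_restrict_space1 measurable_completion) simp

lemma absolutely_integrable_nonneg:
  fixes f :: "real \<Rightarrow> real"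
  assumes "f integrable_on S" "\<And>x. x \<in> S \<Longrightarrow> 0 \<le> f x"
  shows "f absolutely_integrable_on S"
  using assms nonnegative_absolutely_integrable_1 by blast

lemma ex_increasing_reparam:
  fixes v :: "real \<Rightarrow> real"
  assumes v: "v \<in> borel_measurable borel" "c > 0" "\<And>x. c \<le> v x" "v integrable_on {0..P}" "P > 0"
  obtains w G where "increasing_reparam w G (min c 1)" "\<And>x. x \<in> {0..P} \<Longrightarrow> w x = v x" "G 0 = 0"
proof -
  \<comment> \<open>Extension by 1 makes the density live on the whole line, hence the lower bound
    \<open>min c 1\<close>.\<close>
  define w where "w x = (if x \<in> {0..P} then v x else 1)" for x
  have wm: "w \<in> borel_measurable borel" unfolding w_def using v(1) by measurable
  have w_ge: "min c 1 \<le> w x" for x using v(3)[of x] by (auto simp: w_def)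
  have wi: "w integrable_on {a..b}" for a b
  proof -
    have "(\<lambda>x. v x - 1) integrable_on {0..P}"
      using v(4) by (intro integrable_diff) (auto simp: integrable_const_ivl)
    then have "(\<lambda>x. if x \<in> {0..P} then v x - 1 else 0) integrable_on UNIV"
      by (simp only: integrable_restrict_UNIV)
    then have "(\<lambda>x. if x \<in> {0..P} then v x - 1 else 0) integrable_on {a..b}"
      using integrable_on_subcbox[of _ UNIV a b] by simp
    then have "(\<lambda>x. (if x \<in> {0..P} then v x - 1 else 0) + 1) integrable_on {a..b}"
      by (intro integrable_add) (auto simp: integrable_const_ivl)
    moreover have "(\<lambda>x. (if x \<in> {0..P} then v x - 1 else 0) + 1) = w" by (auto simp: w_def)
    ultimately show ?thesis by simp
  qed
  \<comment> \<open>The signed integral from 0: at least one of the two intervals is empty or a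
    point.\<close>
  define G where "G x = integral {0..x} w - integral {x..0} w" for x
  have "G y - G x = integral {x..y} w" if "x \<le> y" for x y
  proof -
    have comb: "integral {a..b} w + integral {b..d} w = integral {a..d} w" if "a \<le> b" "b \<le> d" for a b d
      using Henstock_Kurzweil_Integration.integral_combine[OF that wi] .
    consider "0 \<le> x" | "x < 0" "0 \<le> y" | "y < 0" using that by linarith
    then show ?thesis
    proof cases
      case 1 then show ?thesis using comb[of 0 x y] that by (cases "x = 0"; cases "y = 0") (auto simp: G_def)
    next
      case 2 then show ?thesis using comb[of x 0 y] by (cases "y = 0") (auto simp: G_def)
    next
      case 3 then show ?thesis using comb[of x y 0] that by (auto simp: G_def)
    qed
  qed
  then have "increasing_reparam w G (min c 1)"
    using wm w_ge wi v(2) by unfold_locales auto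
  moreover have "G 0 = 0" by (simp add: G_def)
  ultimately show thesis using that[of w G] by (simp add: w_def)
qed

text \<open>In the new arc length the curvature is \<open>k / v\<close>, transported by the inverse
  \<open>\<phi>\<close>. The tangent angle at corresponding points is the same, so total turning and
  convexity persist, and the square of \<open>k / v\<close> times the length element
  \<open>v ds\<close> gives the energy density \<open>k^2 / v\<close>.\<close>

theorem E_set_reweight:
  assumes k: "closed_curvature P k \<theta>0"
    and v: "v \<in> borel_measurable borel" "c > 0" "\<And>x. c \<le> v x" "v integrable_on {0..P}"
  defines "\<theta> \<equiv> tangent_angle \<theta>0 k"
  assumes cl: "integral {0..P} (\<lambda>s. v s * cos (\<theta> s)) = 0" "integral {0..P} (\<lambda>s. v s * sin (\<theta> s)) = 0"
  shows "(4 * pi * area_form P \<theta> v v / (integral {0..P} v)\<^sup>2,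
     integral {0..P} (\<lambda>s. (k s)\<^sup>2 / v s) / 2 * integral {0..P} v / (2 * pi\<^sup>2)) \<in> E_set"
proof -
  have P: "P > 0" and km: "k \<in> borel_measurable borel" and k0: "\<And>s. k s \<ge> 0"
    and ki: "k integrable_on {0..P}" "(\<lambda>s. (k s)\<^sup>2) integrable_on {0..P}" and k2: "integral {0..P} k = 2 * pi"
    using k by (auto simp: closed_curvature_def)
  have kai: "k absolutely_integrable_on {0..P}" by (rule absolutely_integrable_nonneg[OF ki(1)]) (rule k0)
  obtain w G where "increasing_reparam w G (min c 1)" and wv: "\<And>x. x \<in> {0..P} \<Longrightarrow> w x = v x" and G0: "G 0 = 0"
    using ex_increasing_reparam[OF v P] by blast
  then interpret R: increasing_reparam w G "min c 1" by simp
  note [measurable] = km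
  have w0: "w x > 0" for x using R.v_ge[of x] R.c_pos by linarith
  have w_ai: "w absolutely_integrable_on {s..t}" for s t
    by (rule absolutely_integrable_nonneg[OF R.v_int]) (rule R.v_nonneg)
  define P' where "P' = G P"
  have GP: "P' = integral {0..P} v"
    using R.G_diff[of 0 P] P G0 Henstock_Kurzweil_Integration.integral_cong[of "{0..P}" w v] wv by (simp add: P'_def)
  have P': "P' > 0" using R.G_strict_mono[OF P] G0 by (simp add: P'_def)
  have \<phi>_in: "R.\<phi> u \<in> {0..P}" if "u \<in> {0..P'}" for u
    using that R.G_le_iff[of 0 "R.\<phi> u"] R.G_le_iff[of "R.\<phi> u" P] G0 by (simp add: P'_def)
  define k' where "k' u = k (R.\<phi> u) / w (R.\<phi> u)" for u
  have \<theta>_cont: "continuous_on {0..P} \<theta>"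
    unfolding \<theta>_def tangent_angle_def by (intro continuous_intros indefinite_integral_continuous_1 ki)
  have subst_cont: "((\<lambda>u. h (R.\<phi> u)) has_integral integral {0..s} (\<lambda>x. v x * h x)) {0..G s}"
    if "continuous_on {0..P} h" "s \<in> {0..P}" for h s
  proof -
    have ch: "continuous_on {0..s} h" using that by (auto intro: continuous_on_subset)
    have "(\<lambda>x. indicator {0..s} x * h x) \<in> borel_measurable borel"
      using borel_measurable_continuous_on_indicator[OF _ ch] by simp
    moreover have "(\<lambda>x. h x * w x) absolutely_integrable_on {0..s}"
      using absolutely_integrable_continuous_mult(1)[OF ch w_ai] .
    ultimately have "((\<lambda>u. h (R.\<phi> u)) has_integral integral {0..s} (\<lambda>x. h x * w x)) {G 0..G s}"
      by (rule R.has_integral_substitution_\<phi>)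
    moreover have "integral {0..s} (\<lambda>x. h x * w x) = integral {0..s} (\<lambda>x. v x * h x)"
      using that wv by (intro Henstock_Kurzweil_Integration.integral_cong) auto
    ultimately show ?thesis using G0 by simp
  qed
  have k'_int: "(k' has_integral integral {0..s} k) {0..G s}" if "s \<in> {0..P}" for s
  proof -
    have eq: "(\<lambda>x. k x / w x * w x) = k" using w0 by (auto simp: less_imp_neq[symmetric])
    have "(\<lambda>x. indicator {0..s} x * (k x / w x)) \<in> borel_measurable borel" by measurable
    moreover have "(\<lambda>x. k x / w x * w x) absolutely_integrable_on {0..s}"
      unfolding eq using absolutely_integrable_subinterval[OF kai, of 0 s] that by simp
    ultimately have "((\<lambda>u. k (R.\<phi> u) / w (R.\<phi> u)) has_integral integral {0..s} (\<lambda>x. k x / w x * w x)) {G 0..G s}"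
      by (rule R.has_integral_substitution_\<phi>)
    then show ?thesis unfolding eq G0 k'_def[abs_def] .
  qed
  have ang: "tangent_angle \<theta>0 k' u = \<theta> (R.\<phi> u)" if "u \<in> {0..P'}" for u
    using k'_int[OF \<phi>_in[OF that]] by (simp add: tangent_angle_def \<theta>_def integral_unique)
  have k'2: "((\<lambda>u. (k' u)\<^sup>2) has_integral integral {0..P} (\<lambda>s. (k s)\<^sup>2 / v s)) {0..P'}"
  proof -
    have eq: "(\<lambda>x. (k x / w x)\<^sup>2 * w x) = (\<lambda>x. (k x)\<^sup>2 / w x)"
    proof
      fix x show "(k x / w x)\<^sup>2 * w x = (k x)\<^sup>2 / w x" using w0[of x] by (simp add: power2_eq_square field_simps)
    qed
    have "(\<lambda>x. indicator {0..P} x * (k x / w x)\<^sup>2) \<in> borel_measurable borel" by measurable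
    moreover have "(\<lambda>x. (k x / w x)\<^sup>2 * w x) absolutely_integrable_on {0..P}"
      unfolding eq
    proof (rule measurable_bounded_by_integrable_imp_absolutely_integrable)
      show "(\<lambda>x. (k x)\<^sup>2 / w x) \<in> borel_measurable (lebesgue_on {0..P})"
        by (rule borel_measurable_lebesgue_onI) measurable
      show "(\<lambda>x. (k x)\<^sup>2 / min c 1) integrable_on {0..P}" by (rule integrable_on_divide[OF ki(2)])
      show "norm ((k x)\<^sup>2 / w x) \<le> (k x)\<^sup>2 / min c 1" for x
        using w0[of x] R.v_ge[of x] R.c_pos by (auto intro!: divide_left_mono)
    qed auto
    ultimately have "((\<lambda>u. (k (R.\<phi> u) / w (R.\<phi> u))\<^sup>2) has_integral integral {0..P} (\<lambda>x. (k x / w x)\<^sup>2 * w x)) {G 0..G P}"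
      by (rule R.has_integral_substitution_\<phi>)
    then have "((\<lambda>u. (k' u)\<^sup>2) has_integral integral {0..P} (\<lambda>x. (k x)\<^sup>2 / w x)) {G 0..G P}"
      unfolding eq k'_def[abs_def] .
    moreover have "integral {0..P} (\<lambda>x. (k x)\<^sup>2 / w x) = integral {0..P} (\<lambda>x. (k x)\<^sup>2 / v x)"
      using wv by (intro Henstock_Kurzweil_Integration.integral_cong) auto
    ultimately show ?thesis using G0 by (simp add: P'_def)
  qed
  have trig: "integral {0..u} (\<lambda>t. cos (tangent_angle \<theta>0 k' t)) = integral {0..R.\<phi> u} (\<lambda>x. v x * cos (\<theta> x))"
    "integral {0..u} (\<lambda>t. sin (tangent_angle \<theta>0 k' t)) = integral {0..R.\<phi> u} (\<lambda>x. v x * sin (\<theta> x))"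
    if u: "u \<in> {0..P'}" for u
  proof -
    have "integral {0..u} (\<lambda>t. cos (tangent_angle \<theta>0 k' t)) = integral {0..u} (\<lambda>t. cos (\<theta> (R.\<phi> t)))"
      "integral {0..u} (\<lambda>t. sin (tangent_angle \<theta>0 k' t)) = integral {0..u} (\<lambda>t. sin (\<theta> (R.\<phi> t)))"
      using u ang by (auto intro!: Henstock_Kurzweil_Integration.integral_cong)
    then show "integral {0..u} (\<lambda>t. cos (tangent_angle \<theta>0 k' t)) = integral {0..R.\<phi> u} (\<lambda>x. v x * cos (\<theta> x))"
      "integral {0..u} (\<lambda>t. sin (tangent_angle \<theta>0 k' t)) = integral {0..R.\<phi> u} (\<lambda>x. v x * sin (\<theta> x))"
      using subst_cont[OF _ \<phi>_in[OF u], of "\<lambda>x. cos (\<theta> x)"] subst_cont[OF _ \<phi>_in[OF u], of "\<lambda>x. sin (\<theta> x)"] \<theta>_cont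
      by (auto simp: integral_unique intro!: continuous_intros)
  qed
  have "R.\<phi> P' = P" by (simp add: P'_def)
  have k'm: "k' \<in> borel_measurable borel" unfolding k'_def by measurable
  have k'0: "k' u \<ge> 0" for u unfolding k'_def using k0 R.v_nonneg by simp
  have "closed_curvature P' k' \<theta>0"
    using P' k'm k'0 k'_int[of P] k2 k'2 P trig[of P'] cl \<open>R.\<phi> P' = P\<close>
    by (auto simp: closed_curvature_def P'_def[symmetric] integral_unique)
  moreover have "area_form P' (tangent_angle \<theta>0 k') (\<lambda>_. 1) (\<lambda>_. 1) = area_form P \<theta> v v"
  proof -
    let ?h = "\<lambda>s. integral {0..s} (\<lambda>t. v t * cos (\<theta> t)) * sin (\<theta> s) - integral {0..s} (\<lambda>t. v t * sin (\<theta> t)) * cos (\<theta> s)"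
    have vai: "v absolutely_integrable_on {0..P}"
      by (rule absolutely_integrable_nonneg[OF v(4)]) (use v(2,3) in \<open>meson less_imp_le order_trans\<close>)
    have "continuous_on {0..P} ?h"
      using \<theta>_cont by (intro continuous_intros indefinite_integral_continuous_1 absolutely_integrable_continuous_mult(4)[OF _ vai])
    from subst_cont[OF this, of P] have "integral {0..P'} (\<lambda>u. ?h (R.\<phi> u)) = integral {0..P} (\<lambda>x. v x * ?h x)"
      using P by (simp add: integral_unique P'_def)
    moreover have "integral {0..P'} (\<lambda>u. ?h (R.\<phi> u)) = integral {0..P'} (\<lambda>u. integral {0..u} (\<lambda>t. cos (tangent_angle \<theta>0 k' t)) * sin (tangent_angle \<theta>0 k' u)
        - integral {0..u} (\<lambda>t. sin (tangent_angle \<theta>0 k' t)) * cos (tangent_angle \<theta>0 k' u))"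
      by (intro Henstock_Kurzweil_Integration.integral_cong) (simp only: trig ang)
    ultimately show ?thesis by (simp add: area_form_def mult.commute)
  qed
  moreover have "elastic_energy P' k' = integral {0..P} (\<lambda>s. (k s)\<^sup>2 / v s) / 2"
    using k'2 by (simp add: elastic_energy_def integral_unique)
  ultimately show ?thesis
    unfolding E_set_iff GP[symmetric] by - (rule exI[of _ P'], rule exI[of _ k'], rule exI[of _ \<theta>0], simp only:)
qed

section \<open>The area form\<close>

locale curvature =
  fixes P :: real and k :: "real \<Rightarrow> real" and \<theta>0 :: real
  assumes closed_curvature: "closed_curvature P k \<theta>0"
begin

definition \<theta> :: "real \<Rightarrow> real" where "\<theta> = tangent_angle \<theta>0 k"

lemma P_pos: "P > 0" and k_meas [measurable]: "k \<in> borel_measurable borel" and k_nonneg: "k s \<ge> 0"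
  and k_int: "k integrable_on {0..P}" and k2_int: "(\<lambda>s. (k s)\<^sup>2) integrable_on {0..P}"
  and k_total: "integral {0..P} k = 2 * pi"
  and closed_cos: "integral {0..P} (\<lambda>s. cos (\<theta> s)) = 0"
  and closed_sin: "integral {0..P} (\<lambda>s. sin (\<theta> s)) = 0"
  using closed_curvature by (auto simp: closed_curvature_def \<theta>_def)

lemma k_abs_int: "k absolutely_integrable_on {0..P}"
  by (rule absolutely_integrable_nonneg[OF k_int k_nonneg])

lemma \<theta>_eq: "\<theta> s = \<theta>0 + integral {0..s} k" and \<theta>_0: "\<theta> 0 = \<theta>0" and \<theta>_P: "\<theta> P = \<theta>0 + 2 * pi"
  using k_total by (simp_all add: \<theta>_def tangent_angle_def)

lemma \<theta>_cont: "continuous_on {0..P} \<theta>"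
  by (rule continuous_on_indefinite_integral[OF k_int \<theta>_eq])

lemma trig_cont: "continuous_on {0..P} (\<lambda>s. cos (\<theta> s))" "continuous_on {0..P} (\<lambda>s. sin (\<theta> s))"
  by (intro continuous_intros \<theta>_cont)+

text \<open>With weight \<open>k\<close> the curve becomes the unit circle traced by its own
  normals; this is the computation behind all statements on the disc.\<close>

lemma has_integral_k_trig:
  assumes "s \<in> {0..P}"
  shows "((\<lambda>s. k s * cos (\<theta> s)) has_integral sin (\<theta> s) - sin \<theta>0) {0..s}"
    "((\<lambda>s. k s * sin (\<theta> s)) has_integral cos \<theta>0 - cos (\<theta> s)) {0..s}"
proof -
  have k: "k absolutely_integrable_on {0..s}"
    using absolutely_integrable_subinterval[OF k_abs_int] assms by simp
  have lip: "\<bar>cos x - cos y\<bar> \<le> \<bar>x - y\<bar>" "\<bar>sin x - sin y\<bar> \<le> \<bar>x - y\<bar>" for x y :: real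
  proof -
    have *: "\<bar>f x - f y\<bar> \<le> \<bar>x - y\<bar>" if "\<And>z. (f has_field_derivative f' z) (at z)" "\<And>z. \<bar>f' z\<bar> \<le> 1" for f f' :: "real \<Rightarrow> real"
    proof -
      have "norm (f x - f y) \<le> 1 * norm (x - y)"
        by (rule field_differentiable_bound[of UNIV f f']) (use that in \<open>auto intro: has_field_derivative_at_within\<close>)
      then show ?thesis by simp
    qed
    show "\<bar>cos x - cos y\<bar> \<le> \<bar>x - y\<bar>" by (rule *[of cos "\<lambda>z. - sin z"]) (auto intro!: derivative_eq_intros)
    show "\<bar>sin x - sin y\<bar> \<le> \<bar>x - y\<bar>" by (rule *[of sin cos]) (auto intro!: derivative_eq_intros)
  qed
  have "((\<lambda>s. k s * cos (\<theta> s)) has_integral sin (\<theta> s) - sin (\<theta> 0)) {0..s}"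
    by (rule indefinite_integral_chain_rule[OF _ k])
      (use assms in \<open>auto simp: \<theta>_eq intro!: derivative_eq_intros lip\<close>)
  then show "((\<lambda>s. k s * cos (\<theta> s)) has_integral sin (\<theta> s) - sin \<theta>0) {0..s}" by (simp add: \<theta>_0)
  have "((\<lambda>s. k s * sin (\<theta> s)) has_integral (- cos (\<theta> s)) - (- cos (\<theta> 0))) {0..s}"
    by (rule indefinite_integral_chain_rule[OF _ k, where h = "\<lambda>x. - cos x"])
      (use assms in \<open>auto simp: \<theta>_eq intro!: derivative_eq_intros lip\<close>)
  then show "((\<lambda>s. k s * sin (\<theta> s)) has_integral cos \<theta>0 - cos (\<theta> s)) {0..s}" by (simp add: \<theta>_0)
qed

definition X :: "(real \<Rightarrow> real) \<Rightarrow> real \<Rightarrow> real" where "X f s = integral {0..s} (\<lambda>t. f t * cos (\<theta> t))"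
definition Y :: "(real \<Rightarrow> real) \<Rightarrow> real \<Rightarrow> real" where "Y f s = integral {0..s} (\<lambda>t. f t * sin (\<theta> t))"
text \<open>For a positive weight whose curve closes, this is the support function of the reweighted
  curve as seen from its starting point: the position paired with the outer normal. Accordingly
  \<open>B f g\<close> is the mixed area of the two reweighted curves.\<close>

definition height :: "(real \<Rightarrow> real) \<Rightarrow> real \<Rightarrow> real" where "height f s = X f s * sin (\<theta> s) - Y f s * cos (\<theta> s)"
definition B :: "(real \<Rightarrow> real) \<Rightarrow> (real \<Rightarrow> real) \<Rightarrow> real" where "B f g = integral {0..P} (\<lambda>s. height f s * g s) / 2"

lemma area_form_eq: "area_form P \<theta> f g = B f g"
  by (simp add: area_form_def B_def height_def X_def Y_def)

text \<open>The closing condition for the curve with length element \<open>f ds\<close>.\<close>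

definition balanced :: "(real \<Rightarrow> real) \<Rightarrow> bool" where
  "balanced f \<longleftrightarrow> f absolutely_integrable_on {0..P} \<and> X f P = 0 \<and> Y f P = 0"

lemma X_0 [simp]: "X f 0 = 0" and Y_0 [simp]: "Y f 0 = 0" and height_0 [simp]: "height f 0 = 0"
  by (simp_all add: X_def Y_def height_def)

lemma weighted_trig_abs_int:
  assumes "f absolutely_integrable_on {0..P}" "s \<le> P"
  shows "(\<lambda>t. f t * cos (\<theta> t)) absolutely_integrable_on {0..s}" "(\<lambda>t. f t * sin (\<theta> t)) absolutely_integrable_on {0..s}"
    "(\<lambda>t. f t * cos (\<theta> t)) integrable_on {0..s}" "(\<lambda>t. f t * sin (\<theta> t)) integrable_on {0..s}"
  using absolutely_integrable_subinterval[OF assms(1), of 0 s] continuous_on_subset[OF trig_cont(1), of "{0..s}"]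
    continuous_on_subset[OF trig_cont(2), of "{0..s}"] assms(2)
  by (auto intro!: absolutely_integrable_continuous_mult)

lemma XY_cont:
  assumes "f absolutely_integrable_on {0..P}"
  shows "continuous_on {0..P} (X f)" "continuous_on {0..P} (Y f)" "continuous_on {0..P} (height f)"
proof -
  show 1: "continuous_on {0..P} (X f)" "continuous_on {0..P} (Y f)"
    unfolding X_def Y_def using weighted_trig_abs_int[OF assms order_refl]
    by (auto intro: indefinite_integral_continuous_1)
  show "continuous_on {0..P} (height f)"
    unfolding height_def by (intro continuous_intros 1 \<theta>_cont)
qed

lemma XY_linear:
  assumes "f absolutely_integrable_on {0..P}" "g absolutely_integrable_on {0..P}" "s \<le> P"
  shows "X (\<lambda>t. f t + r * g t) s = X f s + r * X g s" "Y (\<lambda>t. f t + r * g t) s = Y f s + r * Y g s"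
    "height (\<lambda>t. f t + r * g t) s = height f s + r * height g s"
proof -
  note i = weighted_trig_abs_int[OF assms(1,3)] weighted_trig_abs_int[OF assms(2,3)]
  have "X (\<lambda>t. f t + r * g t) s = integral {0..s} (\<lambda>t. f t * cos (\<theta> t) + r * (g t * cos (\<theta> t)))"
    by (simp add: X_def algebra_simps)
  also have "\<dots> = X f s + r * X g s"
    unfolding X_def using i by (subst Henstock_Kurzweil_Integration.integral_add) (auto intro!: integrable_on_mult_right)
  finally show 1: "X (\<lambda>t. f t + r * g t) s = X f s + r * X g s" .
  have "Y (\<lambda>t. f t + r * g t) s = integral {0..s} (\<lambda>t. f t * sin (\<theta> t) + r * (g t * sin (\<theta> t)))"
    by (simp add: Y_def algebra_simps)
  also have "\<dots> = Y f s + r * Y g s"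
    unfolding Y_def using i by (subst Henstock_Kurzweil_Integration.integral_add) (auto intro!: integrable_on_mult_right)
  finally show 2: "Y (\<lambda>t. f t + r * g t) s = Y f s + r * Y g s" .
  show "height (\<lambda>t. f t + r * g t) s = height f s + r * height g s"
    by (simp add: height_def 1 2 algebra_simps)
qed

lemma height_mult_int:
  assumes "f absolutely_integrable_on {0..P}" "g absolutely_integrable_on {0..P}"
  shows "(\<lambda>s. height f s * g s) integrable_on {0..P}"
  using absolutely_integrable_continuous_mult(3)[OF XY_cont(3)[OF assms(1)] assms(2)] .

lemma B_add_left:
  assumes "f absolutely_integrable_on {0..P}" "g absolutely_integrable_on {0..P}" "h absolutely_integrable_on {0..P}"
  shows "B (\<lambda>t. f t + r * g t) h = B f h + r * B g h"
proof -
  have "integral {0..P} (\<lambda>s. height (\<lambda>t. f t + r * g t) s * h s) = integral {0..P} (\<lambda>s. height f s * h s + r * (height g s * h s))"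
    using XY_linear(3)[OF assms(1,2)] by (intro Henstock_Kurzweil_Integration.integral_cong) (auto simp: algebra_simps)
  also have "\<dots> = integral {0..P} (\<lambda>s. height f s * h s) + r * integral {0..P} (\<lambda>s. height g s * h s)"
    using height_mult_int assms by (subst Henstock_Kurzweil_Integration.integral_add) (auto intro!: integrable_on_mult_right)
  finally show ?thesis by (simp add: B_def field_simps)
qed

lemma B_add_right:
  assumes "f absolutely_integrable_on {0..P}" "g absolutely_integrable_on {0..P}" "h absolutely_integrable_on {0..P}"
  shows "B h (\<lambda>t. f t + r * g t) = B h f + r * B h g"
proof -
  have "integral {0..P} (\<lambda>s. height h s * (f s + r * g s)) = integral {0..P} (\<lambda>s. height h s * f s + r * (height h s * g s))"
    by (simp add: algebra_simps)
  also have "\<dots> = integral {0..P} (\<lambda>s. height h s * f s) + r * integral {0..P} (\<lambda>s. height h s * g s)"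
    using height_mult_int assms by (subst Henstock_Kurzweil_Integration.integral_add) (auto intro!: integrable_on_mult_right)
  finally show ?thesis by (simp add: B_def field_simps)
qed

text \<open>Integration by parts of \<open>X f * Y g\<close> and \<open>Y f * X g\<close>. The terms
  at 0 vanish by definition and those at \<open>P\<close> because \<open>f\<close> is
  balanced.\<close>

lemma B_sym:
  assumes f: "balanced f" and g: "g absolutely_integrable_on {0..P}"
  shows "B f g = B g f"
proof -
  have fa: "f absolutely_integrable_on {0..P}" and f0: "X f P = 0" "Y f P = 0" using f by (auto simp: balanced_def)
  note fi = weighted_trig_abs_int[OF fa order_refl] and gi = weighted_trig_abs_int[OF g order_refl]
  have P0: "0 \<le> P" using P_pos by simp
  have 1: "((\<lambda>s. f s * cos (\<theta> s) * Y g s + X f s * (g s * sin (\<theta> s))) has_integral X f P * Y g P - X f 0 * Y g 0) {0..P}"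
    by (rule indefinite_integral_product_rule[OF P0 fi(1) gi(2)]) (simp_all add: X_def Y_def)
  have 2: "((\<lambda>s. f s * sin (\<theta> s) * X g s + Y f s * (g s * cos (\<theta> s))) has_integral Y f P * X g P - Y f 0 * X g 0) {0..P}"
    by (rule indefinite_integral_product_rule[OF P0 fi(2) gi(1)]) (simp_all add: X_def Y_def)
  have "((\<lambda>s. height f s * g s - height g s * f s) has_integral 0) {0..P}"
    using has_integral_diff[OF 1 2] f0 by (simp add: height_def algebra_simps)
  then have "integral {0..P} (\<lambda>s. height f s * g s - height g s * f s) = 0" by (rule integral_unique)
  then show ?thesis
    using Henstock_Kurzweil_Integration.integral_diff[OF height_mult_int[OF fa g] height_mult_int[OF g fa]]
    by (simp add: B_def)
qed

lemma balanced_k: "balanced k"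
  using has_integral_k_trig[of P] P_pos k_abs_int
  by (simp add: balanced_def X_def Y_def integral_unique \<theta>_P)

text \<open>The mixed area with the unit disc is half the perimeter. Seen from the starting point,
  the support function of the disc is 1 plus a combination of \<open>sin\<close> and
  \<open>cos\<close> of the angle, and balanced functions are orthogonal to these.\<close>

lemma B_k_left:
  assumes "balanced f"
  shows "B k f = integral {0..P} f / 2"
proof -
  have fa: "f absolutely_integrable_on {0..P}" and f0: "X f P = 0" "Y f P = 0" using assms by (auto simp: balanced_def)
  note fi = weighted_trig_abs_int[OF fa order_refl]
  have f: "f integrable_on {0..P}" using fa by (simp add: absolutely_integrable_on_def)
  have h: "height k s = 1 - sin \<theta>0 * sin (\<theta> s) - cos \<theta>0 * cos (\<theta> s)" if "s \<in> {0..P}" for s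
  proof -
    have "height k s = (sin (\<theta> s))\<^sup>2 + (cos (\<theta> s))\<^sup>2 - sin \<theta>0 * sin (\<theta> s) - cos \<theta>0 * cos (\<theta> s)"
      using has_integral_k_trig[OF that]
      by (simp only: height_def X_def Y_def integral_unique power2_eq_square) (simp only: algebra_simps)
    then show ?thesis by simp
  qed
  have "integral {0..P} (\<lambda>s. height k s * f s) = integral {0..P} (\<lambda>s. f s - sin \<theta>0 * (f s * sin (\<theta> s)) - cos \<theta>0 * (f s * cos (\<theta> s)))"
    by (intro Henstock_Kurzweil_Integration.integral_cong) (simp add: h algebra_simps)
  also have "\<dots> = integral {0..P} f - sin \<theta>0 * Y f P - cos \<theta>0 * X f P"
    unfolding X_def Y_def using fi f
    by (simp add: Henstock_Kurzweil_Integration.integral_diff integrable_diff integrable_on_mult_right)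
  finally show ?thesis using f0 by (simp add: B_def)
qed

text \<open>Steiner formulas for area and perimeter of the parallel curve at distance
  \<open>r\<close>.\<close>

lemma B_add_k:
  fixes r :: real
  assumes "balanced f"
  defines "v \<equiv> \<lambda>s. f s + r * k s"
  shows "balanced v" "B v v = B f f + r * integral {0..P} f + pi * r\<^sup>2"
    "integral {0..P} v = integral {0..P} f + 2 * pi * r"
proof -
  have fa: "f absolutely_integrable_on {0..P}" and f0: "X f P = 0" "Y f P = 0" using assms by (auto simp: balanced_def)
  have va: "v absolutely_integrable_on {0..P}"
    unfolding v_def using fa k_abs_int by (intro set_integral_add set_integrable_mult_right) auto
  have k0: "X k P = 0" "Y k P = 0" using balanced_k by (auto simp: balanced_def)
  show "balanced v"
    using va f0 k0 XY_linear(1,2)[OF fa k_abs_int order_refl] by (simp add: balanced_def v_def)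
  have "B v v = B f v + r * B k v"
    unfolding v_def using B_add_left[OF fa k_abs_int va[unfolded v_def]] .
  also have "B f v = B f f + r * B f k" unfolding v_def by (rule B_add_right[OF fa k_abs_int fa])
  also have "B k v = B k f + r * B k k" unfolding v_def by (rule B_add_right[OF fa k_abs_int k_abs_int])
  also have "B f k = B k f" by (rule B_sym[OF assms(1) k_abs_int])
  finally show "B v v = B f f + r * integral {0..P} f + pi * r\<^sup>2"
    using B_k_left[OF assms(1)] B_k_left[OF balanced_k] k_total by (simp add: power2_eq_square algebra_simps)
  show "integral {0..P} v = integral {0..P} f + 2 * pi * r"
    unfolding v_def using fa k_int k_total
    by (subst Henstock_Kurzweil_Integration.integral_add) (auto intro!: integrable_on_mult_right simp: absolutely_integrable_on_def)
qed

text \<open>By the Steiner formulas \<open>(L + 2 pi r)^2 - 4 pi (B f f + r L + pi r^2)\<close>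
  equals \<open>L^2 - 4 pi B f f\<close>. So the first coordinate is governed by a fixed deficit
  over the square of the growing perimeter.\<close>

lemma E_set_add_k:
  assumes f: "balanced f" "f \<in> borel_measurable borel" "c > 0" "\<And>s. c \<le> f s" and r: "r \<ge> 0"
  defines "L \<equiv> integral {0..P} f"
  shows "(1 - (L\<^sup>2 - 4 * pi * B f f) / (L + 2 * pi * r)\<^sup>2,
    (L + 2 * pi * r) * integral {0..P} (\<lambda>s. (k s)\<^sup>2 / (f s + r * k s)) / (4 * pi\<^sup>2)) \<in> E_set"
proof -
  let ?v = "\<lambda>s. f s + r * k s"
  note v = B_add_k[OF f(1), of r]
  have vi: "?v integrable_on {0..P}" using v(1) by (simp add: balanced_def absolutely_integrable_on_def)
  have "c \<le> ?v s" for s using f(4)[of s] r k_nonneg[of s] by (simp add: add_increasing2)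
  moreover have "?v \<in> borel_measurable borel" using f(2) by measurable
  moreover have "integral {0..P} (\<lambda>s. ?v s * cos (tangent_angle \<theta>0 k s)) = 0" "integral {0..P} (\<lambda>s. ?v s * sin (tangent_angle \<theta>0 k s)) = 0"
    using v(1) by (auto simp: balanced_def X_def Y_def \<theta>_def)
  ultimately have E: "(4 * pi * B ?v ?v / (integral {0..P} ?v)\<^sup>2,
     integral {0..P} (\<lambda>s. (k s)\<^sup>2 / ?v s) / 2 * integral {0..P} ?v / (2 * pi\<^sup>2)) \<in> E_set"
    using E_set_reweight[OF closed_curvature _ f(3) _ vi] by (simp add: \<theta>_def[symmetric] area_form_eq)
  have "L \<ge> c * P"
    unfolding L_def using integral_le[of "\<lambda>_. c" "{0..P}" f] f(1,4) P_pos
    by (simp add: balanced_def absolutely_integrable_on_def integrable_const_ivl mult.commute)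
  then have L: "L + 2 * pi * r > 0" using f(3) P_pos r by (smt (verit) mult_nonneg_nonneg mult_pos_pos pi_gt_zero)
  have "4 * pi * B ?v ?v = (L + 2 * pi * r)\<^sup>2 - (L\<^sup>2 - 4 * pi * B f f)"
    unfolding v(2) by (simp add: L_def power2_eq_square algebra_simps)
  then have "4 * pi * B ?v ?v / (integral {0..P} ?v)\<^sup>2 = 1 - (L\<^sup>2 - 4 * pi * B f f) / (L + 2 * pi * r)\<^sup>2"
    unfolding v(3) L_def[symmetric] using L by (simp add: diff_divide_distrib)
  moreover have "integral {0..P} (\<lambda>s. (k s)\<^sup>2 / ?v s) / 2 * integral {0..P} ?v / (2 * pi\<^sup>2)
      = (L + 2 * pi * r) * integral {0..P} (\<lambda>s. (k s)\<^sup>2 / ?v s) / (4 * pi\<^sup>2)"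
    unfolding v(3) L_def[symmetric] by simp
  ultimately show ?thesis using E by (simp only:)
qed

lemma const_abs_int: "(\<lambda>_. a) absolutely_integrable_on {0..P}" for a :: real
  by (intro absolutely_integrable_continuous_real continuous_intros)

lemma balanced_1: "balanced (\<lambda>_. 1)"
  using closed_cos closed_sin const_abs_int by (simp add: balanced_def X_def Y_def)

lemma int_1: "integral {0..P} (\<lambda>_. 1 :: real) = P"
  using P_pos by simp

lemma k2_div_int:
  assumes f: "f \<in> borel_measurable borel" "c > 0" "\<And>s. c \<le> f s" and r: "r \<ge> 0"
  shows "(\<lambda>s. (k s)\<^sup>2 / (f s + r * k s)) integrable_on {0..P}"
proof (rule measurable_bounded_by_integrable_imp_integrable)
  show "(\<lambda>s. (k s)\<^sup>2 / (f s + r * k s)) \<in> borel_measurable (lebesgue_on {0..P})"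
    by (rule borel_measurable_lebesgue_onI) (use f(1) in measurable)
  show "(\<lambda>s. (k s)\<^sup>2 / c) integrable_on {0..P}" by (rule integrable_on_divide[OF k2_int])
  fix s
  have "c \<le> f s + r * k s" using f(3)[of s] r k_nonneg[of s] by (simp add: add_increasing2)
  then show "norm ((k s)\<^sup>2 / (f s + r * k s)) \<le> (k s)\<^sup>2 / c"
    using f(2) by (auto intro!: divide_left_mono)
qed auto

text \<open>The pointwise inequality is the tangent line of a function of \<open>k\<close> at its mean \<open>m\<close>.\<close>
lemma energy_add_k_le:
  assumes r: "r \<ge> 0"
  shows "(P + 2 * pi * r) * integral {0..P} (\<lambda>s. (k s)\<^sup>2 / (1 + r * k s)) \<le> P * integral {0..P} (\<lambda>s. (k s)\<^sup>2)"
proof -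
  define m where "m = 2 * pi / P"
  have m: "m > 0" "m * P = 2 * pi" using P_pos by (auto simp: m_def)
  have pos: "1 + r * x > 0" if "x \<ge> 0" for x using r that by (simp add: add_pos_nonneg)
  have pw: "m\<^sup>2 / (1 + r * m) * r * (k s - m) \<le> (k s)\<^sup>2 - (1 + m * r) * ((k s)\<^sup>2 / (1 + r * k s))" for s
  proof -
    let ?k = "k s"
    have 1: "1 + r * ?k > 0" "1 + r * m > 0" using pos k_nonneg m by auto
    have "?k\<^sup>2 - (1 + m * r) * (?k\<^sup>2 / (1 + r * ?k)) - m\<^sup>2 / (1 + r * m) * r * (?k - m)
      = r * (?k - m)\<^sup>2 * (?k + m + r * ?k * m) / ((1 + r * ?k) * (1 + r * m))"
      using 1 by (simp add: divide_simps) (simp add: power2_eq_square algebra_simps)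
    also have "\<dots> \<ge> 0" using 1 r m k_nonneg[of s] by (auto intro!: divide_nonneg_pos mult_nonneg_nonneg add_nonneg_nonneg)
    finally show ?thesis by linarith
  qed
  have i1: "(\<lambda>s. (k s)\<^sup>2 / (1 + r * k s)) integrable_on {0..P}"
    using k2_div_int[of "\<lambda>_. 1" 1 r] r by simp
  have i2: "(\<lambda>s. k s - m) integrable_on {0..P}" by (intro integrable_diff k_int) (simp add: integrable_const_ivl)
  have "integral {0..P} (\<lambda>s. k s - m) = 0"
    using k_int k_total m P_pos by (subst Henstock_Kurzweil_Integration.integral_diff) (auto simp: integrable_const_ivl mult.commute)
  then have "0 = integral {0..P} (\<lambda>s. m\<^sup>2 / (1 + r * m) * r * (k s - m))" by simp
  also have "\<dots> \<le> integral {0..P} (\<lambda>s. (k s)\<^sup>2 - (1 + m * r) * ((k s)\<^sup>2 / (1 + r * k s)))"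
    by (rule integral_le[OF integrable_on_mult_right[OF i2] integrable_diff[OF k2_int integrable_on_mult_right[OF i1]] pw])
  also have "\<dots> = integral {0..P} (\<lambda>s. (k s)\<^sup>2) - (1 + m * r) * integral {0..P} (\<lambda>s. (k s)\<^sup>2 / (1 + r * k s))"
    by (simp only: Henstock_Kurzweil_Integration.integral_diff[OF k2_int integrable_on_mult_right[OF i1]] integral_mult_right)
  finally have "(1 + m * r) * integral {0..P} (\<lambda>s. (k s)\<^sup>2 / (1 + r * k s)) \<le> integral {0..P} (\<lambda>s. (k s)\<^sup>2)" by simp
  then have "P * ((1 + m * r) * integral {0..P} (\<lambda>s. (k s)\<^sup>2 / (1 + r * k s))) \<le> P * integral {0..P} (\<lambda>s. (k s)\<^sup>2)"
    using P_pos by simp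
  moreover have "P * (1 + m * r) = P + 2 * pi * r" using m(2) by (simp add: algebra_simps)
  ultimately show ?thesis by (simp add: mult.assoc[symmetric])
qed

text \<open>Frenet equations in integrated form: \<open>q\<close> is the component of
  \<open>(X w, Y w)\<close> along the tangent and \<open>height w\<close> the one along the outer
  normal. Each summand is treated by the product rule.\<close>

lemma q_p_integrals:
  assumes w: "w absolutely_integrable_on {0..P}" and s: "s \<in> {0..P}"
  defines "q \<equiv> \<lambda>s. X w s * cos (\<theta> s) + Y w s * sin (\<theta> s)"
  shows "((\<lambda>t. k t * q t) has_integral height w s) {0..s}"
    "((\<lambda>t. w t - k t * height w t) has_integral q s) {0..s}"
proof -
  have s0: "0 \<le> s" "s \<le> P" using s by auto
  note wi = weighted_trig_abs_int[OF w s0(2)] and ki = weighted_trig_abs_int[OF k_abs_int s0(2)]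
  have ki': "(\<lambda>t. - (k t * sin (\<theta> t))) absolutely_integrable_on {0..s}"
    using absolutely_integrable_continuous_mult(2)[OF continuous_on_minus[OF continuous_on_subset[OF trig_cont(2)]]
        absolutely_integrable_subinterval[OF k_abs_int, of 0 s]] s0 by simp
  have S: "sin (\<theta> t) = sin (\<theta> 0) + integral {0..t} (\<lambda>t. k t * cos (\<theta> t))"
    "cos (\<theta> t) = cos (\<theta> 0) + integral {0..t} (\<lambda>t. - (k t * sin (\<theta> t)))" if "t \<in> {0..s}" for t
    using has_integral_k_trig[of t] that s by (simp_all add: integral_unique \<theta>_0)
  have 1: "((\<lambda>t. w t * cos (\<theta> t) * sin (\<theta> t) + X w t * (k t * cos (\<theta> t))) has_integral X w s * sin (\<theta> s) - X w 0 * sin (\<theta> 0)) {0..s}"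
    by (rule indefinite_integral_product_rule[OF s0(1) wi(1) ki(1) _ S(1)]) (simp_all add: X_def)
  have 2: "((\<lambda>t. w t * sin (\<theta> t) * cos (\<theta> t) + Y w t * (- (k t * sin (\<theta> t)))) has_integral Y w s * cos (\<theta> s) - Y w 0 * cos (\<theta> 0)) {0..s}"
    by (rule indefinite_integral_product_rule[OF s0(1) wi(2) ki' _ S(2)]) (simp_all add: Y_def)
  have 3: "((\<lambda>t. w t * cos (\<theta> t) * cos (\<theta> t) + X w t * (- (k t * sin (\<theta> t)))) has_integral X w s * cos (\<theta> s) - X w 0 * cos (\<theta> 0)) {0..s}"
    by (rule indefinite_integral_product_rule[OF s0(1) wi(1) ki' _ S(2)]) (simp_all add: X_def)
  have 4: "((\<lambda>t. w t * sin (\<theta> t) * sin (\<theta> t) + Y w t * (k t * cos (\<theta> t))) has_integral Y w s * sin (\<theta> s) - Y w 0 * sin (\<theta> 0)) {0..s}"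
    by (rule indefinite_integral_product_rule[OF s0(1) wi(2) ki(1) _ S(1)]) (simp_all add: Y_def)
  have e1: "w t * cos (\<theta> t) * sin (\<theta> t) + X w t * (k t * cos (\<theta> t)) - (w t * sin (\<theta> t) * cos (\<theta> t) + Y w t * (- (k t * sin (\<theta> t)))) = k t * q t" for t
    by (simp add: q_def algebra_simps)
  show "((\<lambda>t. k t * q t) has_integral height w s) {0..s}"
    using has_integral_diff[OF 1 2] unfolding e1 by (simp add: height_def)
  have e2: "w t * cos (\<theta> t) * cos (\<theta> t) + X w t * (- (k t * sin (\<theta> t))) + (w t * sin (\<theta> t) * sin (\<theta> t) + Y w t * (k t * cos (\<theta> t))) = w t - k t * height w t" for t
  proof -
    have "w t * cos (\<theta> t) * cos (\<theta> t) + w t * sin (\<theta> t) * sin (\<theta> t) = w t"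
      by (simp add: mult.assoc flip: distrib_left)
    then show ?thesis by (simp add: height_def algebra_simps)
  qed
  show "((\<lambda>t. w t - k t * height w t) has_integral q s) {0..s}"
    using has_integral_add[OF 3 4] unfolding e2 by (simp add: q_def)
qed

end

lemma E_set_increase_x:
  assumes E: "(x0, y0) \<in> E_set" and x: "x0 \<le> x" "x < 1"
  obtains y where "y \<le> y0" "(x, y) \<in> E_set"
proof -
  obtain P k \<theta>0 where k: "closed_curvature P k \<theta>0"
    and x0: "x0 = 4 * pi * area_form P (tangent_angle \<theta>0 k) (\<lambda>_. 1) (\<lambda>_. 1) / P\<^sup>2"
    and y0: "y0 = elastic_energy P k * P / (2 * pi\<^sup>2)"
    using E unfolding E_set_iff by blast
  interpret curvature P k \<theta>0 by standard (rule k)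
  \<comment> \<open>The factor by which the perimeter must grow: at fixed deficit
    \<open>1 - x\<close> is inversely proportional to its square.\<close>
  define b where "b = sqrt ((1 - x0) / (1 - x))"
  have b: "b \<ge> 1" "b\<^sup>2 = (1 - x0) / (1 - x)" using x by (auto simp: b_def)
  define r where "r = P * (b - 1) / (2 * pi)"
  have r: "r \<ge> 0" "P + 2 * pi * r = P * b" using b P_pos by (auto simp: r_def field_simps)
  have "P\<^sup>2 - 4 * pi * B (\<lambda>_. 1) (\<lambda>_. 1) = P\<^sup>2 * (1 - x0)"
    using x0 P_pos by (simp add: area_form_eq \<theta>_def[symmetric] field_simps)
  then have "1 - (P\<^sup>2 - 4 * pi * B (\<lambda>_. 1) (\<lambda>_. 1)) / (P + 2 * pi * r)\<^sup>2 = x"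
    using b x P_pos unfolding r(2) by (simp add: power_mult_distrib)
  then have "(x, (P + 2 * pi * r) * integral {0..P} (\<lambda>s. (k s)\<^sup>2 / (1 + r * k s)) / (4 * pi\<^sup>2)) \<in> E_set"
    using E_set_add_k[OF balanced_1, of 1 r] r int_1 by simp
  moreover have "(P + 2 * pi * r) * integral {0..P} (\<lambda>s. (k s)\<^sup>2 / (1 + r * k s)) / (4 * pi\<^sup>2) \<le> y0"
    using energy_add_k_le[OF r(1)] by (simp add: y0 elastic_energy_def divide_right_mono mult.commute)
  ultimately show thesis using that by blast
qed

section \<open>Local perturbations\<close>

text \<open>Gaussian elimination, by induction on the number of equations: an unknown with nonzero
  coefficient in the last equation is eliminated from the others.\<close>

lemma homogeneous_system_nontrivial_solution:
  fixes m :: "'i \<Rightarrow> nat \<Rightarrow> real"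
  assumes "finite I" "n < card I"
  shows "\<exists>c. (\<exists>i\<in>I. c i \<noteq> 0) \<and> (\<forall>j<n. (\<Sum>i\<in>I. c i * m i j) = 0)"
  using assms
proof (induction n arbitrary: I m)
  case 0
  then have "I \<noteq> {}" by auto
  then show ?case by (intro exI[of _ "\<lambda>_. 1"]) auto
next
  case (Suc n)
  show ?case
  proof (cases "\<forall>i\<in>I. m i n = 0")
    case True
    then obtain c where "\<exists>i\<in>I. c i \<noteq> 0" "\<forall>j<n. (\<Sum>i\<in>I. c i * m i j) = 0"
      using Suc.IH[of I m] Suc.prems by auto
    moreover have "(\<Sum>i\<in>I. c i * m i n) = 0" using True by simp
    ultimately show ?thesis by (intro exI[of _ c]) (auto simp: less_Suc_eq)
  next
    case False
    then obtain i0 where i0: "i0 \<in> I" "m i0 n \<noteq> 0" by blast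
    define J where "J = I - {i0}"
    have J: "finite J" "n < card J" "i0 \<notin> J" "I = insert i0 J"
      using Suc.prems i0 by (auto simp: J_def)
    obtain c where c: "\<exists>i\<in>J. c i \<noteq> 0" "\<forall>j<n. (\<Sum>i\<in>J. c i * (m i j - m i n / m i0 n * m i0 j)) = 0"
      using Suc.IH[OF J(1,2), of "\<lambda>i j. m i j - m i n / m i0 n * m i0 j"] by blast
    define S where "S = (\<Sum>i\<in>J. c i * m i n)"
    \<comment> \<open>The pivot unknown is set so that the last equation holds; the other equations
      then hold because \<open>c\<close> solves the reduced system.\<close>
    define d where "d = c(i0 := - S / m i0 n)"
    have sum_d: "(\<Sum>i\<in>I. d i * m i j) = - S / m i0 n * m i0 j + (\<Sum>i\<in>J. c i * m i j)" for j
    proof -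
      have "(\<Sum>i\<in>J. d i * m i j) = (\<Sum>i\<in>J. c i * m i j)" using J(3) by (intro sum.cong) (auto simp: d_def)
      then show ?thesis using J by (simp add: d_def)
    qed
    have "(\<Sum>i\<in>I. d i * m i j) = 0" if j: "j < Suc n" for j
    proof (cases "j = n")
      case True then show ?thesis using sum_d[of n] i0 by (simp add: S_def)
    next
      case False
      then have "0 = (\<Sum>i\<in>J. c i * (m i j - m i n / m i0 n * m i0 j))" using c(2) j by simp
      also have "\<dots> = (\<Sum>i\<in>J. c i * m i j) - (\<Sum>i\<in>J. c i * m i n * (m i0 j / m i0 n))"
        by (simp add: sum_subtractf[symmetric] algebra_simps)
      also have "\<dots> = (\<Sum>i\<in>J. c i * m i j) - S * (m i0 j / m i0 n)" by (simp add: S_def sum_distrib_right sum_divide_distrib)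
      finally show ?thesis using sum_d[of j] by simp
    qed
    moreover have "\<exists>i\<in>I. d i \<noteq> 0" using c(1) J by (auto simp: d_def)
    ultimately show ?thesis by blast
  qed
qed

text \<open>Division by a coefficient of largest modulus. The value 1, with this sign, is the upper
  bound of the perturbation, so subtracting nearly all of it squeezes one arc and keeps the density
  positive everywhere.\<close>

lemma homogeneous_system_normalized_solution:
  fixes m :: "'i \<Rightarrow> nat \<Rightarrow> real"
  assumes "finite I" "n < card I"
  obtains c i0 where "i0 \<in> I" "c i0 = 1" "\<And>i. i \<in> I \<Longrightarrow> \<bar>c i\<bar> \<le> 1" "\<And>j. j < n \<Longrightarrow> (\<Sum>i\<in>I. c i * m i j) = 0"
proof -
  obtain c where c: "\<exists>i\<in>I. c i \<noteq> 0" "\<forall>j<n. (\<Sum>i\<in>I. c i * m i j) = 0"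
    using homogeneous_system_nontrivial_solution[OF assms] by blast
  have "I \<noteq> {}" using c(1) by blast
  then have "Max ((\<lambda>i. \<bar>c i\<bar>) ` I) \<in> (\<lambda>i. \<bar>c i\<bar>) ` I" using assms(1) by (intro Max_in) auto
  then obtain i0 where i0: "i0 \<in> I" "Max ((\<lambda>i. \<bar>c i\<bar>) ` I) = \<bar>c i0\<bar>" by blast
  have le: "\<bar>c i\<bar> \<le> \<bar>c i0\<bar>" if "i \<in> I" for i
    using Max_ge[of "(\<lambda>i. \<bar>c i\<bar>) ` I" "\<bar>c i\<bar>"] assms(1) i0(2) that by auto
  have nz: "c i0 \<noteq> 0" using c(1) le by fastforce
  show thesis
  proof (rule that[of i0 "\<lambda>i. c i / c i0"])
    show "(\<Sum>i\<in>I. c i / c i0 * m i j) = 0" if "j < n" for j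
    proof -
      have "(\<Sum>i\<in>I. c i / c i0 * m i j) = (\<Sum>i\<in>I. c i * m i j) / c i0"
        by (simp add: sum_divide_distrib)
      then show ?thesis using c(2) that by simp
    qed
  qed (use i0 nz le in \<open>auto simp: divide_simps\<close>)
qed

lemma integral_eq_zero_if:
  fixes f :: "real \<Rightarrow> real"
  assumes "\<And>s. s \<in> S \<Longrightarrow> f s = 0"
  shows "integral S f = 0"
  using Henstock_Kurzweil_Integration.integral_cong[of S f "\<lambda>_. 0"] assms by simp

lemma integral_localize:
  fixes f :: "real \<Rightarrow> real"
  assumes f: "f integrable_on {0..P}" and ab: "0 \<le> a" "a \<le> b" "b \<le> P"
    and z: "\<And>s. s \<in> {0..P} \<Longrightarrow> s \<notin> {a<..<b} \<Longrightarrow> f s = 0"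
  shows "integral {0..P} f = integral {a..b} f"
proof -
  have "integral {0..a} f = 0" "integral {b..P} f = 0"
    using ab z by (auto intro!: integral_eq_zero_if)
  then show ?thesis
    using integral_increment(1)[OF f, of a b] integral_increment(1)[OF f, of b P] ab by simp
qed

lemma abs_integral_le_const:
  fixes f :: "real \<Rightarrow> real"
  assumes f: "f integrable_on {a..b}" and ab: "a \<le> b" and M: "\<And>s. s \<in> {a..b} \<Longrightarrow> \<bar>f s\<bar> \<le> M"
  shows "\<bar>integral {a..b} f\<bar> \<le> M * (b - a)"
proof -
  have "norm (integral {a..b} f) \<le> integral {a..b} (\<lambda>_. M)"
    by (rule integral_norm_bound_integral[OF f]) (use M in \<open>auto simp: integrable_const_ivl\<close>)
  then show ?thesis using ab by (simp add: mult.commute)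
qed

context curvature
begin

lemma k_mass_mono:
  assumes "0 \<le> a" "a \<le> s" "s \<le> t" "t \<le> b" "b \<le> P"
  shows "integral {s..t} k \<le> integral {a..b} k"
  using assms k_nonneg by (intro integral_subset_le integrable_on_subinterval[OF k_int]) auto

text \<open>With \<open>p = height w\<close> and \<open>q\<close> the tangential component one has \<open>p' = k q\<close>, \<open>q' = w - k p\<close>, so
  \<open>2 B w w\<close> is the integral of \<open>k (p\<^sup>2 - q\<^sup>2)\<close>; this is nonpositive by a Poincare inequality as soon as
  the support of \<open>w\<close> turns by at most 1.\<close>
lemma B_local:
  assumes w: "balanced w" and ab: "0 \<le> a" "a \<le> b" "b \<le> P"
    and w1: "\<And>s. s \<in> {0..P} \<Longrightarrow> \<bar>w s\<bar> \<le> 1" and w0: "\<And>s. s \<in> {0..P} \<Longrightarrow> s \<notin> {a<..<b} \<Longrightarrow> w s = 0"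
  defines "M \<equiv> integral {a..b} k"
  assumes M: "M \<le> 1"
  shows "B w w \<le> 0" "- B w w \<le> M * (b - a)\<^sup>2"
proof -
  have wa: "w absolutely_integrable_on {0..P}" and wP: "X w P = 0" "Y w P = 0" using w by (auto simp: balanced_def)
  define p where "p = height w"
  define q where "q s = X w s * cos (\<theta> s) + Y w s * sin (\<theta> s)" for s
  note wi = weighted_trig_abs_int(3,4)[OF wa order_refl]
  have out: "X w s = 0 \<and> Y w s = 0" if s: "s \<in> {0..P}" "s \<notin> {a<..<b}" for s
  proof (cases "s \<le> a")
    case True
    then show ?thesis
      unfolding X_def Y_def using s ab w0 by (auto intro!: integral_eq_zero_if)
  next
    case False
    \<comment> \<open>Beyond \<open>b\<close> the integral from 0 equals minus the tail integral,
      since \<open>w\<close> is balanced, and on the tail \<open>w\<close> vanishes.\<close>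
    have "integral {s..P} (\<lambda>t. w t * cos (\<theta> t)) = 0" "integral {s..P} (\<lambda>t. w t * sin (\<theta> t)) = 0"
      using s ab False w0 by (auto intro!: integral_eq_zero_if)
    then show ?thesis
      using integral_increment(1)[OF wi(1), of s P] integral_increment(1)[OF wi(2), of s P] wP s
      by (simp add: X_def Y_def)
  qed
  have out': "p s = 0" "q s = 0" if "s \<in> {0..P}" "s \<notin> {a<..<b}" for s
    using out[OF that] by (auto simp: p_def q_def height_def)
  have pab: "p a = 0" "q a = 0" "p b = 0" "q b = 0" using out' ab by auto
  have cp: "continuous_on {0..P} p" unfolding p_def by (rule XY_cont(3)[OF wa])
  have cq: "continuous_on {0..P} q" unfolding q_def by (intro continuous_intros XY_cont[OF wa] \<theta>_cont)
  have cp': "continuous_on {s..t} p" and cq': "continuous_on {s..t} q" if "a \<le> s" "t \<le> b" for s t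
    using that ab by (auto intro!: continuous_on_subset[OF cp] continuous_on_subset[OF cq])
  have ka: "k absolutely_integrable_on {s..t}" if "a \<le> s" "t \<le> b" for s t
    using that ab by (auto intro!: absolutely_integrable_subinterval[OF k_abs_int])
  have ki: "k integrable_on {s..t}" if "a \<le> s" "t \<le> b" for s t
    using ka[OF that] by (simp add: absolutely_integrable_on_def)
  have kmi: "(\<lambda>s. k s * f s) integrable_on {s..t}" "(\<lambda>s. k s * f s) absolutely_integrable_on {s..t}"
    if "continuous_on {s..t} f" "a \<le> s" "t \<le> b" for f s t
    using absolutely_integrable_continuous_mult[OF that(1) ka[OF that(2,3)]] by auto
  have pi_q: "((\<lambda>t. k t * q t) has_integral p s) {0..s}" "((\<lambda>t. w t - k t * p t) has_integral q s) {0..s}" if "s \<in> {0..P}" for s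
    using q_p_integrals[OF wa that] by (simp_all add: p_def q_def)
  have kqP: "(\<lambda>t. k t * q t) integrable_on {0..P}" and wkp: "(\<lambda>t. w t - k t * p t) integrable_on {0..P}"
    using pi_q[of P] P_pos by (auto simp: has_integral_iff)
  have p_ab: "p s = integral {a..s} (\<lambda>t. k t * q t)" and q_ab: "q s = integral {a..s} (\<lambda>t. w t - k t * p t)"
    if "s \<in> {a..b}" for s
    using integral_increment(1)[OF kqP, of a s] integral_increment(1)[OF wkp, of a s] pi_q[of a] pi_q[of s] pab that ab
    by (auto simp: has_integral_iff)
  define C where "C = integral {a..b} (\<lambda>t. k t * (q t)\<^sup>2)"
  have p2: "(p s)\<^sup>2 \<le> C" if s: "s \<in> {a..b}" for s
  proof -
    have as: "a \<le> s" "s \<le> b" using s by auto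
    have i: "(\<lambda>t. k t * (q t)\<^sup>2) integrable_on {a..s}" "(\<lambda>t. k t * q t) integrable_on {a..s}" "k integrable_on {a..s}"
      using as cq'[of a s] by (auto intro!: kmi ki continuous_intros)
    \<comment> \<open>Cauchy-Schwarz for the weight \<open>k\<close>: here \<open>p s\<close> is the
      integral of \<open>k q\<close>, and the total weight is at most 1, so expanding the square
      about \<open>p s\<close> bounds \<open>(p s)^2\<close>.\<close>
    have "0 \<le> integral {a..s} (\<lambda>t. k t * (q t - p s)\<^sup>2)"
      using as cq'[of a s] k_nonneg by (intro integral_nonneg kmi continuous_intros) auto
    also have "\<dots> = integral {a..s} (\<lambda>t. k t * (q t)\<^sup>2 - 2 * p s * (k t * q t) + (p s)\<^sup>2 * k t)"
      by (intro Henstock_Kurzweil_Integration.integral_cong) (simp add: power2_eq_square algebra_simps)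
    also have "\<dots> = integral {a..s} (\<lambda>t. k t * (q t)\<^sup>2) - 2 * p s * p s + (p s)\<^sup>2 * integral {a..s} k"
      using i by (simp add: Henstock_Kurzweil_Integration.integral_add Henstock_Kurzweil_Integration.integral_diff
          integrable_diff integrable_on_mult_right p_ab[OF s])
    also have "integral {a..s} k \<le> 1" using k_mass_mono[of a a s b] as ab M by (auto simp: M_def)
    then have "(p s)\<^sup>2 * integral {a..s} k \<le> (p s)\<^sup>2 * 1" by (intro mult_left_mono) auto
    finally have "(p s)\<^sup>2 \<le> integral {a..s} (\<lambda>t. k t * (q t)\<^sup>2)" by (simp add: power2_eq_square)
    also have "\<dots> \<le> C" unfolding C_def using as k_nonneg cq'[of a s] cq'[of a b]
      by (intro integral_subset_le kmi continuous_intros) auto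
    finally show ?thesis .
  qed
  have C0: "C \<ge> 0" unfolding C_def using k_nonneg cq'[of a b] by (intro integral_nonneg kmi continuous_intros) auto
  have kp2: "integral {a..b} (\<lambda>t. k t * (p t)\<^sup>2) \<le> C"
  proof -
    have "integral {a..b} (\<lambda>t. k t * (p t)\<^sup>2) \<le> integral {a..b} (\<lambda>t. k t * C)"
      using p2 k_nonneg cp'[of a b] by (intro integral_le kmi continuous_intros) (auto intro: mult_left_mono)
    also have "\<dots> = M * C" by (simp add: M_def)
    also have "\<dots> \<le> 1 * C" using M C0 by (intro mult_right_mono)
    finally show ?thesis by simp
  qed
  have pw: "(\<lambda>t. p t * w t) integrable_on {0..P}" unfolding p_def by (rule height_mult_int[OF wa wa])
  have pwab: "(\<lambda>t. p t * w t) integrable_on {a..b}" using integral_increment(2)[OF pw ab] .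
  have loc: "integral {0..P} (\<lambda>t. p t * w t) = integral {a..b} (\<lambda>t. p t * w t)"
    by (rule integral_localize[OF pw ab]) (use w0 in auto)
  \<comment> \<open>The derivative of \<open>p q\<close>. Both factors vanish at the ends of the
    support, which trades the integral of \<open>p w\<close> for that of
    \<open>k (p^2 - q^2)\<close>.\<close>
  have "((\<lambda>t. k t * q t * q t + p t * (w t - k t * p t)) has_integral p b * q b - p a * q a) {a..b}"
  proof (rule indefinite_integral_product_rule[OF ab(2)])
    show "(\<lambda>t. k t * q t) absolutely_integrable_on {a..b}" using cq'[of a b] by (intro kmi) auto
    have "w absolutely_integrable_on {a..b}" using absolutely_integrable_subinterval[OF wa] ab by blast
    then show "(\<lambda>t. w t - k t * p t) absolutely_integrable_on {a..b}"
      using cp'[of a b] by (intro set_integral_diff kmi) auto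
  qed (use p_ab q_ab pab in auto)
  then have "integral {a..b} (\<lambda>t. k t * (q t)\<^sup>2 + p t * w t - k t * (p t)\<^sup>2) = 0"
    using pab by (simp add: has_integral_iff power2_eq_square algebra_simps)
  moreover have "integral {a..b} (\<lambda>t. k t * (q t)\<^sup>2 + p t * w t - k t * (p t)\<^sup>2) = C + integral {a..b} (\<lambda>t. p t * w t) - integral {a..b} (\<lambda>t. k t * (p t)\<^sup>2)"
  proof -
    have "(\<lambda>t. k t * (q t)\<^sup>2) integrable_on {a..b}" "(\<lambda>t. k t * (p t)\<^sup>2) integrable_on {a..b}"
      using cp'[of a b] cq'[of a b] by (auto intro!: kmi continuous_intros)
    then show ?thesis
      using pwab by (simp add: Henstock_Kurzweil_Integration.integral_add Henstock_Kurzweil_Integration.integral_diff integrable_add C_def)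
  qed
  ultimately have "2 * B w w = integral {a..b} (\<lambda>t. k t * (p t)\<^sup>2) - C"
    using loc by (simp add: B_def p_def)
  then show "B w w \<le> 0" using kp2 by simp
  have XYb: "\<bar>X w s\<bar> \<le> b - a" "\<bar>Y w s\<bar> \<le> b - a" if s: "s \<in> {a..b}" for s
  proof -
    have e: "X w s = integral {a..s} (\<lambda>t. w t * cos (\<theta> t))" "Y w s = integral {a..s} (\<lambda>t. w t * sin (\<theta> t))"
      using integral_increment(1)[OF wi(1), of a s] integral_increment(1)[OF wi(2), of a s] out[of a] s ab
      by (auto simp: X_def Y_def)
    have "\<bar>w t * cos (\<theta> t)\<bar> \<le> 1" "\<bar>w t * sin (\<theta> t)\<bar> \<le> 1" if "t \<in> {a..s}" for t
      using w1[of t] that s ab mult_mono[of "\<bar>w t\<bar>" 1 "\<bar>cos (\<theta> t)\<bar>" 1] mult_mono[of "\<bar>w t\<bar>" 1 "\<bar>sin (\<theta> t)\<bar>" 1]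
      by (auto simp: abs_mult)
    then have "\<bar>integral {a..s} (\<lambda>t. w t * cos (\<theta> t))\<bar> \<le> 1 * (s - a)" "\<bar>integral {a..s} (\<lambda>t. w t * sin (\<theta> t))\<bar> \<le> 1 * (s - a)"
      using integral_increment(2)[OF wi(1), of a s] integral_increment(2)[OF wi(2), of a s] s ab
      by (auto intro!: abs_integral_le_const[where M = 1, simplified])
    then show "\<bar>X w s\<bar> \<le> b - a" "\<bar>Y w s\<bar> \<le> b - a" using e s by auto
  qed
  have qb: "\<bar>q s\<bar> \<le> 2 * (b - a)" if s: "s \<in> {a..b}" for s
  proof -
    have "\<bar>X w s * cos (\<theta> s)\<bar> \<le> (b - a) * 1" "\<bar>Y w s * sin (\<theta> s)\<bar> \<le> (b - a) * 1"
      unfolding abs_mult by (rule mult_mono; use XYb[OF s] ab in simp)+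
    then show ?thesis unfolding q_def by linarith
  qed
  \<comment> \<open>The normal component is smaller than the tangential one by the factor
    \<open>M\<close>, because \<open>p' = k q\<close>. This extra factor is what makes
    \<open>B w w\<close> of first order in the turning.\<close>
  have pb: "\<bar>p s\<bar> \<le> 2 * (b - a) * M" if s: "s \<in> {a..b}" for s
  proof -
    have "\<bar>p s\<bar> \<le> 2 * (b - a) * integral {a..s} (\<lambda>t. \<bar>k t\<bar>)"
      unfolding p_ab[OF s] using s qb by (intro abs_integral_mult_le ka cq') auto
    also have "integral {a..s} (\<lambda>t. \<bar>k t\<bar>) = integral {a..s} k" using k_nonneg by simp
    also have "2 * (b - a) * integral {a..s} k \<le> 2 * (b - a) * M"
      using k_mass_mono[of a a s b] s ab by (intro mult_left_mono) (auto simp: M_def)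
    finally show ?thesis .
  qed
  have "\<bar>integral {a..b} (\<lambda>t. p t * w t)\<bar> \<le> 2 * (b - a) * M * (b - a)"
  proof (rule abs_integral_le_const[OF pwab ab(2)])
    fix s assume s: "s \<in> {a..b}"
    have "\<bar>p s\<bar> * \<bar>w s\<bar> \<le> 2 * (b - a) * M * 1"
      using pb[OF s] w1[of s] s ab by (intro mult_mono) auto
    then show "\<bar>p s * w s\<bar> \<le> 2 * (b - a) * M" by (simp add: abs_mult)
  qed
  then show "- B w w \<le> M * (b - a)\<^sup>2"
    using loc by (simp add: B_def p_def power2_eq_square algebra_simps)
qed

text \<open>Start at the last parameter where the angle still has its initial value: immediately
  afterwards it grows strictly, and by continuity by less than 1 on a short interval.\<close>

lemma ex_short_turning_interval:
  assumes "\<eta> > 0"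
  obtains a b where "0 \<le> a" "a < b" "b \<le> P" "b - a \<le> \<eta>" "0 < integral {a..b} k" "integral {a..b} k \<le> 1"
proof -
  define S where "S = {s \<in> {0..P}. \<theta> s = \<theta>0}"
  have "closed S" unfolding S_def
    using continuous_closed_preimage_constant[OF \<theta>_cont] by simp
  then have "compact S"
    by (metis (no_types, lifting) S_def bounded_closed_interval bounded_subset compact_eq_bounded_closed mem_Collect_eq subsetI)
  moreover have "0 \<in> S" using P_pos by (simp add: S_def \<theta>_0)
  ultimately obtain a where a: "a \<in> S" "\<forall>s\<in>S. s \<le> a"
    using compact_attains_sup[of S] by blast
  have a0: "0 \<le> a" "a \<le> P" "\<theta> a = \<theta>0" using a(1) by (auto simp: S_def)
  then have aP: "a < P" using \<theta>_P by (cases "a = P") auto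
  obtain d where d: "d > 0" "\<And>s. s \<in> {0..P} \<Longrightarrow> \<bar>s - a\<bar> < d \<Longrightarrow> \<bar>\<theta> s - \<theta> a\<bar> < 1"
    using \<theta>_cont a0 unfolding continuous_on_iff dist_real_def by (metis atLeastAtMost_iff zero_less_one)
  define b where "b = min P (a + min \<eta> (d / 2))"
  have b: "a < b" "b \<le> P" "b - a \<le> \<eta>" "b - a < d" using aP assms d(1) by (auto simp: b_def)
  have eq: "integral {a..b} k = \<theta> b - \<theta> a"
    using integral_increment(1)[OF k_int a0(1) less_imp_le[OF b(1)] b(2)] by (simp add: \<theta>_eq)
  have "integral {a..b} k \<ge> 0"
    using integral_increment(2)[OF k_int a0(1) less_imp_le[OF b(1)] b(2)] k_nonneg by (intro integral_nonneg) auto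
  moreover have "\<theta> b \<noteq> \<theta> a" using bspec[OF a(2), of b] b a0 by (auto simp: S_def)
  moreover have "\<theta> b - \<theta> a < 1" using d(2)[of b] b a0 by auto
  ultimately show thesis using that[of a b] a0 b eq by auto
qed

end

section \<open>Increasing the energy at fixed isoperimetric ratio\<close>

lemma has_integral_open_real_iff:
  fixes f :: "real \<Rightarrow> real"
  shows "(f has_integral y) {a<..<b} \<longleftrightarrow> (f has_integral y) {a..b}"
  using has_integral_open_interval[of f y a b] by (simp add: box_real)

lemma has_integral_indicator_mult:
  fixes g :: "real \<Rightarrow> real"
  assumes "continuous_on {0..P} g" "0 \<le> a" "b \<le> P"
  shows "((\<lambda>s. indicator {a<..<b} s * g s) has_integral integral {a..b} g) {0..P}"
proof -
  have "(g has_integral integral {a..b} g) {a..b}"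
    using assms by (intro integrable_integral integrable_continuous_real continuous_on_subset[OF assms(1)]) auto
  then have "(g has_integral integral {a..b} g) {a<..<b}"
    unfolding has_integral_open_real_iff .
  then have "((\<lambda>s. if s \<in> {a<..<b} then g s else 0) has_integral integral {a..b} g) {0..P}"
    using has_integral_restrict[of "{a<..<b}" "{0..P}" g] assms by (auto simp: subset_iff)
  moreover have "(\<lambda>s. if s \<in> {a<..<b} then g s else 0) = (\<lambda>s. indicator {a<..<b} s * g s)"
    by (auto simp: indicator_def)
  ultimately show ?thesis by simp
qed

context curvature
begin

text \<open>Five adjacent arcs of equal turning \<open>\<epsilon>\<close> leave room for the four linear conditions
  (closure, length, and first variation of the area).\<close>
lemma ex_local_perturbation:
  assumes \<eta>: "\<eta> > 0"
  obtains w \<epsilon> a b where "w \<in> borel_measurable borel" "\<And>s. \<bar>w s\<bar> \<le> 1" "balanced w"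
    "integral {0..P} w = 0" "B (\<lambda>_. 1) w = 0" "0 < \<epsilon>" "0 \<le> a" "a < b" "b \<le> P"
    "\<And>s. s \<in> {a<..<b} \<Longrightarrow> w s = 1" "integral {a..b} k = \<epsilon>"
    "B w w \<le> 0" "- B w w \<le> 5 * \<epsilon> * \<eta>\<^sup>2"
proof -
  obtain a b where ab: "0 \<le> a" "a < b" "b \<le> P" "b - a \<le> \<eta>" and M: "0 < integral {a..b} k" "integral {a..b} k \<le> 1"
    using ex_short_turning_interval[OF \<eta>] by blast
  define \<epsilon> where "\<epsilon> = integral {a..b} k / 5"
  have \<epsilon>: "\<epsilon> > 0" using M by (simp add: \<epsilon>_def)
  have inc: "\<theta> t - \<theta> s = integral {s..t} k" if "0 \<le> s" "s \<le> t" "t \<le> P" for s t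
    using integral_increment(1)[OF k_int that] by (simp add: \<theta>_eq)
  have \<theta>b: "\<theta> b = \<theta> a + 5 * \<epsilon>" using inc[of a b] ab by (simp add: \<epsilon>_def)
  have "\<exists>x. a \<le> x \<and> x \<le> b \<and> \<theta> x = \<theta> a + real i * \<epsilon>" if "i \<le> 5" for i
  proof (rule IVT')
    show "\<theta> a + real i * \<epsilon> \<le> \<theta> b" using \<theta>b \<epsilon> that by simp
    show "continuous_on {a..b} \<theta>" using ab by (intro continuous_on_subset[OF \<theta>_cont]) auto
  qed (use \<epsilon> ab in auto)
  then obtain t where t: "\<And>i. i \<le> 5 \<Longrightarrow> a \<le> t i \<and> t i \<le> b \<and> \<theta> (t i) = \<theta> a + real i * \<epsilon>"
    by metis
  have t_mono: "t i < t j" if "i < j" "j \<le> 5" for i j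
  proof (rule ccontr)
    assume "\<not> t i < t j"
    then have "\<theta> (t i) - \<theta> (t j) \<ge> 0"
      using inc[of "t j" "t i"] t[of i] t[of j] that ab k_nonneg
      by (auto intro!: integral_nonneg integrable_on_subinterval[OF k_int])
    then show False using t[of i] t[of j] that \<epsilon> by simp
  qed
  define J where "J i = {t i<..<t (Suc i)}" for i
  \<comment> \<open>The test functions of the four conditions: length, the two components of
    closure, and \<open>height\<close> of the constant 1, against which \<open>w\<close> integrates
    to twice the first variation \<open>B 1 w\<close> of the area.\<close>
  define g where "g j = (if j = 0 then (\<lambda>_. 1) else if j = 1 then (\<lambda>s. cos (\<theta> s)) else if j = 2 then (\<lambda>s. sin (\<theta> s))
      else height (\<lambda>_. 1))" for j :: nat
  have g_cont: "continuous_on {0..P} (g j)" for j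
    unfolding g_def using trig_cont XY_cont(3)[OF const_abs_int] by auto
  obtain c i0 where c: "i0 \<in> {..<5::nat}" "c i0 = 1" "\<And>i. i \<in> {..<5} \<Longrightarrow> \<bar>c i\<bar> \<le> 1"
    "\<And>j. j < 4 \<Longrightarrow> (\<Sum>i<5. c i * integral {t i..t (Suc i)} (g j)) = 0"
    by (rule homogeneous_system_normalized_solution[of "{..<5::nat}" 4 "\<lambda>i j. integral {t i..t (Suc i)} (g j)"])
      (simp, simp, use that in blast)
  define w where "w s = (\<Sum>i<5. c i * indicator (J i) s)" for s :: real
  have w_on: "w s = c i" if "i < 5" "s \<in> J i" for s i
  proof -
    have "s \<notin> J l" if l: "l < 5" "l \<noteq> i" for l
    proof
      assume s: "s \<in> J l"
      consider "Suc l \<le> i" | "Suc i \<le> l" using l(2) by (meson Suc_leI linorder_neqE_nat)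
      then show False
      proof cases
        case 1
        then have "t (Suc l) \<le> t i" using t_mono[of "Suc l" i] \<open>i < 5\<close> by (cases "Suc l = i") auto
        then show False using s \<open>s \<in> J i\<close> by (auto simp: J_def)
      next
        case 2
        then have "t (Suc i) \<le> t l" using t_mono[of "Suc i" l] \<open>l < 5\<close> by (cases "Suc i = l") auto
        then show False using s \<open>s \<in> J i\<close> by (auto simp: J_def)
      qed
    qed
    then have "w s = (\<Sum>l<5. if l = i then c i else 0)"
      unfolding w_def using that by (intro sum.cong) auto
    then show ?thesis using that by simp
  qed
  have w_off: "w s = 0" if "\<And>i. i < 5 \<Longrightarrow> s \<notin> J i" for s
    unfolding w_def using that by (intro sum.neutral) auto
  have w1: "\<bar>w s\<bar> \<le> 1" for s
    using w_on w_off c(3) by (cases "\<exists>i<5. s \<in> J i") auto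
  have w_supp: "w s = 0" if "s \<notin> {a<..<b}" for s
  proof (rule w_off)
    fix i :: nat assume "i < 5"
    then show "s \<notin> J i" using t[of i] t[of "Suc i"] that by (auto simp: J_def)
  qed
  have wm [measurable]: "w \<in> borel_measurable borel" unfolding w_def J_def by measurable
  have wa: "w absolutely_integrable_on {0..P}"
    by (rule measurable_bounded_by_integrable_imp_absolutely_integrable[where g = "\<lambda>_. 1"])
      (use w1 borel_measurable_lebesgue_onI[OF wm] in \<open>auto simp: integrable_const_ivl\<close>)
  have gw: "integral {0..P} (\<lambda>s. w s * g j s) = 0" if "j < 4" for j
  proof -
    have "((\<lambda>s. \<Sum>i<5. c i * (indicator (J i) s * g j s)) has_integral (\<Sum>i<5. c i * integral {t i..t (Suc i)} (g j))) {0..P}"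
    proof (rule has_integral_sum)
      fix i assume "i \<in> {..<5::nat}"
      then show "((\<lambda>s. c i * (indicator (J i) s * g j s)) has_integral c i * integral {t i..t (Suc i)} (g j)) {0..P}"
        unfolding J_def using t[of i] t[of "Suc i"] ab
        by (intro has_integral_mult_right has_integral_indicator_mult g_cont) auto
    qed simp
    moreover have "(\<lambda>s. \<Sum>i<5. c i * (indicator (J i) s * g j s)) = (\<lambda>s. w s * g j s)"
      unfolding w_def sum_distrib_right mult.assoc ..
    ultimately show ?thesis using c(4)[OF that] by (simp add: integral_unique)
  qed
  have bal: "balanced w"
    using gw[of 1] gw[of 2] wa by (simp add: balanced_def X_def Y_def g_def)
  have int0: "integral {0..P} w = 0" using gw[of 0] by (simp add: g_def)
  have B0: "B (\<lambda>_. 1) w = 0" using gw[of 3] by (simp add: g_def B_def mult.commute)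
  have loc: "B w w \<le> 0" "- B w w \<le> integral {a..b} k * (b - a)\<^sup>2"
    using B_local[OF bal, of a b] ab M(2) w1 w_supp by auto
  \<comment> \<open>The factor 5 arises because \<open>B_local\<close> sees the turning of all five
    arcs, while \<open>\<epsilon>\<close> is that of one. The interval handed out below is only the
    arc on which \<open>w = 1\<close>.\<close>
  have "integral {a..b} k * (b - a)\<^sup>2 \<le> 5 * \<epsilon> * \<eta>\<^sup>2"
    unfolding \<epsilon>_def using ab M by (auto intro!: mult_left_mono power_mono)
  moreover have i0: "i0 < 5" using c(1) by simp
  moreover have "integral {t i0..t (Suc i0)} k = \<epsilon>"
    using inc[of "t i0" "t (Suc i0)"] t[of i0] t[of "Suc i0"] t_mono[of i0 "Suc i0"] i0 ab by (auto simp: algebra_simps)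
  moreover have "w s = 1" if "s \<in> {t i0<..<t (Suc i0)}" for s
    using w_on[OF i0, of s] c(2) that by (simp add: J_def)
  ultimately show thesis
    using wm w1 bal int0 B0 \<epsilon> loc t[of i0] t[of "Suc i0"] t_mono[of i0 "Suc i0"] ab
    by (intro that[of w \<epsilon> "t i0" "t (Suc i0)"]) auto
qed

text \<open>Cauchy-Schwarz on the subarc, in the linear form
  \<open>k^2 / V \<ge> 2 l k - l^2 V\<close> with \<open>l = \<epsilon> / S\<close>, where
  \<open>S\<close> bounds the length that the subarc receives.\<close>

lemma energy_ge_local:
  assumes f: "f \<in> borel_measurable borel" "c > 0" "\<And>s. c \<le> f s" and r: "r \<ge> 0"
    and ab: "0 \<le> a" "a < b" "b \<le> P" and fc: "\<And>s. s \<in> {a<..<b} \<Longrightarrow> f s = d"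
    and S: "d * (b - a) + r * integral {a..b} k \<le> S" "S > 0"
  shows "(integral {a..b} k)\<^sup>2 / S \<le> integral {0..P} (\<lambda>s. (k s)\<^sup>2 / (f s + r * k s))"
proof -
  define \<epsilon> where "\<epsilon> = integral {a..b} k"
  define l where "l = \<epsilon> / S"
  let ?h = "\<lambda>s. (k s)\<^sup>2 / (f s + r * k s)"
  have hi: "?h integrable_on {0..P}" by (rule k2_div_int[OF f r])
  have pos: "f s + r * k s > 0" for s using f(2) f(3)[of s] r k_nonneg[of s] by (smt (verit) mult_nonneg_nonneg)
  have kab: "k integrable_on {a..b}" using integral_increment(2)[OF k_int, of a b] ab by auto
  have dc: "d \<ge> 0" using fc[of "(a + b) / 2"] f(2) f(3)[of "(a + b) / 2"] ab by auto
  have I: "((\<lambda>s. 2 * l * k s - l\<^sup>2 * (d + r * k s)) has_integral 2 * l * \<epsilon> - l\<^sup>2 * (d * (b - a) + r * \<epsilon>)) {a..b}"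
    unfolding \<epsilon>_def using ab kab has_integral_const_real[of d a b]
    by (intro has_integral_diff has_integral_mult_right has_integral_add integrable_integral) (auto simp: mult.commute)
  have I': "((\<lambda>s. 2 * l * k s - l\<^sup>2 * (d + r * k s)) has_integral 2 * l * \<epsilon> - l\<^sup>2 * (d * (b - a) + r * \<epsilon>)) {a<..<b}"
    using I unfolding has_integral_open_real_iff .
  have hab: "(?h has_integral integral {a..b} ?h) {a<..<b}"
    using integrable_integral[OF integral_increment(2)[OF hi, of a b]] ab unfolding has_integral_open_real_iff by simp
  have "2 * l * \<epsilon> - l\<^sup>2 * (d * (b - a) + r * \<epsilon>) \<le> integral {a..b} ?h"
  proof (rule has_integral_le[OF I' hab])
    fix s assume s: "s \<in> {a<..<b}"
    define V where "V = f s + r * k s"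
    have V: "V > 0" "V = d + r * k s" using pos[of s] fc[OF s] by (auto simp: V_def)
    have "0 \<le> (k s - l * V)\<^sup>2 / V" using V by simp
    also have "\<dots> = (k s)\<^sup>2 / V - (2 * l * k s - l\<^sup>2 * V)" using V(1) by (simp add: power2_eq_square field_simps)
    finally show "2 * l * k s - l\<^sup>2 * (d + r * k s) \<le> (k s)\<^sup>2 / (f s + r * k s)" using V by (simp add: V_def)
  qed
  also have "integral {a..b} ?h \<le> integral {0..P} ?h"
    using ab pos integral_increment(2)[OF hi, of a b]
    by (intro integral_subset_le hi) (auto intro!: divide_nonneg_pos)
  finally have "2 * l * \<epsilon> - l\<^sup>2 * (d * (b - a) + r * \<epsilon>) \<le> integral {0..P} ?h" .
  moreover have "l\<^sup>2 * (d * (b - a) + r * \<epsilon>) \<le> l\<^sup>2 * S" using S by (intro mult_left_mono) (auto simp: \<epsilon>_def)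
  moreover have "2 * l * \<epsilon> - l\<^sup>2 * S = \<epsilon>\<^sup>2 / S" using S(2) by (simp add: l_def power2_eq_square field_simps)
  ultimately show ?thesis by (simp add: \<epsilon>_def)
qed

text \<open>Dominated convergence: as long as \<open>\<sigma> \<le> u < 1\<close>, the density is at
  least \<open>1 - u\<close>, and \<open>k^2 / (1 - u)\<close> dominates.\<close>

lemma energy_continuous:
  assumes w: "w \<in> borel_measurable borel" "\<And>s. \<bar>w s\<bar> \<le> 1" and u: "u < 1"
    and r: "continuous_on {0..u} r" "\<And>\<sigma>. \<sigma> \<in> {0..u} \<Longrightarrow> r \<sigma> \<ge> 0"
  shows "continuous_on {0..u} (\<lambda>\<sigma>. integral {0..P} (\<lambda>s. (k s)\<^sup>2 / (1 - \<sigma> * w s + r \<sigma> * k s)))"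
proof -
  have ge: "1 - u \<le> 1 - \<sigma> * w s" if "\<sigma> \<in> {0..u}" for \<sigma> s
  proof -
    have "\<sigma> * w s \<le> \<sigma> * 1" using w(2)[of s] that by (intro mult_left_mono) auto
    then show ?thesis using that by simp
  qed
  have ge': "1 - u \<le> 1 - \<sigma> * w s + r \<sigma> * k s" if "\<sigma> \<in> {0..u}" for \<sigma> s
    using ge[OF that, of s] mult_nonneg_nonneg[OF r(2)[OF that] k_nonneg[of s]] by linarith
  have int: "(\<lambda>s. (k s)\<^sup>2 / (1 - \<sigma> * w s + r \<sigma> * k s)) integrable_on {0..P}" if "\<sigma> \<in> {0..u}" for \<sigma>
    using ge[OF that] r(2)[OF that] u w(1) by (intro k2_div_int[of _ "1 - u"]) auto
  show ?thesis
    unfolding continuous_on_sequentially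
  proof (intro allI ballI impI)
    fix \<sigma>s \<sigma> assume \<sigma>: "\<sigma> \<in> {0..u}" and "(\<forall>n. \<sigma>s n \<in> {0..u}) \<and> \<sigma>s \<longlonglongrightarrow> \<sigma>"
    then have \<sigma>s: "\<And>n. \<sigma>s n \<in> {0..u}" "\<sigma>s \<longlonglongrightarrow> \<sigma>" by auto
    have rl: "(\<lambda>n. r (\<sigma>s n)) \<longlonglongrightarrow> r \<sigma>"
      using r(1) \<sigma> \<sigma>s unfolding continuous_on_sequentially o_def by blast
    have "(\<lambda>n. integral {0..P} (\<lambda>s. (k s)\<^sup>2 / (1 - \<sigma>s n * w s + r (\<sigma>s n) * k s)))
        \<longlonglongrightarrow> integral {0..P} (\<lambda>s. (k s)\<^sup>2 / (1 - \<sigma> * w s + r \<sigma> * k s))"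
    proof (rule dominated_convergence(2)[where h = "\<lambda>s. (k s)\<^sup>2 / (1 - u)"])
      show "(\<lambda>s. (k s)\<^sup>2 / (1 - u)) integrable_on {0..P}" by (rule integrable_on_divide[OF k2_int])
      show "norm ((k s)\<^sup>2 / (1 - \<sigma>s n * w s + r (\<sigma>s n) * k s)) \<le> (k s)\<^sup>2 / (1 - u)" for n s
        using ge'[OF \<sigma>s(1)[of n], of s] u by (auto intro!: divide_left_mono)
      show "(\<lambda>n. (k s)\<^sup>2 / (1 - \<sigma>s n * w s + r (\<sigma>s n) * k s)) \<longlonglongrightarrow> (k s)\<^sup>2 / (1 - \<sigma> * w s + r \<sigma> * k s)" for s
        using ge'[OF \<sigma>, of s] u by (intro tendsto_intros \<sigma>s rl) auto
    qed (use int \<sigma>s in auto)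
    then show "((\<lambda>\<sigma>. integral {0..P} (\<lambda>s. (k s)\<^sup>2 / (1 - \<sigma> * w s + r \<sigma> * k s))) \<circ> \<sigma>s)
        \<longlonglongrightarrow> integral {0..P} (\<lambda>s. (k s)\<^sup>2 / (1 - \<sigma> * w s + r \<sigma> * k s))" by (simp add: o_def)
  qed
qed

text \<open>Since \<open>w\<close> is orthogonal to 1 for \<open>B\<close> and does not change the
  length, the area changes by \<open>\<sigma>^2 B w w\<close> alone. The relation \<open>rel\<close>
  then says that deficit over squared perimeter returns to its old value.\<close>

lemma E_set_perturbation:
  assumes w: "w \<in> borel_measurable borel" "\<And>s. \<bar>w s\<bar> \<le> 1" "balanced w" "integral {0..P} w = 0" "B (\<lambda>_. 1) w = 0"
    and \<sigma>: "0 \<le> \<sigma>" "\<sigma> < 1" and r: "r \<ge> 0"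
    and rel: "(P + 2 * pi * r)\<^sup>2 * (P\<^sup>2 - 4 * pi * B (\<lambda>_. 1) (\<lambda>_. 1)) = P\<^sup>2 * (P\<^sup>2 - 4 * pi * B (\<lambda>_. 1) (\<lambda>_. 1) - 4 * pi * \<sigma>\<^sup>2 * B w w)"
  shows "(4 * pi * B (\<lambda>_. 1) (\<lambda>_. 1) / P\<^sup>2,
      (P + 2 * pi * r) * integral {0..P} (\<lambda>s. (k s)\<^sup>2 / (1 - \<sigma> * w s + r * k s)) / (4 * pi\<^sup>2)) \<in> E_set"
proof -
  let ?f = "\<lambda>s. 1 + (- \<sigma>) * w s" and ?D = "P\<^sup>2 - 4 * pi * B (\<lambda>_. 1) (\<lambda>_. 1)"
  have wa: "w absolutely_integrable_on {0..P}" and wP: "X w P = 0" "Y w P = 0" using w(3) by (auto simp: balanced_def)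
  have one: "X (\<lambda>_. 1) P = 0" "Y (\<lambda>_. 1) P = 0" using balanced_1 by (auto simp: balanced_def)
  have fa: "?f absolutely_integrable_on {0..P}"
    using wa const_abs_int by (intro set_integral_add set_integrable_mult_right) auto
  have bal: "balanced ?f"
    using fa XY_linear(1,2)[OF const_abs_int[of 1] wa order_refl, of "- \<sigma>"] wP one by (simp add: balanced_def)
  have "(\<lambda>s. (- \<sigma>) * w s) integrable_on {0..P}"
    using wa by (intro integrable_on_mult_right) (simp add: absolutely_integrable_on_def)
  from Henstock_Kurzweil_Integration.integral_add[OF integrable_const_ivl this]
  have int: "integral {0..P} ?f = P" using w(4) P_pos by simp
  have Bff: "B ?f ?f = B (\<lambda>_. 1) (\<lambda>_. 1) + \<sigma>\<^sup>2 * B w w"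
  proof -
    have "B ?f ?f = B (\<lambda>_. 1) ?f + (- \<sigma>) * B w ?f" by (rule B_add_left[OF const_abs_int wa fa])
    also have "B (\<lambda>_. 1) ?f = B (\<lambda>_. 1) (\<lambda>_. 1) + (- \<sigma>) * B (\<lambda>_. 1) w" by (rule B_add_right[OF const_abs_int wa const_abs_int])
    also have "B w ?f = B w (\<lambda>_. 1) + (- \<sigma>) * B w w" by (rule B_add_right[OF const_abs_int wa wa])
    also have "B w (\<lambda>_. 1) = B (\<lambda>_. 1) w" by (rule B_sym[OF w(3) const_abs_int])
    finally show ?thesis using w(5) by (simp add: power2_eq_square)
  qed
  have ge: "1 - \<sigma> \<le> ?f s" for s
    using mult_left_mono[of "w s" 1 \<sigma>] w(2)[of s] \<sigma> by simp
  have Pr: "P + 2 * pi * r > 0" using P_pos r by (simp add: add_pos_nonneg)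
  have fm: "?f \<in> borel_measurable borel" using w(1) by measurable
  have E: "(1 - (P\<^sup>2 - 4 * pi * B ?f ?f) / (P + 2 * pi * r)\<^sup>2,
    (P + 2 * pi * r) * integral {0..P} (\<lambda>s. (k s)\<^sup>2 / (?f s + r * k s)) / (4 * pi\<^sup>2)) \<in> E_set"
    using E_set_add_k[OF bal fm _ ge r] \<sigma>(2) unfolding int by simp
  have "(P\<^sup>2 - 4 * pi * B ?f ?f) / (P + 2 * pi * r)\<^sup>2 = ?D / P\<^sup>2"
    using rel Pr P_pos unfolding Bff by (simp add: field_simps)
  moreover have "?D / P\<^sup>2 = 1 - 4 * pi * B (\<lambda>_. 1) (\<lambda>_. 1) / P\<^sup>2" using P_pos by (simp add: diff_divide_distrib)
  ultimately show ?thesis using E by simp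
qed

end

lemma E_set_increase_y:
  assumes E: "(x, y1) \<in> E_set" and x: "x < 1" and y: "y1 \<le> y"
  shows "(x, y) \<in> E_set"
proof -
  obtain P k \<theta>0 where k: "closed_curvature P k \<theta>0"
    and x0: "x = 4 * pi * area_form P (tangent_angle \<theta>0 k) (\<lambda>_. 1) (\<lambda>_. 1) / P\<^sup>2"
    and y0: "y1 = elastic_energy P k * P / (2 * pi\<^sup>2)"
    using E unfolding E_set_iff by blast
  interpret curvature P k \<theta>0 by standard (rule k)
  have xB: "x = 4 * pi * B (\<lambda>_. 1) (\<lambda>_. 1) / P\<^sup>2" using x0 by (simp add: area_form_eq \<theta>_def[symmetric])
  define D where "D = P\<^sup>2 - 4 * pi * B (\<lambda>_. 1) (\<lambda>_. 1)"
  have D: "D > 0" using x xB P_pos by (simp add: D_def field_simps)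
  \<comment> \<open>Fixed by the final estimate: the energy coordinate at the end of the path is at
    least \<open>D / (40 pi^2 \<eta>^2)\<close>, which this choice turns into
    \<open>\<bar>y\<bar> + 1\<close>.\<close>
  define \<eta> where "\<eta> = sqrt (D / (40 * pi\<^sup>2 * (\<bar>y\<bar> + 1)))"
  have \<eta>: "\<eta> > 0" "\<eta>\<^sup>2 = D / (40 * pi\<^sup>2 * (\<bar>y\<bar> + 1))" using D by (auto simp: \<eta>_def)
  obtain w \<epsilon> a b where w: "w \<in> borel_measurable borel" "\<And>s. \<bar>w s\<bar> \<le> 1" "balanced w"
    "integral {0..P} w = 0" "B (\<lambda>_. 1) w = 0" and \<epsilon>: "0 < \<epsilon>" and ab: "0 \<le> a" "a < b" "b \<le> P"
    and wab: "\<And>s. s \<in> {a<..<b} \<Longrightarrow> w s = 1" and kab: "integral {a..b} k = \<epsilon>"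
    and Bw: "B w w \<le> 0" "- B w w \<le> 5 * \<epsilon> * \<eta>\<^sup>2"
    using ex_local_perturbation[OF \<eta>(1)] by blast
  \<comment> \<open>The deficit of the weight \<open>1 - \<sigma> w\<close> is
    \<open>D + \<sigma>^2 \<beta>\<close>.\<close>
  define \<beta> where "\<beta> = - 4 * pi * B w w"
  have \<beta>: "0 \<le> \<beta>" "\<beta> \<le> 20 * pi * \<epsilon> * \<eta>\<^sup>2"
  proof -
    show "0 \<le> \<beta>" using Bw(1) by (simp add: \<beta>_def mult_nonneg_nonpos)
    have "4 * pi * (- B w w) \<le> 4 * pi * (5 * \<epsilon> * \<eta>\<^sup>2)" using Bw(2) by (intro mult_left_mono) auto
    then show "\<beta> \<le> 20 * pi * \<epsilon> * \<eta>\<^sup>2" by (simp add: \<beta>_def)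
  qed
  \<comment> \<open>The solution of \<open>(P + 2 pi r)^2 D = P^2 (D + \<sigma>^2 \<beta>)\<close>,
    nonnegative because the deficit has not decreased.\<close>
  define r where "r \<sigma> = P * (sqrt (1 + \<sigma>\<^sup>2 * \<beta> / D) - 1) / (2 * pi)" for \<sigma>
  have r_eq: "P + 2 * pi * r \<sigma> = P * sqrt (1 + \<sigma>\<^sup>2 * \<beta> / D)" for \<sigma> using pi_gt_zero by (simp add: r_def field_simps)
  have r0: "r \<sigma> \<ge> 0" for \<sigma> using P_pos \<beta> D by (simp add: r_def)
  have mem: "(x, (P + 2 * pi * r \<sigma>) * integral {0..P} (\<lambda>s. (k s)\<^sup>2 / (1 - \<sigma> * w s + r \<sigma> * k s)) / (4 * pi\<^sup>2)) \<in> E_set"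
    if \<sigma>: "0 \<le> \<sigma>" "\<sigma> < 1" for \<sigma>
    unfolding xB
  proof (rule E_set_perturbation[OF w \<sigma> r0])
    have "1 + \<sigma>\<^sup>2 * \<beta> / D \<ge> 0" using \<beta> D by simp
    then show "(P + 2 * pi * r \<sigma>)\<^sup>2 * (P\<^sup>2 - 4 * pi * B (\<lambda>_. 1) (\<lambda>_. 1)) = P\<^sup>2 * (P\<^sup>2 - 4 * pi * B (\<lambda>_. 1) (\<lambda>_. 1) - 4 * pi * \<sigma>\<^sup>2 * B w w)"
      unfolding r_eq D_def[symmetric] using D by (simp add: power_mult_distrib \<beta>_def field_simps)
  qed
  \<comment> \<open>Chosen so that the two parts of the length left on the subarc,
    \<open>(1 - u) (b - a)\<close> and \<open>r u * \<epsilon>\<close>, are both at most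
    \<open>P * Q\<close>. The second bound is forced by \<open>\<beta>\<close>; \<open>u\<close> is
    then taken close enough to 1 for the first.\<close>
  define Q where "Q = 5 * \<epsilon>\<^sup>2 * \<eta>\<^sup>2 / D"
  have Q: "Q > 0" using \<epsilon> \<eta>(1) D by (simp add: Q_def)
  define u where "u = 1 - min 1 Q"
  have u: "0 \<le> u" "u < 1" "1 - u \<le> Q" using Q by (auto simp: u_def)
  let ?F = "\<lambda>\<sigma>. (P + 2 * pi * r \<sigma>) * integral {0..P} (\<lambda>s. (k s)\<^sup>2 / (1 - \<sigma> * w s + r \<sigma> * k s)) / (4 * pi\<^sup>2)"
  have r_cont: "continuous_on {0..u} r" unfolding r_def using D by (intro continuous_intros) auto
  have F_cont: "continuous_on {0..u} ?F"
    by (intro continuous_intros r_cont energy_continuous w(1,2) u(2) r0) auto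
  have F0: "?F 0 = y1"
    by (simp add: r_def y0 elastic_energy_def)
  have "?F u \<ge> \<bar>y\<bar> + 1"
  proof -
    \<comment> \<open>These lines prove the square root bound
      \<open>sqrt (1 + t) \<le> 1 + t / 2\<close>, which makes \<open>r u\<close> linear in
      \<open>\<beta>\<close>.\<close>
    have "u\<^sup>2 * \<beta> \<le> 1 * \<beta>" using u \<beta>(1) by (intro mult_right_mono) (auto simp: power_le_one)
    then have "u\<^sup>2 * \<beta> / D \<le> \<beta> / D" using D by (intro divide_right_mono) auto
    moreover have "(1 + \<beta> / D / 2)\<^sup>2 = 1 + \<beta> / D + (\<beta> / D / 2)\<^sup>2" by (simp only: power2_sum) simp
    moreover have "(\<beta> / D / 2)\<^sup>2 \<ge> 0" by simp
    ultimately have "1 + u\<^sup>2 * \<beta> / D \<le> (1 + \<beta> / D / 2)\<^sup>2" by linarith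
    then have "sqrt (1 + u\<^sup>2 * \<beta> / D) \<le> 1 + \<beta> / D / 2"
      using \<beta>(1) D by (intro real_le_lsqrt) auto
    then have "r u \<le> P * (\<beta> / D / 2) / (2 * pi)"
      unfolding r_def using P_pos by (intro divide_right_mono mult_left_mono) auto
    also have "\<dots> \<le> P * (20 * pi * \<epsilon> * \<eta>\<^sup>2 / D / 2) / (2 * pi)"
      using \<beta>(2) P_pos D by (intro divide_right_mono mult_left_mono) auto
    also have "\<dots> = 5 * P * \<epsilon> * \<eta>\<^sup>2 / D" using pi_gt_zero by (simp add: field_simps)
    finally have "r u * \<epsilon> \<le> 5 * P * \<epsilon> * \<eta>\<^sup>2 / D * \<epsilon>" using \<epsilon> by (intro mult_right_mono) auto
    then have "r u * \<epsilon> \<le> P * Q" by (simp add: Q_def power2_eq_square mult_ac)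
    moreover have "(1 - u) * (b - a) \<le> Q * P" using u ab by (intro mult_mono) auto
    ultimately have S: "(1 - u) * (b - a) + r u * integral {a..b} k \<le> 2 * (P * Q)"
      by (simp add: kab mult.commute)
    have w_le: "1 - u \<le> 1 - u * w s" for s using mult_left_mono[of "w s" 1 u] w(2)[of s] u by simp
    have "(integral {a..b} k)\<^sup>2 / (2 * (P * Q)) \<le> integral {0..P} (\<lambda>s. (k s)\<^sup>2 / (1 - u * w s + r u * k s))"
      by (rule energy_ge_local[of "\<lambda>s. 1 - u * w s" "1 - u" "r u" a b "1 - u"])
        (use w(1) u w_le r0 ab wab S P_pos Q in auto)
    then have "P * (\<epsilon>\<^sup>2 / (2 * (P * Q))) \<le> (P + 2 * pi * r u) * integral {0..P} (\<lambda>s. (k s)\<^sup>2 / (1 - u * w s + r u * k s))"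
      unfolding kab using P_pos r0 Q by (intro mult_mono) auto
    then have "P * (\<epsilon>\<^sup>2 / (2 * (P * Q))) / (4 * pi\<^sup>2) \<le> ?F u" by (intro divide_right_mono) auto
    moreover have "P * (\<epsilon>\<^sup>2 / (2 * (P * Q))) / (4 * pi\<^sup>2) = D / (40 * pi\<^sup>2 * \<eta>\<^sup>2)"
      using P_pos \<epsilon> \<eta>(1) D by (simp add: Q_def field_simps)
    moreover have "D / (40 * pi\<^sup>2 * \<eta>\<^sup>2) = \<bar>y\<bar> + 1"
    proof -
      have "40 * pi\<^sup>2 * (\<bar>y\<bar> + 1) > 0" by (simp add: add_nonneg_pos)
      then have "\<eta>\<^sup>2 * (40 * pi\<^sup>2 * (\<bar>y\<bar> + 1)) = D" using \<eta>(2) by (simp add: field_simps)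
      then show ?thesis using \<eta>(1) by (simp add: field_simps)
    qed
    ultimately show ?thesis by simp
  qed
  then have "y \<le> ?F u" by linarith
  moreover have "?F 0 \<le> y" using F0 y by (simp only:)
  ultimately obtain \<sigma> where \<sigma>: "0 \<le> \<sigma>" "\<sigma> \<le> u" "?F \<sigma> = y"
    using IVT'[of ?F 0 y u] u(1) F_cont by blast
  then have "\<sigma> < 1" using u(2) by linarith
  then show ?thesis using mem[OF \<sigma>(1)] unfolding \<sigma>(3) by blast
qed

section \<open>Isoperimetric inequality and the boundary of the set\<close>

text \<open>Supplies the limits of \<open>y / S\<close> at the end points in
  \<open>wirtinger\<close>, where both functions vanish.\<close>

lemma tendsto_quotient_at_common_zero:
  fixes y S :: "real \<Rightarrow> real"
  assumes "(y has_field_derivative D) (at z within A)" "(S has_field_derivative E) (at z within A)"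
    and "y z = 0" "S z = 0" "E \<noteq> 0"
  shows "((\<lambda>s. y s / S s) \<longlongrightarrow> D / E) (at z within A)"
proof -
  have "((\<lambda>s. ((y s - y z) / (s - z)) / ((S s - S z) / (s - z))) \<longlongrightarrow> D / E) (at z within A)"
    using assms unfolding has_field_derivative_iff by (intro tendsto_divide) auto
  moreover have "\<forall>\<^sub>F s in at z within A. ((y s - y z) / (s - z)) / ((S s - S z) / (s - z)) = y s / S s"
    using assms by (auto simp: eventually_at_filter)
  ultimately show ?thesis by (rule Lim_transform_eventually)
qed

text \<open>The identity \<open>y'\<^sup>2 - \<mu>\<^sup>2 y\<^sup>2 = (y' - \<mu> y cot)\<^sup>2 + (\<mu> y\<^sup>2 cot)'\<close>, with cot taken at \<open>\<mu> (s - a)\<close>;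
  since \<open>x / 0 = 0\<close> the boundary term vanishes at both end points.\<close>
lemma wirtinger:
  fixes y y' :: "real \<Rightarrow> real"
  assumes ab: "a < b" and der: "\<And>s. s \<in> {a..b} \<Longrightarrow> (y has_field_derivative y' s) (at s within {a..b})"
    and cont: "continuous_on {a..b} y'" and zero: "y a = 0" "y b = 0"
  defines "\<mu> \<equiv> pi / (b - a)"
  shows "integral {a..b} (\<lambda>s. (y' s)\<^sup>2 - \<mu>\<^sup>2 * (y s)\<^sup>2) \<ge> 0"
    and "integral {a..b} (\<lambda>s. (y' s)\<^sup>2 - \<mu>\<^sup>2 * (y s)\<^sup>2) = 0 \<Longrightarrow> s \<in> {a<..<b} \<Longrightarrow>
      y' s * sin (\<mu> * (s - a)) = \<mu> * y s * cos (\<mu> * (s - a))"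
proof -
  define S where "S s = sin (\<mu> * (s - a))" for s
  define C where "C s = cos (\<mu> * (s - a))" for s
  have \<mu>: "\<mu> > 0" "\<mu> * (b - a) = pi" using ab by (auto simp: \<mu>_def)
  have dS: "(S has_field_derivative \<mu> * C s) (at s within A)" for s A
    unfolding S_def C_def by (auto intro!: derivative_eq_intros)
  have dC: "(C has_field_derivative - (\<mu> * S s)) (at s within A)" for s A
    unfolding S_def C_def by (auto intro!: derivative_eq_intros)
  have Spos: "S s > 0" if "s \<in> {a<..<b}" for s
    unfolding S_def
  proof (rule sin_gt_zero)
    show "0 < \<mu> * (s - a)" using that \<mu> by simp
    have "\<mu> * (s - a) < \<mu> * (b - a)" using that \<mu>(1) by (intro mult_strict_left_mono) auto
    then show "\<mu> * (s - a) < pi" using \<mu>(2) by simp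
  qed
  have SC: "(S s)\<^sup>2 + (C s)\<^sup>2 = 1" for s by (simp add: S_def C_def)
  have Sab: "S a = 0" "S b = 0" "C a = 1" "C b = -1" using \<mu>(2) by (auto simp: S_def C_def)
  have cy: "continuous_on {a..b} y"
    using der by (rule DERIV_continuous_on)
  \<comment> \<open>The boundary term \<open>\<mu> y^2 cot\<close>, grouped as \<open>y\<close>
    times \<open>y / S\<close>: at the ends the quotient has a finite limit and the other factor
    tends to 0, so \<open>H\<close> is continuous there with value 0.\<close>
  define H where "H s = \<mu> * (y s * (y s / S s)) * C s" for s
  define g where "g s = (y' s - \<mu> * y s * C s / S s)\<^sup>2" for s
  define I where "I = integral {a..b} (\<lambda>s. (y' s)\<^sup>2 - \<mu>\<^sup>2 * (y s)\<^sup>2)"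
  have cH: "continuous_on {a..b} H"
    unfolding continuous_on_def
  proof
    fix z assume z: "z \<in> {a..b}"
    have ty: "(y \<longlongrightarrow> y z) (at z within {a..b})" using cy z by (auto simp: continuous_on_def)
    have tC: "(C \<longlongrightarrow> C z) (at z within {a..b})" unfolding C_def by (intro tendsto_intros)
    have tS: "(S \<longlongrightarrow> S z) (at z within {a..b})" unfolding S_def by (intro tendsto_intros)
    show "(H \<longlongrightarrow> H z) (at z within {a..b})"
    proof (cases "z = a \<or> z = b")
      case True
      then have "y z = 0" "S z = 0" "\<mu> * C z \<noteq> 0" using zero Sab \<mu> by auto
      then have "((\<lambda>s. y s / S s) \<longlongrightarrow> y' z / (\<mu> * C z)) (at z within {a..b})"
        by (intro tendsto_quotient_at_common_zero der[OF z] dS)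
      then have "(H \<longlongrightarrow> \<mu> * (y z * (y' z / (\<mu> * C z))) * C z) (at z within {a..b})"
        unfolding H_def by (intro tendsto_mult tendsto_const ty tC)
      then show ?thesis using \<open>y z = 0\<close> by (simp add: H_def)
    next
      case False
      then have "S z \<noteq> 0" using Spos[of z] z by force
      then show ?thesis unfolding H_def by (intro tendsto_intros ty tC tS)
    qed
  qed
  have g_eq: "(y' s)\<^sup>2 - \<mu>\<^sup>2 * (y s)\<^sup>2 - (2 * \<mu> * y s * y' s * C s / S s - \<mu>\<^sup>2 * (y s)\<^sup>2 / (S s)\<^sup>2) = g s" if "s \<in> {a<..<b}" for s
  proof -
    have "g s = (y' s)\<^sup>2 - 2 * \<mu> * y s * y' s * C s / S s + \<mu>\<^sup>2 * (y s)\<^sup>2 * (C s)\<^sup>2 / (S s)\<^sup>2"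
      unfolding g_def by (simp add: power2_diff power_divide power_mult_distrib algebra_simps)
    moreover have "\<mu>\<^sup>2 * (y s)\<^sup>2 * (C s)\<^sup>2 / (S s)\<^sup>2 = \<mu>\<^sup>2 * (y s)\<^sup>2 / (S s)\<^sup>2 - \<mu>\<^sup>2 * (y s)\<^sup>2"
    proof -
      have C2: "(C s)\<^sup>2 = 1 - (S s)\<^sup>2" using SC[of s] by simp
      show ?thesis unfolding C2 using Spos[OF that] by (simp add: field_simps)
    qed
    ultimately show ?thesis by simp
  qed
  have "((\<lambda>s. 2 * \<mu> * y s * y' s * C s / S s - \<mu>\<^sup>2 * (y s)\<^sup>2 / (S s)\<^sup>2) has_integral H b - H a) {a..b}"
  proof (rule fundamental_theorem_of_calculus_interior)
    fix s assume s: "s \<in> {a<..<b}"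
    have dy: "(y has_field_derivative y' s) (at s)"
      using der[of s] s at_within_interior[of s "{a..b}"] by auto
    have "(H has_field_derivative 2 * \<mu> * y s * y' s * C s / S s - \<mu>\<^sup>2 * (y s)\<^sup>2 * ((S s)\<^sup>2 + (C s)\<^sup>2) / (S s)\<^sup>2) (at s)"
      unfolding H_def using Spos[OF s]
      by (auto intro!: derivative_eq_intros dy dS dC simp: power2_eq_square field_simps)
    then show "(H has_vector_derivative 2 * \<mu> * y s * y' s * C s / S s - \<mu>\<^sup>2 * (y s)\<^sup>2 / (S s)\<^sup>2) (at s)"
      unfolding SC by (simp add: has_real_derivative_iff_has_vector_derivative)
  qed (use ab cH in auto)
  then have H': "((\<lambda>s. 2 * \<mu> * y s * y' s * C s / S s - \<mu>\<^sup>2 * (y s)\<^sup>2 / (S s)\<^sup>2) has_integral 0) {a..b}"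
    using zero by (simp add: H_def)
  have "((\<lambda>s. (y' s)\<^sup>2 - \<mu>\<^sup>2 * (y s)\<^sup>2) has_integral I) {a..b}"
    unfolding I_def by (intro integrable_integral integrable_continuous_real continuous_intros cont cy)
  from has_integral_diff[OF this H'] have "((\<lambda>s. (y' s)\<^sup>2 - \<mu>\<^sup>2 * (y s)\<^sup>2 - (2 * \<mu> * y s * y' s * C s / S s - \<mu>\<^sup>2 * (y s)\<^sup>2 / (S s)\<^sup>2)) has_integral I) {a<..<b}"
    unfolding has_integral_open_real_iff by simp
  then have gI: "(g has_integral I) {a<..<b}"
    by (rule has_integral_eq[rotated]) (rule g_eq)
  show "integral {a..b} (\<lambda>s. (y' s)\<^sup>2 - \<mu>\<^sup>2 * (y s)\<^sup>2) \<ge> 0"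
    using has_integral_nonneg[OF gI] by (simp add: I_def g_def)
  assume "integral {a..b} (\<lambda>s. (y' s)\<^sup>2 - \<mu>\<^sup>2 * (y s)\<^sup>2) = 0" and s: "s \<in> {a<..<b}"
  then have g0: "(g has_integral 0) {a<..<b}" using gI by (simp add: I_def)
  \<comment> \<open>On a compact interval around \<open>s\<close> inside the open one the sine has
    no zero, so \<open>g\<close> is continuous there and a vanishing integral forces
    \<open>g s = 0\<close>.\<close>
  define c where "c = (a + s) / 2"
  define d where "d = (s + b) / 2"
  have cd: "a < c" "c < s" "s < d" "d < b" using s by (auto simp: c_def d_def)
  have cg: "continuous_on {c..d} g"
  proof -
    have "continuous_on {c..d} S" "continuous_on {c..d} C" unfolding S_def C_def by (intro continuous_intros)+
    moreover have "continuous_on {c..d} y" "continuous_on {c..d} y'"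
      using cd by (auto intro: continuous_on_subset[OF cy] continuous_on_subset[OF cont])
    moreover have "S t \<noteq> 0" if "t \<in> {c..d}" for t using Spos[of t] cd that by simp
    ultimately show ?thesis unfolding g_def by (intro continuous_intros) auto
  qed
  have "integral {c..d} g \<le> integral {a<..<b} g"
    using cd g0 by (intro integral_subset_le integrable_continuous_real cg) (auto simp: g_def)
  also have "\<dots> = 0" using g0 by (rule integral_unique)
  finally have "integral {c..d} g = 0"
    using integral_nonneg[OF integrable_continuous_real[OF cg]] by (simp add: g_def)
  then have "g s = 0"
    using integral_eq_0_iff[OF cg] cd by (force simp: g_def)
  then have "y' s = \<mu> * y s * C s / S s" by (simp add: g_def)
  then show "y' s * sin (\<mu> * (s - a)) = \<mu> * y s * cos (\<mu> * (s - a))"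
    using Spos[OF s] by (simp add: S_def C_def)
qed

text \<open>Zeros of the cosine are isolated: otherwise \<open>g\<close> would take a value
  \<open>g a + d\<close> with \<open>0 < \<bar>d\<bar> \<le> 1\<close>, where the cosine is
  \<open>- sin (g a) * sin d\<close> and does not vanish.\<close>

lemma cos_zero_imp_constant:
  fixes g :: "real \<Rightarrow> real"
  assumes cont: "continuous_on {a..b} g" and z: "\<And>s. s \<in> {a..b} \<Longrightarrow> cos (g s) = 0" and s: "s \<in> {a..b}"
  shows "g s = g a"
proof (rule ccontr)
  assume ne: "g s \<noteq> g a"
  define d where "d = (if g a < g s then min 1 (g s - g a) else max (-1) (g s - g a))"
  have d: "d \<noteq> 0" "\<bar>d\<bar> \<le> 1" using ne by (auto simp: d_def)
  have c': "continuous_on {a..s} g" using s by (auto intro: continuous_on_subset[OF cont])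
  obtain t where t: "a \<le> t" "t \<le> s" "g t = g a + d"
  proof (cases "g a < g s")
    case True
    then have "g a \<le> g a + d" "g a + d \<le> g s" by (auto simp: d_def min_def)
    then show ?thesis using IVT'[of g a "g a + d" s] that s c' by auto
  next
    case False
    then have "g a + d \<le> g a" "g s \<le> g a + d" using ne by (auto simp: d_def max_def)
    then show ?thesis using IVT2'[of g s "g a + d" a] that s c' by auto
  qed
  have "0 = cos (g a + d)" using z[of t] t s by auto
  also have "\<dots> = - sin (g a) * sin d" using z[of a] s by (simp add: cos_add)
  finally have "sin (g a) = 0 \<or> sin d = 0" by simp
  moreover have "sin (g a) \<noteq> 0" using z[of a] s sin_cos_squared_add[of "g a"] by auto
  moreover have "sin d \<noteq> 0"
    using sin_gt_zero[of d] sin_gt_zero[of "- d"] d pi_gt3 by (cases "d > 0") auto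
  ultimately show False by blast
qed

context curvature
begin

text \<open>Integrate \<open>(k - m)^2 \<ge> 0\<close> with \<open>m\<close> the mean curvature
  \<open>2 pi / P\<close>.\<close>

lemma energy_ge: "4 * pi\<^sup>2 \<le> P * integral {0..P} (\<lambda>s. (k s)\<^sup>2)"
proof -
  define m where "m = 2 * pi / P"
  have i: "(\<lambda>s. (k s)\<^sup>2 - 2 * m * k s + m\<^sup>2) integrable_on {0..P}"
    by (intro integrable_add integrable_diff k2_int integrable_on_mult_right k_int) (simp add: integrable_const_ivl)
  have "0 \<le> integral {0..P} (\<lambda>s. (k s)\<^sup>2 - 2 * m * k s + m\<^sup>2)"
  proof (rule integral_nonneg[OF i])
    fix s show "0 \<le> (k s)\<^sup>2 - 2 * m * k s + m\<^sup>2"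
      using zero_le_power2[of "k s - m"] by (simp add: power2_diff mult_ac)
  qed
  also have "\<dots> = integral {0..P} (\<lambda>s. (k s)\<^sup>2) - 2 * m * (2 * pi) + P * m\<^sup>2"
    using k2_int k_int k_total P_pos
    by (simp add: Henstock_Kurzweil_Integration.integral_add Henstock_Kurzweil_Integration.integral_diff
        integrable_diff integrable_on_mult_right integrable_const_ivl)
  finally have "0 \<le> P * (integral {0..P} (\<lambda>s. (k s)\<^sup>2) - 2 * m * (2 * pi) + P * m\<^sup>2)" using P_pos by simp
  also have "\<dots> = P * integral {0..P} (\<lambda>s. (k s)\<^sup>2) - 4 * pi\<^sup>2"
    using P_pos by (simp add: m_def power2_eq_square field_simps)
  finally show ?thesis by simp
qed

text \<open>Substituting along \<open>s + \<theta>(s)\<close>, which is affine here, avoids showing that \<open>k\<close> is constant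
  almost everywhere.\<close>
lemma energy_if_affine:
  assumes aff: "\<And>s. s \<in> {0..P} \<Longrightarrow> integral {0..s} k = 2 * pi / P * s"
  shows "P * integral {0..P} (\<lambda>s. (k s)\<^sup>2) = 4 * pi\<^sup>2"
proof -
  define m where "m = 2 * pi / P"
  have m: "m > 0" "m * P = 2 * pi" using P_pos by (auto simp: m_def)
  have v: "(\<lambda>s. 1 + k s) \<in> borel_measurable borel" "1 > (0::real)" "\<And>s. 1 \<le> 1 + k s" "(\<lambda>s. 1 + k s) integrable_on {0..P}"
    using k_nonneg k_int by (auto intro!: integrable_add simp: integrable_const_ivl)
  obtain w G where "increasing_reparam w G (min 1 1)" and wv: "\<And>x. x \<in> {0..P} \<Longrightarrow> w x = 1 + k x" and G0: "G 0 = 0"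
    using ex_increasing_reparam[OF v P_pos] by blast
  then interpret R: increasing_reparam w G "min 1 1" by simp
  have G: "G s = (1 + m) * s" if "s \<in> {0..P}" for s
  proof -
    have "G s = integral {0..s} w" using R.G_diff[of 0 s] G0 that by simp
    also have "\<dots> = integral {0..s} (\<lambda>s. 1 + k s)" using wv that by (intro Henstock_Kurzweil_Integration.integral_cong) auto
    also have "\<dots> = s + integral {0..s} k" using that integrable_on_subinterval[OF k_int, of 0 s]
      by (subst Henstock_Kurzweil_Integration.integral_add) (auto simp: integrable_const_ivl)
    finally show ?thesis using aff[OF that] by (simp add: m_def algebra_simps)
  qed
  have hi: "(\<lambda>x. k x * w x) absolutely_integrable_on {0..P}"
  proof (rule absolutely_integrable_nonneg)
    have "(\<lambda>x. k x + (k x)\<^sup>2) integrable_on {0..P}" by (intro integrable_add k_int k2_int)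
    then show "(\<lambda>x. k x * w x) integrable_on {0..P}"
      by (rule integrable_eq) (simp add: wv power2_eq_square algebra_simps)
  qed (use k_nonneg R.v_nonneg in auto)
  have km: "(\<lambda>x. indicator {0..P} x * k x) \<in> borel_measurable borel" by measurable
  \<comment> \<open>The integral of \<open>k\<close> along the inverse of \<open>G\<close> is
    computed twice. Substitution gives the integral of \<open>k (1 + k)\<close>; since
    \<open>G\<close> is multiplication by \<open>1 + m\<close>, plain rescaling gives
    \<open>2 pi (1 + m)\<close>. Comparison yields the integral of \<open>k^2\<close>.\<close>
  have "((\<lambda>u. k (R.\<phi> u)) has_integral integral {0..P} (\<lambda>x. k x * w x)) {0..(1 + m) * P}"
    using R.has_integral_substitution_\<phi>[OF km hi] G[of P] P_pos G0 by simp
  moreover have "R.\<phi> u = u / (1 + m)" if "u \<in> {0..(1 + m) * P}" for u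
  proof -
    have "u / (1 + m) \<in> {0..P}" using that m by (auto simp: field_simps)
    then have "G (u / (1 + m)) = u" using G m by simp
    then show ?thesis using R.\<phi>_G by metis
  qed
  ultimately have 1: "((\<lambda>u. k (u / (1 + m))) has_integral integral {0..P} (\<lambda>x. k x * w x)) {0..(1 + m) * P}"
    by (elim has_integral_eq[rotated]) simp
  have "((\<lambda>u. k ((1 / (1 + m)) *\<^sub>R u + 0)) has_integral (2 * pi) /\<^sub>R ((1 / (1 + m)) ^ DIM(real))) (cbox ((0 - 0) /\<^sub>R (1 / (1 + m))) ((P - 0) /\<^sub>R (1 / (1 + m))))"
    using m k_int k_total by (intro has_integral_affinity') (auto simp: has_integral_iff)
  then have 2: "((\<lambda>u. k (u / (1 + m))) has_integral 2 * pi * (1 + m)) {0..(1 + m) * P}"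
    using m by (simp add: field_simps)
  have "integral {0..P} (\<lambda>x. k x * w x) = 2 * pi * (1 + m)" using has_integral_unique[OF 1 2] .
  moreover have "integral {0..P} (\<lambda>x. k x * w x) = integral {0..P} (\<lambda>x. k x + (k x)\<^sup>2)"
    by (intro Henstock_Kurzweil_Integration.integral_cong) (simp add: wv power2_eq_square algebra_simps)
  moreover have "\<dots> = 2 * pi + integral {0..P} (\<lambda>x. (k x)\<^sup>2)"
    using k_int k2_int k_total by (simp add: Henstock_Kurzweil_Integration.integral_add)
  ultimately have "integral {0..P} (\<lambda>x. (k x)\<^sup>2) = 2 * pi * m" by (simp add: algebra_simps)
  then show ?thesis using m(2) by (simp add: power2_eq_square mult_ac)
qed

text \<open>Lax's proof: cut the curve into two arcs of equal length, rotate so that the chord between the cut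
  points is horizontal, and apply the arithmetic-geometric and Wirtinger inequalities on each arc.\<close>
lemma isoperimetric:
  shows "4 * pi * B (\<lambda>_. 1) (\<lambda>_. 1) \<le> P\<^sup>2"
    and "4 * pi * B (\<lambda>_. 1) (\<lambda>_. 1) = P\<^sup>2 \<Longrightarrow> P * integral {0..P} (\<lambda>s. (k s)\<^sup>2) = 4 * pi\<^sup>2"
proof -
  define L where "L = P / 2"
  have L: "0 < L" "L < P" "P = 2 * L" using P_pos by (auto simp: L_def)
  define \<mu> where "\<mu> = pi / L"
  have \<mu>: "\<mu> > 0" "\<mu> * L = pi" "\<mu> = pi / (L - 0)" "\<mu> = pi / (P - L)" using L by (auto simp: \<mu>_def)
  let ?X = "X (\<lambda>_. 1)" and ?Y = "Y (\<lambda>_. 1)"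
  obtain \<alpha> where \<alpha>: "- ?X L * sin \<alpha> + ?Y L * cos \<alpha> = 0"
  proof (cases "(?X L, ?Y L) = 0")
    case True then show ?thesis using that[of 0] by (simp add: zero_prod_def)
  next
    case False
    then obtain t where "(?X L, ?Y L) = norm (?X L, ?Y L) *\<^sub>R unit_dir t"
      using ex_unit_dir by blast
    then obtain n where "?X L = n * cos t" "?Y L = n * sin t" by (auto simp: unit_dir_def)
    then show ?thesis using that[of t] by simp
  qed
  define \<psi> where "\<psi> s = \<theta> s - \<alpha>" for s
  define x where "x s = ?X s * cos \<alpha> + ?Y s * sin \<alpha>" for s
  define y where "y s = - ?X s * sin \<alpha> + ?Y s * cos \<alpha>" for s
  have dX: "(?X has_field_derivative cos (\<theta> s)) (at s within {0..P})" "(?Y has_field_derivative sin (\<theta> s)) (at s within {0..P})" if "s \<in> {0..P}" for s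
    using integral_has_vector_derivative[OF trig_cont(1) that] integral_has_vector_derivative[OF trig_cont(2) that]
    by (simp_all add: X_def[abs_def] Y_def[abs_def] has_real_derivative_iff_has_vector_derivative)
  have dx: "(x has_field_derivative cos (\<psi> s)) (at s within {0..P})" if "s \<in> {0..P}" for s
    unfolding x_def \<psi>_def by (auto intro!: derivative_eq_intros dX[OF that] simp: cos_diff)
  have dy: "(y has_field_derivative sin (\<psi> s)) (at s within {0..P})" if "s \<in> {0..P}" for s
    unfolding y_def \<psi>_def by (auto intro!: derivative_eq_intros dX[OF that] simp: sin_diff)
  have y0: "y 0 = 0" "y L = 0" "y P = 0" "x 0 = 0" "x P = 0"
    using \<alpha> balanced_1 by (auto simp: y_def x_def balanced_def)
  have c\<psi>: "continuous_on {0..P} \<psi>" unfolding \<psi>_def by (intro continuous_intros \<theta>_cont)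
  have cx: "continuous_on {0..P} x" and cy: "continuous_on {0..P} y"
    using DERIV_continuous_on[OF dx] DERIV_continuous_on[OF dy] by auto
  have h: "height (\<lambda>_. 1) s = x s * sin (\<psi> s) - y s * cos (\<psi> s)" for s
  proof -
    have sc: "sin \<alpha> * sin \<alpha> + cos \<alpha> * cos \<alpha> = 1"
      using sin_cos_squared_add[of \<alpha>] by (simp only: power2_eq_square)
    have "x s * sin (\<psi> s) - y s * cos (\<psi> s) = (?X s * sin (\<theta> s) - ?Y s * cos (\<theta> s)) * (sin \<alpha> * sin \<alpha> + cos \<alpha> * cos \<alpha>)"
      unfolding x_def y_def \<psi>_def sin_diff cos_diff by algebra
    then show ?thesis unfolding sc by (simp add: height_def)
  qed
  have ic: "(\<lambda>s. x s * sin (\<psi> s)) integrable_on {0..P}" "(\<lambda>s. y s * cos (\<psi> s)) integrable_on {0..P}"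
    by (intro integrable_continuous_real continuous_intros cx cy c\<psi>)+
  have "((\<lambda>s. x s * sin (\<psi> s) + y s * cos (\<psi> s)) has_integral x P * y P - x 0 * y 0) {0..P}"
  proof (rule fundamental_theorem_of_calculus)
    fix s assume s: "s \<in> {0..P}"
    have "((\<lambda>s. x s * y s) has_field_derivative x s * sin (\<psi> s) + y s * cos (\<psi> s)) (at s within {0..P})"
      by (auto intro!: derivative_eq_intros dx[OF s] dy[OF s])
    then show "((\<lambda>s. x s * y s) has_vector_derivative x s * sin (\<psi> s) + y s * cos (\<psi> s)) (at s within {0..P})"
      by (simp add: has_real_derivative_iff_has_vector_derivative)
  qed (use P_pos in auto)
  then have parts: "integral {0..P} (\<lambda>s. x s * sin (\<psi> s)) = - integral {0..P} (\<lambda>s. y s * cos (\<psi> s))"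
    using y0 ic by (simp add: has_integral_iff Henstock_Kurzweil_Integration.integral_add)
  have Beq: "B (\<lambda>_. 1) (\<lambda>_. 1) = - integral {0..P} (\<lambda>s. y s * cos (\<psi> s))"
    unfolding B_def h using ic parts by (simp add: Henstock_Kurzweil_Integration.integral_diff)
  define W where "W a b = integral {a..b} (\<lambda>s. (sin (\<psi> s))\<^sup>2 - \<mu>\<^sup>2 * (y s)\<^sup>2)" for a b
  define Z where "Z = integral {0..P} (\<lambda>s. (cos (\<psi> s) + \<mu> * y s)\<^sup>2)"
  have iW: "(\<lambda>s. (sin (\<psi> s))\<^sup>2 - \<mu>\<^sup>2 * (y s)\<^sup>2) integrable_on {0..P}"
    by (intro integrable_continuous_real continuous_intros cy c\<psi>)
  have cZ: "continuous_on {0..P} (\<lambda>s. (cos (\<psi> s) + \<mu> * y s)\<^sup>2)"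
    by (intro continuous_intros cy c\<psi>)
  have iZ: "(\<lambda>s. (cos (\<psi> s) + \<mu> * y s)\<^sup>2) integrable_on {0..P}" by (rule integrable_continuous_real[OF cZ])
  have sub: "(y has_field_derivative sin (\<psi> s)) (at s within {a..b})" if "s \<in> {a..b}" "0 \<le> a" "b \<le> P" for s a b
    using that by (intro DERIV_subset[OF dy]) auto
  have csin: "continuous_on {a..b} (\<lambda>s. sin (\<psi> s))" if "0 \<le> a" "b \<le> P" for a b
    using that by (intro continuous_intros continuous_on_subset[OF c\<psi>]) auto
  \<comment> \<open>The arithmetic-geometric inequality kept as an identity:
    \<open>- 2 \<mu> y cos \<psi>\<close> is \<open>1\<close> minus the Wirtinger integrand minus
    the square \<open>(cos \<psi> + \<mu> y)^2\<close>. Retaining these terms is what settles the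
    equality case.\<close>
  have "2 * \<mu> * B (\<lambda>_. 1) (\<lambda>_. 1) = integral {0..P} (\<lambda>s. 1 - ((sin (\<psi> s))\<^sup>2 - \<mu>\<^sup>2 * (y s)\<^sup>2) - (cos (\<psi> s) + \<mu> * y s)\<^sup>2)"
  proof -
    have "1 - ((sin (\<psi> s))\<^sup>2 - \<mu>\<^sup>2 * (y s)\<^sup>2) - (cos (\<psi> s) + \<mu> * y s)\<^sup>2 = (- 2 * \<mu>) * (y s * cos (\<psi> s))" for s
      by (simp add: sin_squared_eq power2_sum power_mult_distrib algebra_simps)
    then show ?thesis unfolding Beq by simp
  qed
  also have "\<dots> = P - integral {0..P} (\<lambda>s. (sin (\<psi> s))\<^sup>2 - \<mu>\<^sup>2 * (y s)\<^sup>2) - Z"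
    using iW iZ P_pos by (simp only: Z_def Henstock_Kurzweil_Integration.integral_diff integrable_diff integrable_const_ivl int_1)
  also have "integral {0..P} (\<lambda>s. (sin (\<psi> s))\<^sup>2 - \<mu>\<^sup>2 * (y s)\<^sup>2) = W 0 L + W L P"
    using Henstock_Kurzweil_Integration.integral_combine[of 0 L P, OF _ _ iW] L by (simp add: W_def)
  finally have "P * (2 * \<mu> * B (\<lambda>_. 1) (\<lambda>_. 1)) = P * (P - (W 0 L + W L P) - Z)" by simp
  moreover have p4: "P * (2 * \<mu>) = 4 * pi" using \<mu>(2) L(3) by (simp add: mult_ac)
  ultimately have main: "4 * pi * B (\<lambda>_. 1) (\<lambda>_. 1) = P\<^sup>2 - P * (W 0 L + W L P + Z)"
    unfolding p4[symmetric] by (simp add: power2_eq_square algebra_simps)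
  have W1: "W 0 L \<ge> 0"
    unfolding W_def \<mu>(3) by (rule wirtinger(1)) (use L y0 sub csin in auto)
  have W2: "W L P \<ge> 0"
    unfolding W_def \<mu>(4) by (rule wirtinger(1)) (use L y0 sub csin in auto)
  have Z0: "Z \<ge> 0" unfolding Z_def by (rule integral_nonneg[OF iZ]) simp
  show "4 * pi * B (\<lambda>_. 1) (\<lambda>_. 1) \<le> P\<^sup>2"
    using main W1 W2 Z0 P_pos by simp
  assume "4 * pi * B (\<lambda>_. 1) (\<lambda>_. 1) = P\<^sup>2"
  then have "W 0 L + W L P + Z = 0" using main P_pos by simp
  then have eq: "W 0 L = 0" "W L P = 0" "Z = 0" using W1 W2 Z0 by auto
  have cosy: "cos (\<psi> s) = - \<mu> * y s" if "s \<in> {0..P}" for s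
  proof -
    have "(cos (\<psi> s) + \<mu> * y s)\<^sup>2 = 0"
      using integral_eq_0_iff[OF cZ P_pos] eq(3) that by (auto simp: Z_def)
    then show ?thesis by simp
  qed
  \<comment> \<open>Equality in Wirtinger gives
    \<open>sin \<psi> sin (\<mu> s) = \<mu> y cos (\<mu> s)\<close>. Together with
    \<open>cos \<psi> = - \<mu> y\<close> the two terms of the addition formula cancel.\<close>
  have g1: "cos (\<psi> s - \<mu> * s) = 0" if "s \<in> {0<..<L}" for s
  proof -
    have "sin (\<psi> s) * sin (\<mu> * (s - 0)) = \<mu> * y s * cos (\<mu> * (s - 0))"
      unfolding \<mu>(3) by (rule wirtinger(2)[where b = L]) (use L y0 sub csin eq(1) that \<mu>(3) in \<open>auto simp: W_def\<close>)
    then show ?thesis using cosy[of s] that L by (simp add: cos_diff)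
  qed
  have g2: "cos (\<psi> s - \<mu> * s) = 0" if "s \<in> {L<..<P}" for s
  proof -
    have "sin (\<psi> s) * sin (\<mu> * (s - L)) = \<mu> * y s * cos (\<mu> * (s - L))"
      unfolding \<mu>(4) by (rule wirtinger(2)[where b = P]) (use L y0 sub csin eq(2) that \<mu>(4) in \<open>auto simp: W_def\<close>)
    then have "cos (\<psi> s - \<mu> * (s - L)) = 0" using cosy[of s] that L by (simp add: cos_diff)
    \<comment> \<open>On the second arc the phase starts at \<open>L\<close>, and
      \<open>\<mu> L = pi\<close> only changes the sign of the cosine.\<close>
    moreover have "\<psi> s - \<mu> * (s - L) = (\<psi> s - \<mu> * s) + pi" using \<mu>(2) by (simp add: algebra_simps)
    ultimately show ?thesis by simp
  qed
  have muP: "\<mu> * P = 2 * pi" using \<mu>(2) L(3) by simp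
  have g: "cos (\<psi> s - \<mu> * s) = 0" if s: "s \<in> {0..P}" for s
  proof -
    consider "s \<in> {0<..<L}" | "s \<in> {L<..<P}" | "s = 0" | "s = L" | "s = P"
      using s unfolding greaterThanLessThan_iff atLeastAtMost_iff by linarith
    then show ?thesis
    proof cases
      case 3 then show ?thesis using cosy[of 0] y0 P_pos by simp
    next
      case 4 then show ?thesis using cosy[of L] y0 L \<mu>(2) by (simp add: cos_diff)
    next
      case 5 then show ?thesis using cosy[of P] y0 P_pos muP by (simp add: cos_diff)
    qed (use g1 g2 in auto)
  qed
  have cg: "continuous_on {0..P} (\<lambda>s. \<psi> s - \<mu> * s)" by (intro continuous_intros c\<psi>)
  have "integral {0..s} k = 2 * pi / P * s" if "s \<in> {0..P}" for s
  proof -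
    have "\<psi> s - \<mu> * s = \<psi> 0 - \<mu> * 0" by (rule cos_zero_imp_constant[OF cg g that])
    then have "integral {0..s} k = \<mu> * s" by (simp add: \<psi>_def \<theta>_eq)
    then show ?thesis using muP P_pos by (simp add: field_simps)
  qed
  then show "P * integral {0..P} (\<lambda>s. (k s)\<^sup>2) = 4 * pi\<^sup>2" by (rule energy_if_affine)
qed

end

lemma E_set_bounds:
  assumes "(x, y) \<in> E_set"
  shows "x \<le> 1" "1 \<le> y" "x = 1 \<Longrightarrow> y = 1"
proof -
  obtain P k \<theta>0 where k: "closed_curvature P k \<theta>0"
    and x: "x = 4 * pi * area_form P (tangent_angle \<theta>0 k) (\<lambda>_. 1) (\<lambda>_. 1) / P\<^sup>2"
    and y: "y = elastic_energy P k * P / (2 * pi\<^sup>2)"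
    using assms unfolding E_set_iff by blast
  interpret curvature P k \<theta>0 by standard (rule k)
  have xB: "x = 4 * pi * B (\<lambda>_. 1) (\<lambda>_. 1) / P\<^sup>2" using x by (simp add: area_form_eq \<theta>_def[symmetric])
  have yE: "y = P * integral {0..P} (\<lambda>s. (k s)\<^sup>2) / (4 * pi\<^sup>2)" by (simp add: y elastic_energy_def)
  show "x \<le> 1" using isoperimetric(1) P_pos by (simp add: xB)
  show "1 \<le> y" using energy_ge by (simp add: yE)
  assume "x = 1"
  then show "y = 1" using isoperimetric(2) P_pos by (simp add: xB yE field_simps)
qed

section \<open>The circle, nearby curves and the half-line x = 1\<close>

text \<open>The frequency 2 makes the curve centrally symmetric: the angle advances by
  \<open>pi\<close> over half the length, so the integrals of \<open>sin\<close> and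
  \<open>cos\<close> over the two halves cancel. The value \<open>e = 0\<close> is the unit circle,
  and small \<open>e > 0\<close> gives energies just above 1.\<close>

lemma closed_curvature_near_circle:
  fixes e :: real
  assumes e: "0 \<le> e" "e < 1"
  defines "k \<equiv> \<lambda>s. 1 + e * cos (2 * s)"
  shows "closed_curvature (2 * pi) k 0" "elastic_energy (2 * pi) k * (2 * pi) / (2 * pi\<^sup>2) = 1 + e\<^sup>2 / 2"
proof -
  have k0: "k s \<ge> 0" for s
  proof -
    have "\<bar>e * cos (2 * s)\<bar> \<le> 1 * 1" unfolding abs_mult using e by (intro mult_mono) auto
    then show ?thesis unfolding k_def by linarith
  qed
  have kc: "continuous_on A k" for A unfolding k_def by (intro continuous_intros)
  have ki: "(k has_integral s + e / 2 * sin (2 * s)) {0..s}" if "0 \<le> s" for s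
  proof -
    have "(k has_integral (s + e / 2 * sin (2 * s)) - (0 + e / 2 * sin (2 * 0))) {0..s}"
      by (rule fundamental_theorem_of_calculus)
        (use that in \<open>auto intro!: derivative_eq_intros simp: k_def has_real_derivative_iff_has_vector_derivative[symmetric]\<close>)
    then show ?thesis by simp
  qed
  have k2: "((\<lambda>s. (k s)\<^sup>2) has_integral 2 * pi + e\<^sup>2 * pi) {0..2 * pi}"
  proof -
    let ?F = "\<lambda>s. s + e * sin (2 * s) + e\<^sup>2 * (s / 2 + sin (4 * s) / 8)"
    have "((\<lambda>s. (k s)\<^sup>2) has_integral ?F (2 * pi) - ?F 0) {0..2 * pi}"
    proof (rule fundamental_theorem_of_calculus)
      fix s :: real
      have "(?F has_field_derivative 1 + 2 * e * cos (2 * s) + e\<^sup>2 * (1 / 2 + cos (4 * s) / 2)) (at s within {0..2 * pi})"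
        by (auto intro!: derivative_eq_intros)
      moreover have c4: "cos (4 * s) = 2 * (cos (2 * s))\<^sup>2 - 1" using cos_double_cos[of "2 * s"] by simp
      have "1 + 2 * e * cos (2 * s) + e\<^sup>2 * (1 / 2 + cos (4 * s) / 2) = (k s)\<^sup>2"
        unfolding k_def c4 by (simp add: power2_eq_square field_simps)
      ultimately show "(?F has_vector_derivative (k s)\<^sup>2) (at s within {0..2 * pi})"
        by (simp add: has_real_derivative_iff_has_vector_derivative)
    qed simp
    moreover have "sin (4 * (2 * pi)) = 0" "sin (2 * (2 * pi)) = 0"
      using sin_npi[of 8] sin_npi[of 4] by (simp_all add: mult.commute)
    ultimately show ?thesis by simp
  qed
  define \<theta> where "\<theta> s = s + e / 2 * sin (2 * s)" for s
  have ang: "tangent_angle 0 k s = \<theta> s" if "0 \<le> s" for s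
    using ki[OF that] by (simp add: tangent_angle_def \<theta>_def integral_unique)
  have shift: "\<theta> (s + pi) = \<theta> s + pi" for s
    using sin_periodic[of "2 * s"] by (simp add: \<theta>_def distrib_left)
  have zero: "integral {0..2 * pi} (\<lambda>s. f (\<theta> s)) = 0" if f: "\<And>x. f (x + pi) = - f x" "\<And>A. continuous_on A f" for f :: "real \<Rightarrow> real"
  proof -
    have c: "continuous_on A (\<lambda>s. f (\<theta> s))" for A
      by (rule continuous_on_compose2[OF f(2)[of UNIV]]) (auto simp: \<theta>_def intro!: continuous_intros)
    have "integral {0..2 * pi} (\<lambda>s. f (\<theta> s)) = integral {0..pi} (\<lambda>s. f (\<theta> s)) + integral {pi..2 * pi} (\<lambda>s. f (\<theta> s))"
      by (rule Henstock_Kurzweil_Integration.integral_combine[symmetric]) (auto intro: integrable_continuous_real c)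
    also have "integral {pi..2 * pi} (\<lambda>s. f (\<theta> s)) = integral {0..pi} (\<lambda>s. f (\<theta> (s + pi)))"
      using integral_shift[of 0 pi pi "\<lambda>s. f (\<theta> s)"] c by (simp add: o_def)
    finally show ?thesis using f(1) by (simp add: shift)
  qed
  have "integral {0..2 * pi} (\<lambda>s. cos (tangent_angle 0 k s)) = integral {0..2 * pi} (\<lambda>s. cos (\<theta> s))"
    "integral {0..2 * pi} (\<lambda>s. sin (tangent_angle 0 k s)) = integral {0..2 * pi} (\<lambda>s. sin (\<theta> s))"
    using ang by (auto intro!: Henstock_Kurzweil_Integration.integral_cong)
  then have "integral {0..2 * pi} (\<lambda>s. cos (tangent_angle 0 k s)) = 0" "integral {0..2 * pi} (\<lambda>s. sin (tangent_angle 0 k s)) = 0"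
    using zero[of cos, OF _ continuous_on_cos[OF continuous_on_id]] zero[of sin, OF _ continuous_on_sin[OF continuous_on_id]] by auto
  moreover have "integral {0..2 * pi} k = 2 * pi"
    using ki[of "2 * pi"] sin_npi[of 4] by (simp add: integral_unique mult.commute)
  moreover have "k integrable_on {0..2 * pi}" "(\<lambda>s. (k s)\<^sup>2) integrable_on {0..2 * pi}"
    using ki[of "2 * pi"] k2 by (auto simp: has_integral_iff)
  ultimately show "closed_curvature (2 * pi) k 0"
    using k0 borel_measurable_continuous_onI[OF kc] by (simp add: closed_curvature_def)
  show "elastic_energy (2 * pi) k * (2 * pi) / (2 * pi\<^sup>2) = 1 + e\<^sup>2 / 2"
    using k2 by (simp add: elastic_energy_def integral_unique power2_eq_square field_simps)
qed

lemma circle_in_E_set: "(1, 1) \<in> E_set"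
proof -
  have c: "closed_curvature (2 * pi) (\<lambda>_. 1) 0" "elastic_energy (2 * pi) (\<lambda>_. 1) * (2 * pi) / (2 * pi\<^sup>2) = 1"
    using closed_curvature_near_circle[of 0] by auto
  interpret curvature "2 * pi" "\<lambda>_. 1" 0 by standard (rule c(1))
  have "4 * pi * area_form (2 * pi) (tangent_angle 0 (\<lambda>_. 1)) (\<lambda>_. 1) (\<lambda>_. 1) / (2 * pi)\<^sup>2 = 1"
    using B_k_left[OF balanced_1] by (simp add: area_form_eq[unfolded \<theta>_def] power2_eq_square)
  then show ?thesis unfolding E_set_iff using c by metis
qed

text \<open>No area is computed: the energy coordinate exceeds 1, so the equality case of the
  isoperimetric inequality excludes \<open>x = 1\<close>.\<close>

lemma near_circle_in_E_set:
  assumes "0 < e" "e < 1"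
  obtains x where "x < 1" "(x, 1 + e\<^sup>2 / 2) \<in> E_set"
proof -
  let ?k = "\<lambda>s. 1 + e * cos (2 * s)"
  define x where "x = 4 * pi * area_form (2 * pi) (tangent_angle 0 ?k) (\<lambda>_. 1) (\<lambda>_. 1) / (2 * pi)\<^sup>2"
  have E: "(x, 1 + e\<^sup>2 / 2) \<in> E_set"
    unfolding E_set_iff using closed_curvature_near_circle[of e] assms x_def
    by - (rule exI[of _ "2 * pi"], rule exI[of _ ?k], rule exI[of _ 0], simp)
  moreover have "x \<noteq> 1" using E_set_bounds(3)[OF E] assms by auto
  ultimately show thesis using E_set_bounds(1)[OF E] that[of x] by auto
qed

lemma E_set_upper_right:
  assumes "(x0, y0) \<in> E_set" "x0 \<le> x" "x < 1" "y0 \<le> y"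
  shows "(x, y) \<in> E_set"
proof -
  obtain y1 where "y1 \<le> y0" "(x, y1) \<in> E_set" using E_set_increase_x[OF assms(1-3)] by blast
  then show ?thesis using E_set_increase_y[of x y1 y] assms by auto
qed

text \<open>The point to be approximated may be \<open>(1, 1)\<close> itself, so seed points with
  \<open>x < 1\<close> and energy as close to 1 as desired are needed; the near-circles provide
  them, and the upper right quadrant does the rest.\<close>

lemma closure_E_set:
  assumes "s \<ge> 1"
  shows "(1, s) \<in> closure E_set"
  unfolding closure_approachable
proof (intro allI impI)
  fix d :: real assume d: "d > 0"
  define e where "e = min (1 / 2) d"
  have e: "0 < e" "e < 1" "e \<le> d" using d by (auto simp: e_def)
  obtain x0 where x0: "x0 < 1" "(x0, 1 + e\<^sup>2 / 2) \<in> E_set" using near_circle_in_E_set[OF e(1,2)] by blast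
  define x where "x = max x0 (1 - d / 4)"
  have x: "x0 \<le> x" "x < 1" "1 - x \<le> d / 4" using x0 d by (auto simp: x_def max_def field_simps)
  have "(x, s + e\<^sup>2 / 2) \<in> E_set" by (rule E_set_upper_right[OF x0(2) x(1,2)]) (use assms in simp)
  moreover have "dist (x, s + e\<^sup>2 / 2) (1, s) < d"
  proof -
    have "e\<^sup>2 \<le> e * 1" unfolding power2_eq_square using e by (intro mult_left_mono) auto
    have "dist (x, s + e\<^sup>2 / 2) (1, s) = sqrt ((x - 1)\<^sup>2 + (e\<^sup>2 / 2)\<^sup>2)" by (simp add: dist_Pair_Pair dist_real_def)
    also have "\<dots> \<le> \<bar>x - 1\<bar> + \<bar>e\<^sup>2 / 2\<bar>" by (rule sqrt_sum_squares_le_sum_abs)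
    also have "\<dots> \<le> d / 4 + d / 2" using x e \<open>e\<^sup>2 \<le> e * 1\<close> by auto
    also have "\<dots> < d" using d by simp
    finally show ?thesis .
  qed
  ultimately show "\<exists>y\<in>E_set. dist y (1, s) < d" by blast
qed

text \<open>An interior point on this line would have to be \<open>(1, 1)\<close>, and then the set
  would also contain points below the energy bound 1.\<close>

lemma not_interior_E_set: "(1, s) \<notin> interior E_set"
proof
  assume i: "(1, s) \<in> interior E_set"
  then have s: "s = 1" using interior_subset E_set_bounds(3) by blast
  obtain d where d: "d > 0" "ball (1, s) d \<subseteq> E_set" using i mem_interior by blast
  have "dist (1, s) (1, s - d / 2) < d" using d(1) by (simp add: dist_Pair_Pair dist_real_def)
  then have "(1, s - d / 2) \<in> E_set" using d(2) by (auto simp: subset_iff)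
  from E_set_bounds(2)[OF this] show False using s d(1) by simp
qed

theorem mainTheorem14:
  shows "(\<forall>x0 y0. (x0, y0) \<in> E_set \<longrightarrow> {x0..<1} \<times> {y0..} \<subseteq> E_set)
     \<and> {(1, s) | s::real. s \<ge> 1} \<subseteq> frontier E_set
     \<and> E_set \<inter> {(1, s) | s::real. s \<ge> 1} = {(1, 1)}"
proof (intro conjI allI impI)
  fix x0 y0 assume "(x0, y0) \<in> E_set"
  then show "{x0..<1} \<times> {y0..} \<subseteq> E_set" using E_set_upper_right by auto
next
  show "{(1, s) | s::real. s \<ge> 1} \<subseteq> frontier E_set"
    using closure_E_set not_interior_E_set by (auto simp: frontier_def)
next
  show "E_set \<inter> {(1, s) | s::real. s \<ge> 1} = {(1, 1)}"
    using circle_in_E_set E_set_bounds(3) by auto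
qed

end
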